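(* Let $G$ be a group and let $X$ be a conjugacy class of $G$. Assume that $X$ is finite, has more than one element, and generates $G$. Regard $X$ as a rack via $x\triangleright y=xyx^{-1}$, and for $n\ge 1$ let $k_n$ be the number of $j\in X$ such that the orbit $\mathcal{O}(i,j)$ has exactly $n$ elements, where $i\in X$ is any fixed element ($k_n$ does not depend on $i$). The following are equivalent. (1) $\displaystyle\sum_{n\ge3}\frac{n-2}{2n}k_{n}\leq1$. (2) The rack $X$ is isomorphic to one of the racks $\mathbb{D}_3$, $\mathcal{T}$, $\mathrm{Aff}(5,2)$, $\mathrm{Aff}(5,3)$, $\mathcal{A}$, $\mathcal{B}$, $\mathrm{Aff}(7,3)$, $\mathrm{Aff}(7,5)$, $\mathcal{C}$.
   Context: A rack is a non-empty set $X$ with an operation $\triangleright:X\times X\to X$ such that each map $\varphi_i:X\to X$, $x\mapsto i\triangleright x$, is bijective and $i\triangleright(j\triangleright k)=(i\triangleright j)\triangleright(i\triangleright k)$ for all $i,j,k\in X$. Rack morphisms are maps $f$ with $f(i\triangleright j)=f(i)\triangleright f(j)$. For a finite conjugacy class $X$, let $c:X\times X\to X\times X$, $c(i,j)=(i\triangleright j,i)$, which is a bijection, and let $\mathcal{O}(i,j)=\{c^m(i,j)\mid m\in\mathbb{Z}\}$. The racks in (2): - $\mathbb{D}_3$: the conjugacy class of involutions in the dihedral group with $6$ elements. - $\mathcal{T}$: the conjugacy class of $(2\,3\,4)$ in the alternating group $\mathbb{A}_4$. - $\mathcal{A}$: the conjugacy class of $(1\,2)$ in $\mathbb{S}_4$.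 - $\mathcal{B}$: the rack $\{1,\dots,6\}$ with $\varphi_1=(2\,3\,4\,5)$, $\varphi_2=(1\,5\,6\,3)$, $\varphi_3=(1\,2\,6\,4)$, $\varphi_4=(1\,3\,6\,5)$, $\varphi_5=(1\,4\,6\,2)$, $\varphi_6=(2\,5\,4\,3)$; it can be realized as the conjugacy class of $4$-cycles in $\mathbb{S}_4$. - $\mathcal{C}$: the conjugacy class of $(1\,2)$ in $\mathbb{S}_5$. - $\mathrm{Aff}(q,\alpha)$, for $0\neq\alpha\in\mathbb{F}_q$: the set $\mathbb{F}_q$ with $x\triangleright y=(1-\alpha)x+\alpha y$. Conjugacy classes are racks via $x\triangleright y=xyx^{-1}$. *)

theory Defs
  imports "HOL-Algebra.Sym_Groups" "HOL-Number_Theory.Residues" "HOL-Analysis.Infinite_Sum"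
begin

section \<open>Racks\<close>

record 'a rack = "'a partial_object" +
  rack_op :: "'a \<Rightarrow> 'a \<Rightarrow> 'a" (infixl "\<rhd>\<index>" 70)

definition is_rack :: "('a, 'b) rack_scheme \<Rightarrow> bool" where
  "is_rack R \<longleftrightarrow>
     carrier R \<noteq> {} \<and>
     (\<forall>i\<in>carrier R. bij_betw (\<lambda>x. i \<rhd>\<^bsub>R\<^esub> x) (carrier R) (carrier R)) \<and>
     (\<forall>i\<in>carrier R. \<forall>j\<in>carrier R. \<forall>k\<in>carrier R.
        i \<rhd>\<^bsub>R\<^esub> (j \<rhd>\<^bsub>R\<^esub> k) = (i \<rhd>\<^bsub>R\<^esub> j) \<rhd>\<^bsub>R\<^esub> (i \<rhd>\<^bsub>R\<^esub> k))"

definition rack_hom :: "('a, 'c) rack_scheme \<Rightarrow> ('b, 'd) rack_scheme \<Rightarrow> ('a \<Rightarrow> 'b) set" where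
  "rack_hom R S =
     {f \<in> carrier R \<rightarrow> carrier S.
        \<forall>i\<in>carrier R. \<forall>j\<in>carrier R. f (i \<rhd>\<^bsub>R\<^esub> j) = f i \<rhd>\<^bsub>S\<^esub> f j}"

definition rack_isomorphic :: "('a, 'c) rack_scheme \<Rightarrow> ('b, 'd) rack_scheme \<Rightarrow> bool"
    (infix "\<cong>\<^sub>R" 50) where
  "R \<cong>\<^sub>R S \<longleftrightarrow> (\<exists>f \<in> rack_hom R S. bij_betw f (carrier R) (carrier S))"

definition hurwitz_map :: "('a, 'b) rack_scheme \<Rightarrow> 'a \<times> 'a \<Rightarrow> 'a \<times> 'a" where
  "hurwitz_map R = (\<lambda>(i, j). (i \<rhd>\<^bsub>R\<^esub> j, i))"

text \<open>
  The map \<open>c(i, j) = (i \<rhd> j, i)\<close> is in general a bijection only of the square of the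
  carrier (cf. \<open>bij_betw_hurwitz_map\<close>), so negative powers use the inverse relative to that set.
\<close>

definition hurwitz_power :: "('a, 'b) rack_scheme \<Rightarrow> int \<Rightarrow> 'a \<times> 'a \<Rightarrow> 'a \<times> 'a" where
  "hurwitz_power R m =
     (if m \<ge> 0 then hurwitz_map R ^^ nat m
      else inv_into (carrier R \<times> carrier R) (hurwitz_map R) ^^ nat (- m))"

definition hurwitz_orbit :: "('a, 'b) rack_scheme \<Rightarrow> 'a \<Rightarrow> 'a \<Rightarrow> ('a \<times> 'a) set" where
  "hurwitz_orbit R i j = {hurwitz_power R m (i, j) | m :: int. True}"

definition hurwitz_orbit_count :: "('a, 'b) rack_scheme \<Rightarrow> 'a \<Rightarrow> nat \<Rightarrow> nat" where
  "hurwitz_orbit_count R i n = card {j \<in> carrier R. card (hurwitz_orbit R i j) = n}"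


section \<open>Conjugacy classes as racks\<close>

definition conjugacy_class :: "('a, 'b) monoid_scheme \<Rightarrow> 'a \<Rightarrow> 'a set" where
  "conjugacy_class G x = {g \<otimes>\<^bsub>G\<^esub> x \<otimes>\<^bsub>G\<^esub> inv\<^bsub>G\<^esub> g | g. g \<in> carrier G}"

definition is_conjugacy_class :: "('a, 'b) monoid_scheme \<Rightarrow> 'a set \<Rightarrow> bool" where
  "is_conjugacy_class G X \<longleftrightarrow> (\<exists>x\<in>carrier G. X = conjugacy_class G x)"

definition conjugation_rack :: "('a, 'b) monoid_scheme \<Rightarrow> 'a set \<Rightarrow> 'a rack" where
  "conjugation_rack G X =
     \<lparr>carrier = X, rack_op = (\<lambda>x y. x \<otimes>\<^bsub>G\<^esub> y \<otimes>\<^bsub>G\<^esub> inv\<^bsub>G\<^esub> x)\<rparr>"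


section \<open>The racks in the classification\<close>

text \<open>
  The dihedral group with \<open>2n\<close> elements: \<open>(a, s)\<close> stands for \<open>r\<^sup>a\<close> if \<open>s\<close> is false and for
  \<open>r\<^sup>a t\<close> if \<open>s\<close> is true, where \<open>r\<^sup>n = t\<^sup>2 = 1\<close> and \<open>t r = r\<^sup>-\<^sup>1 t\<close>.
\<close>

definition dihedral_group :: "nat \<Rightarrow> (int \<times> bool) monoid" where
  "dihedral_group n =
     \<lparr>carrier = {0..<int n} \<times> UNIV,
      mult = (\<lambda>(a, s) (b, t). ((if s then a - b else a + b) mod int n, s \<noteq> t)),
      one = (0, False)\<rparr>"

definition D3_rack :: "(int \<times> bool) rack" where
  "D3_rack = (let D = dihedral_group 3 in
     conjugation_rack D {x \<in> carrier D. x \<noteq> \<one>\<^bsub>D\<^esub> \<and> x \<otimes>\<^bsub>D\<^esub> x = \<one>\<^bsub>D\<^esub>})"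

definition T_rack :: "(nat \<Rightarrow> nat) rack" where
  "T_rack = conjugation_rack (alt_group 4)
     (conjugacy_class (alt_group 4) (cycle_of_list [2, 3, 4]))"

definition A_rack :: "(nat \<Rightarrow> nat) rack" where
  "A_rack = conjugation_rack (sym_group 4)
     (conjugacy_class (sym_group 4) (cycle_of_list [1, 2]))"

definition B_perm :: "nat \<Rightarrow> nat \<Rightarrow> nat" where
  "B_perm i = cycle_of_list
     ([[2, 3, 4, 5], [1, 5, 6, 3], [1, 2, 6, 4], [1, 3, 6, 5], [1, 4, 6, 2], [2, 5, 4, 3]] ! (i - 1))"

definition B_rack :: "nat rack" where
  "B_rack = \<lparr>carrier = {1..6}, rack_op = B_perm\<rparr>"

definition C_rack :: "(nat \<Rightarrow> nat) rack" where
  "C_rack = conjugation_rack (sym_group 5)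
     (conjugacy_class (sym_group 5) (cycle_of_list [1, 2]))"

definition affine_rack :: "('a, 'b) ring_scheme \<Rightarrow> 'a \<Rightarrow> 'a rack" where
  "affine_rack F \<alpha> =
     \<lparr>carrier = carrier F,
      rack_op = (\<lambda>x y. (\<one>\<^bsub>F\<^esub> \<ominus>\<^bsub>F\<^esub> \<alpha>) \<otimes>\<^bsub>F\<^esub> x \<oplus>\<^bsub>F\<^esub> \<alpha> \<otimes>\<^bsub>F\<^esub> y)\<rparr>"


section \<open>Consistency of the definitions\<close>

lemma bij_betw_hurwitz_map:
  assumes "is_rack R"
  shows "bij_betw (hurwitz_map R) (carrier R \<times> carrier R) (carrier R \<times> carrier R)"
proof -
  have b: "bij_betw (\<lambda>x. i \<rhd>\<^bsub>R\<^esub> x) (carrier R) (carrier R)" if "i \<in> carrier R" for i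
    using assms that by (auto simp: is_rack_def)
  have inj: "inj_on (hurwitz_map R) (carrier R \<times> carrier R)"
    using b by (auto simp: inj_on_def hurwitz_map_def bij_betw_def)
  have "hurwitz_map R ` (carrier R \<times> carrier R) = carrier R \<times> carrier R"
  proof (intro equalityI subsetI)
    fix p assume "p \<in> hurwitz_map R ` (carrier R \<times> carrier R)"
    then show "p \<in> carrier R \<times> carrier R"
      using b by (force simp: hurwitz_map_def bij_betw_def)
  next
    fix p assume "p \<in> carrier R \<times> carrier R"
    then obtain a i where p: "p = (a, i)" "a \<in> carrier R" "i \<in> carrier R" by auto
    then obtain j where "j \<in> carrier R" "a = i \<rhd>\<^bsub>R\<^esub> j"
      using b[of i] by (auto simp: bij_betw_def)
    then show "p \<in> hurwitz_map R ` (carrier R \<times> carrier R)"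
      using p by (auto simp: hurwitz_map_def intro!: image_eqI[of _ _ "(i, j)"])
  qed
  with inj show ?thesis by (simp add: bij_betw_def)
qed

lemma (in group) conjugacy_class_subset:
  "x \<in> carrier G \<Longrightarrow> conjugacy_class G x \<subseteq> carrier G"
  by (auto simp: conjugacy_class_def)

lemma (in group) conj_conj:
  assumes "g \<in> carrier G" "h \<in> carrier G" "x \<in> carrier G"
  shows "g \<otimes> (h \<otimes> x \<otimes> inv h) \<otimes> inv g = (g \<otimes> h) \<otimes> x \<otimes> inv (g \<otimes> h)"
  using assms by (simp add: m_assoc inv_mult_group)

lemma (in group) conj_automorphism:
  assumes X: "is_conjugacy_class G X" and g: "g \<in> carrier G"
  shows "bij_betw (\<lambda>y. g \<otimes> y \<otimes> inv g) X X"
    and "\<And>x y. \<lbrakk>x \<in> X; y \<in> X\<rbrakk> \<Longrightarrow>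
      g \<otimes> (x \<otimes> y \<otimes> inv x) \<otimes> inv g =
      (g \<otimes> x \<otimes> inv g) \<otimes> (g \<otimes> y \<otimes> inv g) \<otimes> inv (g \<otimes> x \<otimes> inv g)"
proof -
  obtain x0 where x0: "x0 \<in> carrier G" "X = conjugacy_class G x0"
    using X by (auto simp: is_conjugacy_class_def)
  have sub: "X \<subseteq> carrier G" using x0 conjugacy_class_subset by simp
  have closed: "h \<otimes> y \<otimes> inv h \<in> X" if h: "h \<in> carrier G" and "y \<in> X" for h y
  proof -
    obtain k where "k \<in> carrier G" "y = k \<otimes> x0 \<otimes> inv k"
      using \<open>y \<in> X\<close> x0 by (auto simp: conjugacy_class_def)
    then show ?thesis using h x0 conj_conj[of h k x0]
      by (auto simp: conjugacy_class_def intro!: exI[of _ "h \<otimes> k"])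
  qed
  have cancel: "h \<otimes> (k \<otimes> y \<otimes> inv k) \<otimes> inv h = y"
    if "h \<in> carrier G" "k \<in> carrier G" "h \<otimes> k = \<one>" "y \<in> X" for h k y
    using that sub conj_conj[of h k y] by auto
  show "bij_betw (\<lambda>y. g \<otimes> y \<otimes> inv g) X X"
    by (rule bij_betw_byWitness[where f' = "\<lambda>y. inv g \<otimes> y \<otimes> inv (inv g)"])
       (use g closed[OF g] closed[of "inv g"] cancel[of "inv g" g] cancel[of g "inv g"] in auto)
  fix x y assume xy: "x \<in> X" "y \<in> X"
  then have c: "x \<in> carrier G" "y \<in> carrier G" using sub by auto
  show "g \<otimes> (x \<otimes> y \<otimes> inv x) \<otimes> inv g =
      (g \<otimes> x \<otimes> inv g) \<otimes> (g \<otimes> y \<otimes> inv g) \<otimes> inv (g \<otimes> x \<otimes> inv g)"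
    using c g conj_conj[of g x y] conj_conj[of "g \<otimes> x \<otimes> inv g" g y]
    by (simp add: m_assoc)
qed

lemma (in group) is_rack_conjugation_rack:
  assumes "is_conjugacy_class G X"
  shows "is_rack (conjugation_rack G X)"
proof -
  obtain x0 where x0: "x0 \<in> carrier G" "X = conjugacy_class G x0"
    using assms by (auto simp: is_conjugacy_class_def)
  have "X \<subseteq> carrier G" using x0 conjugacy_class_subset by simp
  moreover have "X \<noteq> {}" using x0 by (auto simp: conjugacy_class_def)
  ultimately show ?thesis
    using conj_automorphism[OF assms] by (auto simp: is_rack_def conjugation_rack_def)
qed

lemma hurwitz_orbit_count_automorphism:
  assumes R: "is_rack R" and f: "f \<in> rack_hom R R" and bf: "bij_betw f (carrier R) (carrier R)"
    and i: "i \<in> carrier R"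
  shows "hurwitz_orbit_count R (f i) n = hurwitz_orbit_count R i n"
proof -
  define S where "S = carrier R \<times> carrier R"
  define F where "F = map_prod f f"
  define c where "c = hurwitz_map R"
  have bc: "bij_betw c S S" using bij_betw_hurwitz_map[OF R] by (simp add: S_def c_def)
  have bF: "bij_betw F S S"
    using bf by (auto simp: F_def S_def bij_betw_def map_prod_inj_on map_prod_surj_on)
  have com: "c (F p) = F (c p)" if "p \<in> S" for p
    using that f by (auto simp: c_def F_def S_def hurwitz_map_def rack_hom_def)
  define d where "d = inv_into S c"
  have bd: "bij_betw d S S" unfolding d_def by (rule bij_betw_inv_into[OF bc])
  have comd: "d (F p) = F (d p)" if "p \<in> S" for p
  proof -
    have dp: "d p \<in> S" using bd that by (auto simp: bij_betw_def)
    have "c (F (d p)) = F p"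
      using com[OF dp] bc that by (simp add: d_def bij_betw_inv_into_right)
    moreover have "F (d p) \<in> S" using bF dp by (auto simp: bij_betw_def)
    ultimately show ?thesis
      using bc by (metis bij_betw_inv_into_left d_def)
  qed
  have pow: "(h ^^ m) p \<in> S \<and> (h ^^ m) (F p) = F ((h ^^ m) p)"
    if "bij_betw h S S" "\<And>p. p \<in> S \<Longrightarrow> h (F p) = F (h p)" "p \<in> S" for h m p
    using that by (induction m) (auto simp: bij_betw_def)
  have hp: "hurwitz_power R m p \<in> S \<and> hurwitz_power R m (F p) = F (hurwitz_power R m p)"
    if "p \<in> S" for m p
    using pow[OF bc com that] pow[OF bd comd that]
    by (simp add: hurwitz_power_def flip: S_def c_def d_def)
  have card: "card (hurwitz_orbit R (f i) (f j)) = card (hurwitz_orbit R i j)"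
    if "j \<in> carrier R" for j
  proof -
    have p: "(i, j) \<in> S" "F (i, j) = (f i, f j)" using i that by (auto simp: S_def F_def)
    have "hurwitz_orbit R (f i) (f j) = F ` hurwitz_orbit R i j"
      using hp[OF p(1)] p(2) by (force simp: hurwitz_orbit_def)
    moreover have "hurwitz_orbit R i j \<subseteq> S"
      using hp[OF p(1)] by (auto simp: hurwitz_orbit_def)
    ultimately show ?thesis
      using bF by (metis bij_betw_def card_image inj_on_subset)
  qed
  have "{j \<in> carrier R. card (hurwitz_orbit R (f i) j) = n} =
        f ` {j \<in> carrier R. card (hurwitz_orbit R i j) = n}" (is "?A = f ` ?B")
  proof (intro equalityI subsetI)
    fix x assume x: "x \<in> ?A"
    then obtain j where "j \<in> carrier R" "x = f j"
      using bf by (auto simp: bij_betw_def)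
    then show "x \<in> f ` ?B" using x card by auto
  qed (use card bf in \<open>auto simp: bij_betw_def\<close>)
  moreover have "inj_on f ?B"
    using bf by (auto simp: bij_betw_def intro: inj_on_subset)
  ultimately show ?thesis by (simp add: hurwitz_orbit_count_def card_image)
qed

text \<open>For a conjugacy class, the numbers \<open>k\<^sub>n\<close> do not depend on the chosen element.\<close>

lemma (in group) hurwitz_orbit_count_conjugation_rack:
  assumes X: "is_conjugacy_class G X" and i: "i \<in> X" and j: "j \<in> X"
  shows "hurwitz_orbit_count (conjugation_rack G X) i n = hurwitz_orbit_count (conjugation_rack G X) j n"
proof -
  obtain x0 where x0: "x0 \<in> carrier G" "X = conjugacy_class G x0"
    using X by (auto simp: is_conjugacy_class_def)
  have *: "hurwitz_orbit_count (conjugation_rack G X) y n = hurwitz_orbit_count (conjugation_rack G X) x0 n"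
    if y: "y \<in> X" for y
  proof -
    obtain g where g: "g \<in> carrier G" "y = g \<otimes> x0 \<otimes> inv g"
      using y x0 by (auto simp: conjugacy_class_def)
    have x0X: "x0 \<in> X" using x0 by (auto simp: conjugacy_class_def intro!: exI[of _ \<one>])
    have "(\<lambda>y. g \<otimes> y \<otimes> inv g) \<in> rack_hom (conjugation_rack G X) (conjugation_rack G X)"
      using conj_automorphism[OF X g(1)]
      by (auto simp: rack_hom_def conjugation_rack_def bij_betw_def)
    from hurwitz_orbit_count_automorphism[OF is_rack_conjugation_rack[OF X] this, of x0 n]
    show ?thesis using conj_automorphism(1)[OF X g(1)] x0X g by (simp add: conjugation_rack_def)
  qed
  show ?thesis using *[OF i] *[OF j] by simp
qed

lemma group_dihedral_group:
  assumes "n > 0"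
  shows "group (dihedral_group n)"
proof (rule groupI)
  fix x assume "x \<in> carrier (dihedral_group n)"
  then obtain a s where "x = (a, s)" "0 \<le> a" "a < int n"
    by (auto simp: dihedral_group_def)
  then show "\<exists>y\<in>carrier (dihedral_group n). y \<otimes>\<^bsub>dihedral_group n\<^esub> x = \<one>\<^bsub>dihedral_group n\<^esub>"
    using assms
    by (intro bexI[of _ "if s then (a, s) else ((- a) mod int n, s)"])
       (auto simp: dihedral_group_def mod_simps)
qed (use assms in \<open>auto simp: dihedral_group_def mod_simps algebra_simps\<close>)

lemma D3_carrier: "carrier D3_rack = {(0, True), (1, True), (2, True)}"
proof -
  have "{0..<3} = {0, 1, 2 :: int}" by auto
  then show ?thesis
    by (auto simp: D3_rack_def conjugation_rack_def dihedral_group_def Let_def)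
qed

lemma is_conjugacy_class_D3: "is_conjugacy_class (dihedral_group 3) (carrier D3_rack)"
proof -
  interpret group "dihedral_group 3" by (rule group_dihedral_group) simp
  have e: "{0..<3} = {0, 1, 2 :: int}" by auto
  have car: "carrier (dihedral_group 3) = {0, 1, 2} \<times> UNIV"
    by (simp add: dihedral_group_def e)
  have inv: "inv\<^bsub>dihedral_group 3\<^esub> (a, s) = (if s then (a, s) else ((- a) mod 3, s))"
    if "a \<in> {0, 1, 2}" for a s
    by (rule inv_equality) (use that in \<open>auto simp: dihedral_group_def\<close>)
  have "conjugacy_class (dihedral_group 3) (0, True) =
      (\<lambda>g. g \<otimes>\<^bsub>dihedral_group 3\<^esub> (0, True) \<otimes>\<^bsub>dihedral_group 3\<^esub> inv\<^bsub>dihedral_group 3\<^esub> g) `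
        {(0, True), (1, True), (2, True), (0, False), (1, False), (2, False)}"
    unfolding conjugacy_class_def Setcompr_eq_image car
    by (rule arg_cong[where f = "\<lambda>A. _ ` A"]) auto
  also have "\<dots> = carrier D3_rack"
    by (auto simp: D3_carrier inv) (auto simp: dihedral_group_def)
  finally show ?thesis
    by (auto simp: is_conjugacy_class_def car intro!: bexI[of _ "(0, True)"])
qed

lemma is_rack_B: "is_rack B_rack"
proof -
  have "{1..6} = {1, 2, 3, 4, 5, 6 :: nat}" by auto
  then show ?thesis
    by (simp add: is_rack_def B_rack_def B_perm_def transpose_def bij_betw_def inj_on_def
        insert_commute insert_absorb2)
qed

lemma is_rack_affine_rack:
  assumes "field F" "\<alpha> \<in> carrier F" "\<alpha> \<noteq> \<zero>\<^bsub>F\<^esub>"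
  shows "is_rack (affine_rack F \<alpha>)"
proof -
  interpret field F by fact
  let ?A = "carrier F"
  have ia: "inv\<^bsub>F\<^esub> \<alpha> \<in> ?A" "inv\<^bsub>F\<^esub> \<alpha> \<otimes>\<^bsub>F\<^esub> \<alpha> = \<one>\<^bsub>F\<^esub>" "\<alpha> \<otimes>\<^bsub>F\<^esub> inv\<^bsub>F\<^esub> \<alpha> = \<one>\<^bsub>F\<^esub>"
    using assms(2,3) field_Units by auto
  have bij: "bij_betw (\<lambda>x. i \<rhd>\<^bsub>affine_rack F \<alpha>\<^esub> x) ?A ?A" if i: "i \<in> ?A" for i
  proof -
    define b where "b = (\<one>\<^bsub>F\<^esub> \<ominus>\<^bsub>F\<^esub> \<alpha>) \<otimes>\<^bsub>F\<^esub> i"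
    have b: "b \<in> ?A" using i assms(2) by (simp add: b_def)
    have 1: "inv\<^bsub>F\<^esub> \<alpha> \<otimes>\<^bsub>F\<^esub> (b \<oplus>\<^bsub>F\<^esub> \<alpha> \<otimes>\<^bsub>F\<^esub> x \<ominus>\<^bsub>F\<^esub> b) = x" if "x \<in> ?A" for x
    proof -
      have "b \<oplus>\<^bsub>F\<^esub> \<alpha> \<otimes>\<^bsub>F\<^esub> x \<ominus>\<^bsub>F\<^esub> b = \<alpha> \<otimes>\<^bsub>F\<^esub> x"
        using b that assms(2) by algebra
      then show ?thesis using ia that assms(2) by (simp flip: m_assoc)
    qed
    have 2: "b \<oplus>\<^bsub>F\<^esub> \<alpha> \<otimes>\<^bsub>F\<^esub> (inv\<^bsub>F\<^esub> \<alpha> \<otimes>\<^bsub>F\<^esub> (x \<ominus>\<^bsub>F\<^esub> b)) = x" if "x \<in> ?A" for x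
    proof -
      have "\<alpha> \<otimes>\<^bsub>F\<^esub> (inv\<^bsub>F\<^esub> \<alpha> \<otimes>\<^bsub>F\<^esub> (x \<ominus>\<^bsub>F\<^esub> b)) = x \<ominus>\<^bsub>F\<^esub> b"
        using ia that assms(2) b by (simp flip: m_assoc)
      then show ?thesis using b that by algebra
    qed
    show ?thesis
      unfolding affine_rack_def rack.simps b_def[symmetric]
      by (rule bij_betw_byWitness[where f' = "\<lambda>x. inv\<^bsub>F\<^esub> \<alpha> \<otimes>\<^bsub>F\<^esub> (x \<ominus>\<^bsub>F\<^esub> b)"])
         (use 1 2 b ia assms(2) in auto)
  qed
  have dist: "(\<one>\<^bsub>F\<^esub> \<ominus>\<^bsub>F\<^esub> \<alpha>) \<otimes>\<^bsub>F\<^esub> i \<oplus>\<^bsub>F\<^esub> \<alpha> \<otimes>\<^bsub>F\<^esub> ((\<one>\<^bsub>F\<^esub> \<ominus>\<^bsub>F\<^esub> \<alpha>) \<otimes>\<^bsub>F\<^esub> j \<oplus>\<^bsub>F\<^esub> \<alpha> \<otimes>\<^bsub>F\<^esub> k) =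
      (\<one>\<^bsub>F\<^esub> \<ominus>\<^bsub>F\<^esub> \<alpha>) \<otimes>\<^bsub>F\<^esub> ((\<one>\<^bsub>F\<^esub> \<ominus>\<^bsub>F\<^esub> \<alpha>) \<otimes>\<^bsub>F\<^esub> i \<oplus>\<^bsub>F\<^esub> \<alpha> \<otimes>\<^bsub>F\<^esub> j) \<oplus>\<^bsub>F\<^esub>
      \<alpha> \<otimes>\<^bsub>F\<^esub> ((\<one>\<^bsub>F\<^esub> \<ominus>\<^bsub>F\<^esub> \<alpha>) \<otimes>\<^bsub>F\<^esub> i \<oplus>\<^bsub>F\<^esub> \<alpha> \<otimes>\<^bsub>F\<^esub> k)"
    if "i \<in> ?A" "j \<in> ?A" "k \<in> ?A" for i j k
    using that assms(2) by algebra
  have "?A \<noteq> {}" using zero_closed by blast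
  then show ?thesis
    using bij dist by (auto simp: is_rack_def affine_rack_def)
qed

end

theory Submission
  imports Defs
begin

text \<open>
  Write \<open>m(i, j)\<close> for the size of the orbit \<open>\<O>(i, j)\<close>. In the group it is the length of the shortest
  braid relation \<open>i j i \<dots> = j i j \<dots>\<close>: it is \<open>1\<close> for \<open>i = j\<close>, \<open>2\<close> for distinct commuting elements and
  \<open>3\<close> for \<open>i j i = j i j\<close>. The sum in the theorem is the sum of \<open>1/2 - 1/m(i, j)\<close> over all \<open>j \<in> X\<close>
  that do not commute with \<open>i\<close>.

  The structure behind the proof is the graph on \<open>X\<close> that joins non-commuting elements. Let \<open>N i\<close>
  be the set of neighbours of \<open>i\<close>. Conjugation by \<open>i\<close> is a permutation that moves exactly the elements
  of \<open>N i\<close>, and it is an automorphism of the graph. Because \<open>X\<close> is a conjugacy class that generates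
  the group, these automorphisms are transitive on \<open>X\<close>, so all vertices look alike, and the graph
  is connected. If \<open>p\<close> of the neighbours of \<open>i\<close> have \<open>m(i, j) = 3\<close> and \<open>q\<close> of them have \<open>m(i, j) \<ge> 4\<close>,
  then a sum of at most \<open>1\<close> forces \<open>2 p + 3 q \<le> 12\<close>. Neither \<open>p\<close> nor \<open>q\<close> is \<open>1\<close>, since conjugation by \<open>i\<close>
  permutes both kinds of neighbours without fixed points. So \<open>p + q\<close> is \<open>2\<close> or \<open>3\<close>, or \<open>(p, q)\<close> is one of
  \<open>(4, 0)\<close>, \<open>(5, 0)\<close>, \<open>(6, 0)\<close>, \<open>(2, 2)\<close>, \<open>(3, 2)\<close>, \<open>(0, 4)\<close>; in the last case equality holds, and all
  the orbits concerned have size exactly \<open>4\<close>.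

  Each case is then split by the cycle type of conjugation by \<open>i\<close> on \<open>N i\<close>. Two observations
  determine the rack or refute the case. If \<open>x\<close> commutes with \<open>i\<close>, then conjugation by \<open>i\<close> fixes \<open>x\<close>
  and therefore permutes \<open>N x\<close>, so \<open>N x \<inter> N i\<close> is a union of cycles (\<open>N_comm\<close>). And every statement
  about \<open>i\<close> and its neighbours holds at every vertex (\<open>invariant_nbrs\<close>). The outcome is
  \<open>classification\<close>: the rack has one of nine explicit operation tables. The types \<open>(2, 2)\<close>, \<open>(3, 2)\<close> and
  \<open>(5, 0)\<close> do not occur, \<open>(4, 0)\<close> gives \<open>\<A>\<close> and \<open>\<B>\<close>, \<open>(0, 4)\<close> gives the two affine racks over
  the field with five elements, and \<open>(6, 0)\<close> gives \<open>\<C>\<close> and the two affine racks over the field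
  with seven elements; with two and three neighbours only \<open>\<D>\<^sub>3\<close> and \<open>\<T>\<close> arise.

  Conversely, an operation table determines the rack up to isomorphism (\<open>op_table_isomorphic\<close>),
  and it bounds the orbit sizes from above, because an orbit has at most \<open>n\<close> elements once the \<open>n\<close>-th
  power of the map \<open>c\<close> fixes its starting point. For the nine tables these bounds give a
  sum of at most \<open>1\<close> (\<open>light_table_sum\<close>).
\<close>

section \<open>Operation tables\<close>

text \<open>
  A table with entries in \<open>{0, 1, \<dots>}\<close> describes \<open>f\<close> on \<open>X\<close> with respect to some enumeration of \<open>X\<close>.
  The equation between lists of lists is a form that the simplifier checks row by row.
\<close>

definition op_table :: "'a set \<Rightarrow> ('a \<Rightarrow> 'a \<Rightarrow> 'a) \<Rightarrow> nat list list \<Rightarrow> bool" where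
  "op_table X f T \<longleftrightarrow> (\<exists>xs. distinct xs \<and> set xs = X \<and>
     map (\<lambda>x. map (f x) xs) xs = map (map ((!) xs)) T)"

lemma op_tableI:
  assumes "distinct xs" "set xs = X" "map (\<lambda>x. map (f x) xs) xs = map (map ((!) xs)) T"
  shows "op_table X f T"
  using assms unfolding op_table_def by blast

lemma op_tableE:
  assumes "op_table X f T"
  obtains xs where "distinct xs" "set xs = X" "length xs = length T"
    "\<And>a b. a < length T \<Longrightarrow> b < length T \<Longrightarrow> f (xs ! a) (xs ! b) = xs ! (T ! a ! b)"
proof -
  obtain xs where xs: "distinct xs" "set xs = X"
    "map (\<lambda>x. map (f x) xs) xs = map (map ((!) xs)) T"
    using assms unfolding op_table_def by blast
  have len: "length xs = length T" using arg_cong[OF xs(3), of length] by simp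
  have row: "map (f (xs ! a)) xs = map ((!) xs) (T ! a)" if "a < length T" for a
    using arg_cong[OF xs(3), of "\<lambda>l. l ! a"] that len by simp
  have "f (xs ! a) (xs ! b) = xs ! (T ! a ! b)" if a: "a < length T" and b: "b < length T" for a b
  proof -
    have "length (T ! a) = length T" using arg_cong[OF row[OF a], of length] len by simp
    then show ?thesis using arg_cong[OF row[OF a], of "\<lambda>l. l ! b"] b len by simp
  qed
  then show ?thesis using that xs(1,2) len by blast
qed

lemma op_table_cong:
  assumes "op_table X f T" "\<And>x y. x \<in> X \<Longrightarrow> y \<in> X \<Longrightarrow> f x y = g x y"
  shows "op_table X g T"
proof -
  obtain xs where xs: "distinct xs" "set xs = X"
    "map (\<lambda>x. map (f x) xs) xs = map (map ((!) xs)) T"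
    using assms(1) unfolding op_table_def by blast
  have "map (\<lambda>x. map (g x) xs) xs = map (\<lambda>x. map (f x) xs) xs"
    using assms(2) xs(2) by auto
  then show ?thesis using xs op_tableI by metis
qed

text \<open>
  An isomorphism carries an enumeration back along its inverse. The bound on the entries matters
  because \<open>xs ! k\<close> is an unspecified value for \<open>k\<close> outside the list.
\<close>

lemma op_table_transfer:
  assumes T: "op_table Y g T" and h: "bij_betw h X Y"
    and hom: "\<And>x y. x \<in> X \<Longrightarrow> y \<in> X \<Longrightarrow> f x y \<in> X \<and> h (f x y) = g (h x) (h y)"
    and ix: "\<forall>row \<in> set T. \<forall>k \<in> set row. k < length T"
  shows "op_table X f T"
proof -
  obtain ys where ys: "distinct ys" "set ys = Y"
    "map (\<lambda>x. map (g x) ys) ys = map (map ((!) ys)) T"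
    using T unfolding op_table_def by blast
  have len: "length ys = length T" using arg_cong[OF ys(3), of length] by simp
  define k where "k = inv_into X h"
  have k: "bij_betw k Y X" unfolding k_def by (rule bij_betw_inv_into[OF h])
  have kh: "k (h x) = x" if "x \<in> X" for x
    using h that by (simp add: k_def bij_betw_inv_into_left)
  have hk: "h (k y) = y" "k y \<in> X" if "y \<in> Y" for y
    using h that k by (auto simp: k_def bij_betw_inv_into_right bij_betw_def)
  have fk: "f (k x) (k y) = k (g x y)" if "x \<in> Y" "y \<in> Y" for x y
    using hom[OF hk(2)[OF that(1)] hk(2)[OF that(2)]] hk[OF that(1)] hk[OF that(2)] kh by metis
  show ?thesis
  proof (rule op_tableI[of "map k ys"])
    show "distinct (map k ys)" using ys k by (auto simp: distinct_map bij_betw_def)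
    show "set (map k ys) = X" using ys(2) k by (auto simp: bij_betw_def)
    have "map (\<lambda>x. map (f x) (map k ys)) (map k ys) = map (map k) (map (\<lambda>x. map (g x) ys) ys)"
      using fk ys(2) by auto
    also have "\<dots> = map (map ((!) (map k ys))) T"
      unfolding ys(3) using ix len by auto
    finally show "map (\<lambda>x. map (f x) (map k ys)) (map k ys) = map (map ((!) (map k ys))) T" .
  qed
qed

lemma op_table_isomorphic:
  assumes "op_table (carrier R) (rack_op R) T" "op_table (carrier S) (rack_op S) T"
    and ix: "\<forall>row \<in> set T. length row = length T \<and> (\<forall>k \<in> set row. k < length T)"
  shows "R \<cong>\<^sub>R S"
proof -
  obtain xs where xs: "distinct xs" "set xs = carrier R" "length xs = length T"
    "\<And>a b. a < length T \<Longrightarrow> b < length T \<Longrightarrow> rack_op R (xs ! a) (xs ! b) = xs ! (T ! a ! b)"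
    using op_tableE[OF assms(1)] by metis
  obtain ys where ys: "distinct ys" "set ys = carrier S" "length ys = length T"
    "\<And>a b. a < length T \<Longrightarrow> b < length T \<Longrightarrow> rack_op S (ys ! a) (ys ! b) = ys ! (T ! a ! b)"
    using op_tableE[OF assms(2)] by metis
  let ?I = "{..<length T}"
  have px: "bij_betw ((!) xs) ?I (carrier R)" using xs by (intro bij_betw_nth) auto
  have py: "bij_betw ((!) ys) ?I (carrier S)" using ys by (intro bij_betw_nth) auto
  define h where "h = (!) ys \<circ> inv_into ?I ((!) xs)"
  have bij: "bij_betw h (carrier R) (carrier S)"
    unfolding h_def by (rule bij_betw_trans[OF bij_betw_inv_into[OF px] py])
  have hx: "h (xs ! a) = ys ! a" if "a < length T" for a
    using bij_betw_inv_into_left[OF px, of a] that by (simp add: h_def)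
  have idx: "T ! a ! b < length T" if "a < length T" "b < length T" for a b
    using ix that by (metis nth_mem)
  have "h (rack_op R x y) = rack_op S (h x) (h y)" if xy: "x \<in> carrier R" "y \<in> carrier R" for x y
  proof -
    obtain a b where "x = xs ! a" "a < length T" "y = xs ! b" "b < length T"
      using xy xs(2,3) by (metis in_set_conv_nth)
    then show ?thesis using xs(4) ys(4) hx idx by simp
  qed
  moreover have "h \<in> carrier R \<rightarrow> carrier S" using bij by (auto simp: bij_betw_def)
  ultimately show ?thesis using bij unfolding rack_isomorphic_def rack_hom_def by blast
qed

text \<open>
  In each of the nine tables the index \<open>0\<close> stands for a vertex \<open>i\<close>, followed by its neighbours in the order of the
  cycles of \<open>i\<close> and then by the remaining vertices; in \<open>B_table\<close> the vertex opposite to \<open>i\<close> has the index \<open>1\<close>.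
\<close>

definition D3_table where "D3_table = [[0, 2, 1], [2, 1, 0], [1, 0, 2::nat]]"

definition T_table where "T_table = [[0, 2, 3, 1], [3, 1, 0, 2], [1, 3, 2, 0], [2, 0, 1, 3::nat]]"

definition A_table where "A_table =
  [[0, 2, 1, 4, 3, 5], [2, 1, 0, 5, 4, 3], [1, 0, 2, 3, 5, 4],
   [4, 5, 2, 3, 0, 1], [3, 1, 5, 0, 4, 2], [0, 3, 4, 1, 2, 5::nat]]"

definition B_table where "B_table =
  [[0, 1, 3, 4, 5, 2], [0, 1, 5, 2, 3, 4], [5, 3, 2, 0, 4, 1],
   [2, 4, 1, 3, 0, 5], [3, 5, 2, 1, 4, 0], [4, 2, 0, 3, 1, 5::nat]]"

definition Aff52_table where "Aff52_table =
  [[0, 2, 3, 4, 1], [3, 1, 4, 2, 0], [4, 0, 2, 1, 3], [1, 4, 0, 3, 2], [2, 3, 1, 0, 4::nat]]"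

definition Aff53_table where "Aff53_table =
  [[0, 2, 3, 4, 1], [2, 1, 4, 0, 3], [3, 4, 2, 1, 0], [4, 0, 1, 3, 2], [1, 3, 0, 2, 4::nat]]"

definition Aff73_table where "Aff73_table =
  [[0, 2, 3, 4, 5, 6, 1], [6, 1, 0, 5, 3, 2, 4], [1, 5, 2, 0, 6, 4, 3], [2, 4, 6, 3, 0, 1, 5],
   [3, 6, 5, 1, 4, 0, 2], [4, 3, 1, 6, 2, 5, 0], [5, 0, 4, 2, 1, 3, 6::nat]]"

definition Aff75_table where "Aff75_table =
  [[0, 2, 3, 4, 5, 6, 1], [6, 1, 0, 5, 2, 4, 3], [1, 4, 2, 0, 6, 3, 5], [2, 6, 5, 3, 0, 1, 4],
   [3, 5, 1, 6, 4, 0, 2], [4, 3, 6, 2, 1, 5, 0], [5, 0, 4, 1, 3, 2, 6::nat]]"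

definition C_table where "C_table =
  [[0, 2, 1, 4, 3, 6, 5, 7, 8, 9],
   [2, 1, 0, 7, 4, 8, 6, 3, 5, 9],
   [1, 0, 2, 3, 7, 5, 8, 4, 6, 9],
   [4, 7, 2, 3, 0, 9, 6, 1, 8, 5],
   [3, 1, 7, 0, 4, 5, 9, 2, 8, 6],
   [6, 8, 2, 9, 4, 5, 0, 7, 1, 3],
   [5, 1, 8, 3, 9, 0, 6, 7, 2, 4],
   [0, 3, 4, 1, 2, 5, 6, 7, 9, 8],
   [0, 5, 6, 3, 4, 1, 2, 9, 8, 7],
   [0, 1, 2, 5, 6, 3, 4, 8, 7, 9::nat]]"

section \<open>Cycles of a permutation\<close>

text \<open>
  The equation \<open>map f xs = rotate1 xs\<close> says that \<open>xs\<close> runs once through the cycle of \<open>a\<close>.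
\<close>

lemma cycle_through:
  assumes "finite B" "inj_on f B" "f ` B \<subseteq> B" "a \<in> B"
  obtains xs where "xs \<noteq> []" "hd xs = a" "distinct xs" "set xs \<subseteq> B" "map f xs = rotate1 xs"
    "f ` (B - set xs) \<subseteq> B - set xs"
proof -
  have inB: "(f ^^ t) a \<in> B" for t
    using assms(3,4) by (induction t) auto
  have ex: "\<exists>c>0. (f ^^ c) a = a"
  proof -
    have "\<not> inj_on (\<lambda>t. (f ^^ t) a) {..card B}"
    proof
      assume "inj_on (\<lambda>t. (f ^^ t) a) {..card B}"
      then have "card {..card B} \<le> card B"
        using inB by (intro card_inj_on_le[of "\<lambda>t. (f ^^ t) a"]) (auto simp: assms(1))
      then show False by simp
    qed
    then obtain s t where st: "s < t" "(f ^^ s) a = (f ^^ t) a"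
      by (auto simp: inj_on_def) (metis linorder_neqE_nat)
    have "(f ^^ (t - s)) a = a" using st
    proof (induction s arbitrary: t)
      case 0 then show ?case by simp
    next
      case (Suc s)
      obtain t' where t': "t = Suc t'" using Suc.prems(1) by (cases t) auto
      have "f ((f ^^ s) a) = f ((f ^^ t') a)" using Suc.prems(2) t' by simp
      then have "(f ^^ s) a = (f ^^ t') a" using assms(2) inB by (meson inj_onD)
      then show ?case using Suc.IH[of t'] Suc.prems(1) t' by simp
    qed
    then show ?thesis using st(1) by (intro exI[of _ "t - s"]) simp
  qed
  define c where "c = (LEAST c. c > 0 \<and> (f ^^ c) a = a)"
  have c: "c > 0" "(f ^^ c) a = a" using LeastI_ex[OF ex] by (auto simp: c_def)
  have least: "(f ^^ t) a \<noteq> a" if "0 < t" "t < c" for t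
    using not_less_Least[of t "\<lambda>c. c > 0 \<and> (f ^^ c) a = a"] that by (auto simp: c_def)
  have inj: "s = t" if "s < c" "t < c" "(f ^^ s) a = (f ^^ t) a" for s t
  proof -
    have *: "s \<le> t \<Longrightarrow> s < c \<Longrightarrow> t < c \<Longrightarrow> (f ^^ s) a = (f ^^ t) a \<Longrightarrow> s = t" for s t
    proof (rule ccontr)
      assume A: "s \<le> t" "t < c" "(f ^^ s) a = (f ^^ t) a" "s \<noteq> t"
      have "(f ^^ (c - t + t)) a = (f ^^ (c - t + s)) a"
        using A(3) by (simp only: funpow_add comp_def)
      then have "(f ^^ (c - t + s)) a = a" using c A(2) by simp
      moreover have "0 < c - t + s" "c - t + s < c" using A by auto
      ultimately show False using least[of "c - t + s"] by simp
    qed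
    show ?thesis using *[of s t] *[of t s] that by (cases "s \<le> t") simp_all
  qed
  define xs where "xs = map (\<lambda>t. (f ^^ t) a) [0..<c]"
  have m: "map f xs = rotate1 xs"
  proof (rule nth_equalityI)
    show "length (map f xs) = length (rotate1 xs)" by simp
    fix t assume "t < length (map f xs)"
    then have t: "t < c" by (simp add: xs_def)
    show "map f xs ! t = rotate1 xs ! t"
    proof (cases "Suc t = c")
      case True
      then show ?thesis using t c by (auto simp: xs_def nth_rotate1 simp flip: funpow.simps(2) comp_apply[of f])
    next
      case False
      then show ?thesis using t by (simp add: xs_def nth_rotate1)
    qed
  qed
  have sub: "set xs \<subseteq> B" using inB by (auto simp: xs_def)
  have ne: "xs \<noteq> []" using c(1) by (simp add: xs_def)
  have im: "f ` set xs = set xs" using m by (metis list.set_map set_rotate1)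
  have "f ` (B - set xs) = f ` B - f ` set xs"
    using assms(2) sub by (intro inj_on_image_set_diff) auto
  then have "f ` (B - set xs) \<subseteq> B - set xs"
    using assms(3) im by blast
  moreover have "distinct xs" using inj by (auto simp: xs_def distinct_map inj_on_def)
  moreover have "hd xs = a" using c(1) by (simp add: xs_def hd_map)
  ultimately show ?thesis using that ne m sub by blast
qed

lemma length_two: "length xs = 2 \<Longrightarrow> \<exists>a b. xs = [a, b]"
  by (auto simp: eval_nat_numeral length_Suc_conv)

lemma length_three: "length xs = 3 \<Longrightarrow> \<exists>a b c. xs = [a, b, c]"
  by (auto simp: eval_nat_numeral length_Suc_conv)

lemma length_four: "length xs = 4 \<Longrightarrow> \<exists>a b c d. xs = [a, b, c, d]"
  by (auto simp: eval_nat_numeral length_Suc_conv)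

lemma length_five: "length xs = 5 \<Longrightarrow> \<exists>a b c d e. xs = [a, b, c, d, e]"
  by (auto simp: eval_nat_numeral length_Suc_conv)

lemma length_six: "length xs = 6 \<Longrightarrow> \<exists>a b c d e f. xs = [a, b, c, d, e, f]"
  by (auto simp: eval_nat_numeral length_Suc_conv)

section \<open>Connected quandles with a commutation relation\<close>

text \<open>
  Conjugation in a conjugacy class \<open>X\<close>, extended to the whole type by letting \<open>x\<close> act trivially unless
  both arguments lie in \<open>X\<close>. All laws survive this extension, so they carry no membership conditions.
  The law \<open>comm\<close> and the law \<open>braid_sym\<close> hold since their premises mean \<open>x y = y x\<close> and \<open>x y x = y x y\<close> in
  the group. The law \<open>indecomposable\<close> expresses that the group generated by \<open>X\<close> acts transitively.
\<close>

locale conj_quandle =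
  fixes X :: "'a set" and act :: "'a \<Rightarrow> 'a \<Rightarrow> 'a" (infixr "\<triangleright>" 70)
  assumes finite_X: "finite X"
    and nontrivial: "x \<in> X \<Longrightarrow> X \<noteq> {x}"
    and moved_in: "x \<triangleright> y \<noteq> y \<Longrightarrow> x \<in> X"
    and inj [simp]: "x \<triangleright> y = x \<triangleright> z \<longleftrightarrow> y = z"
    and dist: "x \<triangleright> y \<triangleright> z = (x \<triangleright> y) \<triangleright> x \<triangleright> z"
    and idem [simp]: "x \<triangleright> x = x"
    and comm: "x \<triangleright> y = y \<Longrightarrow> y \<triangleright> x = x"
    and braid_sym: "x \<triangleright> y \<triangleright> x = y \<Longrightarrow> y \<triangleright> x \<triangleright> y = x"
    and indecomposable: "\<lbrakk>A \<subseteq> X; A \<noteq> {}; \<And>z a. a \<in> A \<Longrightarrow> z \<triangleright> a \<in> A\<rbrakk> \<Longrightarrow> A = X"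
begin

text \<open>
  The neighbours of \<open>x\<close> in the graph of non-commuting elements.
\<close>

definition N :: "'a \<Rightarrow> 'a set" where "N x = {y. x \<triangleright> y \<noteq> y}"

definition br :: "'a \<Rightarrow> 'a \<Rightarrow> bool" where "br x y \<longleftrightarrow> x \<triangleright> y \<noteq> y \<and> x \<triangleright> y \<triangleright> x = y"

lemma N_sym: "y \<in> N x \<longleftrightarrow> x \<in> N y"
  using comm by (auto simp: N_def)

lemma N_sub: "N x \<subseteq> X"
  using comm moved_in by (auto simp: N_def)

lemma finite_N [simp]: "finite (N x)"
  using N_sub finite_X finite_subset by blast

lemma irrefl [simp]: "x \<notin> N x"
  by (simp add: N_def)

lemma act_fixed: "y \<notin> N x \<Longrightarrow> x \<triangleright> y = y"
  by (simp add: N_def)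

lemma act_in: "y \<in> X \<Longrightarrow> x \<triangleright> y \<in> X"
  using N_sub[of x] by (cases "y \<in> N x") (auto simp: N_def)

lemma N_act [simp]: "z \<triangleright> y \<in> N (z \<triangleright> x) \<longleftrightarrow> y \<in> N x"
  by (simp add: N_def flip: dist)

lemma N_stable [simp]: "x \<triangleright> y \<in> N x \<longleftrightarrow> y \<in> N x"
  using N_act[of x y x] by simp

text \<open>
  If \<open>x\<close> commutes with \<open>i\<close>, then \<open>i\<close> acts as an automorphism that fixes \<open>x\<close>. Hence the common
  neighbours of \<open>i\<close> and \<open>x\<close> form a union of cycles of \<open>i\<close>.
\<close>

lemma N_comm: "x \<notin> N i \<Longrightarrow> i \<triangleright> j \<in> N x \<longleftrightarrow> j \<in> N x"
  using N_act[of i j x] act_fixed by simp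

lemma surj: "\<exists>w. z \<triangleright> w = y"
proof (cases "y \<in> N z")
  case True
  have "(\<triangleright>) z ` N z = N z"
    by (intro endo_inj_surj) (auto simp: inj_on_def)
  then show ?thesis using True by (metis imageE)
qed (use act_fixed in blast)

lemma N_image: "N (z \<triangleright> x) = (\<triangleright>) z ` N x"
proof (intro equalityI subsetI)
  fix y assume "y \<in> N (z \<triangleright> x)"
  then show "y \<in> (\<triangleright>) z ` N x" using surj[of z y] by auto
qed auto

lemma N_nonempty: assumes "x \<in> X" shows "N x \<noteq> {}"
proof
  assume "N x = {}"
  then have "{x} = X" using assms N_sym[of x]
    by (intro indecomposable) (auto simp: N_def)
  then show False using nontrivial[OF assms] by simp
qed

text \<open>
  A property that is invariant under the inner automorphisms holds at all vertices or at none.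
\<close>

lemma homogeneous:
  assumes "i \<in> X" "x \<in> X" "P i" "\<And>x z. P x \<Longrightarrow> P (z \<triangleright> x)"
  shows "P x"
proof -
  have "{x \<in> X. P x} = X"
    using assms act_in by (intro indecomposable) auto
  then show ?thesis using assms(2) by blast
qed

lemma card_N: assumes "i \<in> X" "x \<in> X" shows "card (N x) = card (N i)"
  by (rule homogeneous[OF assms]) (auto simp: N_image card_image inj_on_def)

text \<open>
  An element \<open>z\<close> moves \<open>a\<close> only if \<open>z\<close> is a neighbour of \<open>a\<close>, and then \<open>z \<triangleright> a\<close> is a neighbour of \<open>z\<close>.
  So a set that is closed under taking neighbours is closed under the action.
\<close>

lemma connected:
  assumes "A \<subseteq> X" "A \<noteq> {}" "\<And>x. x \<in> A \<Longrightarrow> N x \<subseteq> A"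
  shows "A = X"
proof (rule indecomposable[OF assms(1,2)])
  fix z a assume a: "a \<in> A"
  show "z \<triangleright> a \<in> A"
  proof (cases "a \<in> N z")
    case True
    then have "z \<in> A" using assms(3)[OF a] N_sym by blast
    then show ?thesis using True assms(3) N_stable by blast
  qed (use a act_fixed in simp)
qed

text \<open>
  The hypothesis makes \<open>N i\<close> one side of a bipartite graph. An element that moves a point of one
  side lies on the other side and has all its neighbours on the first, so no point ever
  changes sides, against transitivity.
\<close>

lemma not_bipartite:
  assumes "i \<in> X" "\<And>j x. j \<in> N i \<Longrightarrow> x \<in> N j \<Longrightarrow> N x \<subseteq> N i"
  shows False
proof -
  have "N i = X"
  proof (rule indecomposable[OF N_sub N_nonempty[OF assms(1)]])
    fix z a assume a: "a \<in> N i"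
    show "z \<triangleright> a \<in> N i"
    proof (cases "a \<in> N z")
      case True
      then have "z \<triangleright> a \<in> N z" by simp
      moreover have "z \<in> N a" using True N_sym by blast
      ultimately show ?thesis using assms(2)[OF a] by blast
    qed (use a act_fixed in simp)
  qed
  then show False using assms(1) irrefl by blast
qed

lemma br_sym: "br x y \<longleftrightarrow> br y x"
  unfolding br_def using braid_sym comm by metis

lemma br_act: "br (z \<triangleright> x) (z \<triangleright> y) \<longleftrightarrow> br x y"
  by (simp add: br_def flip: dist)

text \<open>
  With \<open>z = x \<triangleright> y\<close>, the braid relation makes the three elements permute cyclically:
  \<open>x \<triangleright> y = z\<close>, \<open>z \<triangleright> x = y\<close> and \<open>y \<triangleright> z = x\<close>.
\<close>

lemma brD:
  assumes "br x y"
  shows "(x \<triangleright> y) \<triangleright> x = y" "y \<triangleright> x \<triangleright> y = x" "x \<triangleright> y \<triangleright> x = y"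
  using assms dist[of x y x] braid_sym[of x y] by (simp_all add: br_def)

lemma br_third: assumes "br x y" shows "br x (x \<triangleright> y)" "br y (x \<triangleright> y)"
proof -
  show "br x (x \<triangleright> y)" using assms br_act[of x x y] by simp
  have "br (y \<triangleright> x) y" using assms br_act[of y y x] br_sym[of x y] br_sym[of "y \<triangleright> x" y] by simp
  then show "br y (x \<triangleright> y)" using br_act[of x "y \<triangleright> x" y] brD(3)[OF assms] by simp
qed

text \<open>
  A cycle of \<open>i\<close> inside a stable set of neighbours has length at least two, and what it leaves over is not
  a single element, as \<open>i\<close> moves all its neighbours.
\<close>

lemma cycle_N:
  assumes B: "B \<subseteq> N i" "(\<triangleright>) i ` B \<subseteq> B" "a \<in> B"
  shows "\<exists>xs. xs \<noteq> [] \<and> hd xs = a \<and> distinct xs \<and> set xs \<subseteq> B \<and> map ((\<triangleright>) i) xs = rotate1 xs \<and>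
    (\<triangleright>) i ` (B - set xs) \<subseteq> B - set xs \<and> length xs \<ge> 2 \<and> card (B - set xs) \<noteq> 1 \<and>
    card (B - set xs) = card B - length xs \<and> length xs \<le> card B"
proof -
  have fB: "finite B" using B(1) finite_N finite_subset by blast
  obtain xs where xs: "xs \<noteq> []" "hd xs = a" "distinct xs" "set xs \<subseteq> B" "map ((\<triangleright>) i) xs = rotate1 xs"
    "(\<triangleright>) i ` (B - set xs) \<subseteq> B - set xs"
    by (rule cycle_through[of B "(\<triangleright>) i" a]) (use fB B in \<open>auto simp: inj_on_def\<close>)
  have "i \<triangleright> a \<noteq> a" using B by (auto simp: N_def)
  then have "length xs \<noteq> 1" using xs(1,2,5) by (auto simp: length_Suc_conv)
  then have "length xs \<ge> 2" using xs(1) by (cases xs) (auto simp: Suc_le_eq)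
  moreover have "card (B - set xs) \<noteq> 1"
  proof
    assume "card (B - set xs) = 1"
    then obtain b where b: "B - set xs = {b}" using card_1_singletonE by blast
    then have "i \<triangleright> b = b" "b \<in> N i" using xs(6) B(1) by auto
    then show False by (simp add: N_def)
  qed
  moreover have "card (B - set xs) = card B - length xs" "length xs \<le> card B"
    using xs(3,4) fB by (simp_all add: card_Diff_subset distinct_card) (metis card_mono distinct_card)
  ultimately show ?thesis using xs by blast
qed

lemma orbit2:
  assumes "B \<subseteq> N i" "(\<triangleright>) i ` B \<subseteq> B" "card B = 2" "a \<in> B"
  obtains b where "B = {a, b}" "i \<triangleright> a = b" "i \<triangleright> b = a" "a \<noteq> b"
proof -
  obtain xs where xs: "xs \<noteq> []" "hd xs = a" "distinct xs" "set xs \<subseteq> B"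
      "map ((\<triangleright>) i) xs = rotate1 xs" "(\<triangleright>) i ` (B - set xs) \<subseteq> B - set xs"
    and len: "length xs \<ge> 2" "card (B - set xs) \<noteq> 1"
      "card (B - set xs) = card B - length xs" "length xs \<le> card B"
    using cycle_N[OF assms(1,2,4)] by blast
  have l: "length xs = 2" using len assms(3) by simp
  then obtain b where b: "xs = [a, b]" using xs(2) length_two[of xs] by auto
  have "set xs = B" using xs assms(3) l
    by (intro card_subset_eq) (auto simp: distinct_card intro: card_ge_0_finite)
  then show ?thesis using b xs that by auto
qed

lemma orbit3:
  assumes "B \<subseteq> N i" "(\<triangleright>) i ` B \<subseteq> B" "card B = 3" "a \<in> B"
  obtains b c where "B = {a, b, c}" "i \<triangleright> a = b" "i \<triangleright> b = c" "i \<triangleright> c = a" "distinct [a, b, c]"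
proof -
  obtain xs where xs: "xs \<noteq> []" "hd xs = a" "distinct xs" "set xs \<subseteq> B"
      "map ((\<triangleright>) i) xs = rotate1 xs" "(\<triangleright>) i ` (B - set xs) \<subseteq> B - set xs"
    and len: "length xs \<ge> 2" "card (B - set xs) \<noteq> 1"
      "card (B - set xs) = card B - length xs" "length xs \<le> card B"
    using cycle_N[OF assms(1,2,4)] by blast
  have l: "length xs = 3" using len assms(3) by linarith
  then obtain b c where b: "xs = [a, b, c]" using xs(2) length_three[of xs] by auto
  have "set xs = B" using xs assms(3) l
    by (intro card_subset_eq) (auto simp: distinct_card intro: card_ge_0_finite)
  then show ?thesis using b xs that by auto
qed

lemma orbit4:
  assumes "B \<subseteq> N i" "(\<triangleright>) i ` B \<subseteq> B" "card B = 4" "a \<in> B"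
  obtains
    b c d where "B = {a, b, c, d}" "i \<triangleright> a = b" "i \<triangleright> b = c" "i \<triangleright> c = d" "i \<triangleright> d = a" "distinct [a, b, c, d]"
  | b c d where "B = {a, b, c, d}" "i \<triangleright> a = b" "i \<triangleright> b = a" "i \<triangleright> c = d" "i \<triangleright> d = c" "distinct [a, b, c, d]"
proof -
  obtain xs where xs: "xs \<noteq> []" "hd xs = a" "distinct xs" "set xs \<subseteq> B"
      "map ((\<triangleright>) i) xs = rotate1 xs" "(\<triangleright>) i ` (B - set xs) \<subseteq> B - set xs"
    and len: "length xs \<ge> 2" "card (B - set xs) \<noteq> 1"
      "card (B - set xs) = card B - length xs" "length xs \<le> card B"
    using cycle_N[OF assms(1,2,4)] by blast
  have "length xs = 4 \<or> length xs = 2" using len assms(3) by linarith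
  then show ?thesis
  proof
    assume l: "length xs = 4"
    then obtain b c d where b: "xs = [a, b, c, d]" using xs(2) length_four[of xs] by auto
    have "set xs = B" using xs assms(3) l
      by (intro card_subset_eq) (auto simp: distinct_card intro: card_ge_0_finite)
    then show ?thesis using b xs that(1)[of b c d] by auto
  next
    assume l: "length xs = 2"
    then obtain b where b: "xs = [a, b]" using xs(2) length_two[of xs] by auto
    have c2: "card (B - set xs) = 2" using len(3) l assms(3) by simp
    then obtain c where c: "c \<in> B - set xs" by (metis card.empty equals0I zero_neq_numeral)
    have "B - set xs \<subseteq> N i" using assms(1) by blast
    from orbit2[OF this xs(6) c2 c] obtain d
      where d: "B - set xs = {c, d}" "i \<triangleright> c = d" "i \<triangleright> d = c" "c \<noteq> d" by metis
    have "B = {a, b, c, d}" using b xs(4) d(1) by auto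
    moreover have "a \<noteq> b" "i \<triangleright> a = b" "i \<triangleright> b = a" using b xs(3,5) by auto
    moreover have "c \<notin> {a, b}" "d \<notin> {a, b}" using d(1) b by auto
    ultimately show ?thesis using that(2)[of b c d] d(2-4) by auto
  qed
qed

text \<open>
  What \<open>i\<close> does to its neighbours, every vertex does to its own.
\<close>

lemma invariant_nbrs:
  assumes "i \<in> X" "\<And>j. j \<in> N i \<Longrightarrow> Q i j" "\<And>z x y. Q x y \<Longrightarrow> Q (z \<triangleright> x) (z \<triangleright> y)" "y \<in> N x"
  shows "Q x y"
proof -
  have x: "x \<in> X" using assms(4) N_sub N_sym by blast
  have "\<forall>y \<in> N x. Q x y"
  proof (rule homogeneous[OF assms(1) x])
    show "\<forall>y \<in> N i. Q i y" using assms(2) by blast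
  next
    fix x z assume "\<forall>y \<in> N x. Q x y"
    then show "\<forall>y \<in> N (z \<triangleright> x). Q (z \<triangleright> x) y"
      unfolding N_image by (blast intro: assms(3))
  qed
  then show ?thesis using assms(4) by blast
qed

lemma braided_nbrs:
  assumes "i \<in> X" "\<And>j. j \<in> N i \<Longrightarrow> br i j" "y \<in> N x"
  shows "br x y"
  by (rule invariant_nbrs[OF assms(1), where Q = br]) (use assms(2,3) br_act in auto)

lemma N_eqI:
  assumes "i \<in> X" "x \<in> X" "N i \<subseteq> N x"
  shows "N x = N i"
  using card_subset_eq[OF finite_N assms(3)] card_N[OF assms(1,2)] by simp

lemma N_mem: "j \<in> N i \<Longrightarrow> j \<in> X" "j \<in> N i \<Longrightarrow> i \<in> X" "j \<in> N i \<Longrightarrow> i \<in> N j"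
  using N_sub N_sym by blast+

lemma im_N: "(\<triangleright>) i ` N i \<subseteq> N i"
  by auto

lemma pow_act: "((\<triangleright>) (z \<triangleright> x) ^^ k) (z \<triangleright> y) = z \<triangleright> ((\<triangleright>) x ^^ k) y"
  by (induction k) (simp_all flip: dist)

text \<open>
  The cycle type of the action on the neighbours is the same at every vertex.
\<close>

lemma no_short_cycle:
  assumes "i \<in> X" "\<And>j. j \<in> N i \<Longrightarrow> ((\<triangleright>) i ^^ k) j \<noteq> j" "y \<in> N x"
  shows "((\<triangleright>) x ^^ k) y \<noteq> y"
  by (rule invariant_nbrs[OF assms(1), where Q = "\<lambda>x y. ((\<triangleright>) x ^^ k) y \<noteq> y"])
     (use assms(2,3) in \<open>auto simp: pow_act\<close>)

lemma involutive:
  assumes "i \<in> X" "\<And>j. j \<in> N i \<Longrightarrow> i \<triangleright> i \<triangleright> j = j"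
  shows "x \<triangleright> x \<triangleright> y = y"
proof (cases "y \<in> N x")
  case True
  show ?thesis
    by (rule invariant_nbrs[OF assms(1), where Q = "\<lambda>x y. x \<triangleright> x \<triangleright> y = y"])
       (use assms(2) True in \<open>auto simp flip: dist\<close>)
qed (simp add: act_fixed)

text \<open>
  The neighbours of \<open>x\<close> that satisfy the braid relation with \<open>x\<close>, that is, whose Hurwitz orbit has size three.
\<close>

definition L :: "'a \<Rightarrow> 'a set" where "L x = {y. br x y}"

lemma L_sub: "L x \<subseteq> N x"
  by (auto simp: L_def N_def br_def)

lemma finite_L [simp]: "finite (L x)"
  using finite_subset[OF L_sub finite_N] .

lemma L_act [simp]: "z \<triangleright> y \<in> L (z \<triangleright> x) \<longleftrightarrow> y \<in> L x"
  by (simp add: L_def br_act)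

lemma L_stable [simp]: "x \<triangleright> y \<in> L x \<longleftrightarrow> y \<in> L x"
  using L_act[of x y x] by simp

lemma L_sym: "y \<in> L x \<longleftrightarrow> x \<in> L y"
  using br_sym by (simp add: L_def)

lemma L_third: "y \<in> L x \<Longrightarrow> x \<triangleright> y \<in> L y"
  using br_third by (simp add: L_def)

lemma L_ops: "y \<in> L x \<Longrightarrow> (x \<triangleright> y) \<triangleright> x = y" "y \<in> L x \<Longrightarrow> y \<triangleright> x \<triangleright> y = x"
  using brD by (simp_all add: L_def)

lemma card_L: assumes "i \<in> X" "x \<in> X" shows "card (L x) = card (L i)"
proof (rule homogeneous[OF assms])
  fix x z assume "card (L x) = card (L i)"
  moreover have "L (z \<triangleright> x) = (\<triangleright>) z ` L x"
  proof (intro equalityI subsetI)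
    fix y assume "y \<in> L (z \<triangleright> x)"
    then show "y \<in> (\<triangleright>) z ` L x" using surj[of z y] by auto
  qed auto
  ultimately show "card (L (z \<triangleright> x)) = card (L i)" by (simp add: card_image inj_on_def)
qed simp

section \<open>Two or three neighbours\<close>

text \<open>
  Here the graph is a cycle and \<open>i\<close> swaps its two neighbours. For \<open>c \<noteq> b\<close> the graph would be
  a square, which is bipartite; so it is a triangle.
\<close>

lemma degree_two:
  assumes i: "i \<in> X" and card: "card (N i) = 2"
  shows "op_table X (\<triangleright>) D3_table"
proof -
  obtain a where a: "a \<in> N i" using N_nonempty[OF i] by blast
  obtain b where b: "N i = {a, b}" "i \<triangleright> a = b" "i \<triangleright> b = a" "a \<noteq> b"
    using orbit2[OF order_refl im_N card a] by metis
  have aX: "a \<in> X" "i \<in> N a" using a N_mem by auto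
  have bX: "b \<in> X" "i \<in> N b" using b N_mem[of b i] by auto
  obtain c where c: "N a = {i, c}" "a \<triangleright> i = c" "a \<triangleright> c = i" "i \<noteq> c"
    using orbit2[OF order_refl im_N _ aX(2)] card card_N[OF i aX(1)] by metis
  have Nb: "N b = {i, i \<triangleright> c}" using N_image[of i a] b c by auto
  have cX: "c \<in> X" "a \<in> N c" using c N_mem[of c a] by auto
  show ?thesis
  proof (cases "c = b")
    case True
    have Nb: "N b = {i, a}" using Nb True b by simp
    have "{i, a, b} = X"
      using i aX bX b c Nb True by (intro connected) auto
    moreover have "b \<triangleright> i = a" "b \<triangleright> a = i"
      using Nb N_stable[of b i] N_stable[of b a] by (auto simp: N_def)
    moreover have "distinct [i, a, b]" using b(4) irrefl[of i] b(1) by auto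
    ultimately show ?thesis using b(2-) c(2-) True
      by (intro op_tableI[of "[i, a, b]"]) (simp_all add: D3_table_def)
  next
    case False
    then have cN: "c \<notin> N i" using b(1) c(1) irrefl[of a] by auto
    then have "b \<in> N c" using N_comm[OF cN, of a] cX b by simp
    then have Nc: "N c = {a, b}" using N_eqI[OF i cX(1)] cX b by auto
    then have "N b = {i, c}" using Nb N_sym[of b c] c(4) cN b(4) by auto
    then have "N x \<subseteq> N i" if "j \<in> N i" "x \<in> N j" for j x
      using that b(1) c(1) Nc by auto
    then show ?thesis using not_bipartite[OF i] by blast
  qed
qed

text \<open>
  The neighbours of \<open>i\<close> form one cycle of \<open>i\<close>, so they are pairwise adjacent or pairwise
  non-adjacent. The second possibility is a bipartite graph, the first is a complete graph on four
  points. There \<open>a\<close> acts as a three-cycle too, and self-distributivity decides between its two orientations.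
\<close>

lemma degree_three:
  assumes i: "i \<in> X" and card: "card (N i) = 3"
  shows "op_table X (\<triangleright>) T_table"
proof -
  obtain a where a: "a \<in> N i" using N_nonempty[OF i] by blast
  obtain b c where b: "N i = {a, b, c}" "i \<triangleright> a = b" "i \<triangleright> b = c" "i \<triangleright> c = a" "distinct [a, b, c]"
    using orbit3[OF order_refl im_N card a] by metis
  have X: "a \<in> X" "b \<in> X" "c \<in> X" using b(1) N_sub by auto
  have iN: "i \<in> N a" "i \<in> N b" "i \<in> N c" using b(1) N_sym by auto
  have ni: "i \<noteq> a" "i \<noteq> b" "i \<noteq> c" using b(1) irrefl[of i] by auto
  have sh: "b \<in> N a \<longleftrightarrow> c \<in> N b" "c \<in> N b \<longleftrightarrow> a \<in> N c"
    using N_act[of i b a] N_act[of i c b] b by simp_all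
  have ab: "b \<in> N a"
  proof (rule ccontr)
    assume "b \<notin> N a"
    then have ind: "N j \<inter> N i = {}" if "j \<in> N i" for j
      using sh b(1) that N_sym by auto
    have "N x \<subseteq> N i" if "j \<in> N i" "x \<in> N j" for j x
    proof -
      have x: "x \<notin> N i" "j \<in> N x" "x \<in> X" using that ind N_mem by blast+
      then have "N i \<subseteq> N x"
        using that(1) b N_comm[OF x(1), of a] N_comm[OF x(1), of b] N_comm[OF x(1), of c] by auto
      then show ?thesis using N_eqI[OF i x(3)] by simp
    qed
    then show False using not_bipartite[OF i] by blast
  qed
  then have Ns: "N a = {i, b, c}" "N b = {i, a, c}" "N c = {i, a, b}"
    using sh N_sym[of a b] N_sym[of b c] N_sym[of c a] iN ni b(5)
      card_subset_eq[OF finite_N, of "{i, b, c}" a] card_subset_eq[OF finite_N, of "{i, a, c}" b]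
      card_subset_eq[OF finite_N, of "{i, a, b}" c] card card_N[OF i X(1)] card_N[OF i X(2)] card_N[OF i X(3)]
    by auto
  have Xe: "{i, a, b, c} = X" using i X b(1) Ns by (intro connected) auto
  obtain u v where uv: "N a = {i, u, v}" "a \<triangleright> i = u" "a \<triangleright> u = v" "a \<triangleright> v = i" "distinct [i, u, v]"
    using orbit3[OF order_refl im_N _ iN(1)] card card_N[OF i X(1)] by metis
  have "{u, v} = {b, c}" using uv(1,5) Ns(1) ni b(5) by auto
  \<comment> \<open>The two orientations of the three-cycle of \<open>a\<close>.\<close>
  then consider "u = b" "v = c" | "u = c" "v = b" by (metis doubleton_eq_iff)
  then show ?thesis
  proof cases
    case 1
    have "b \<triangleright> c = i" using dist[of a i b] 1 uv b by simp
    moreover have "b \<triangleright> c = a" using dist[of i a b] 1 uv b by simp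
    ultimately show ?thesis using ni by simp
  next
    case 2
    have A: "a \<triangleright> i = c" "a \<triangleright> c = b" "a \<triangleright> b = i" using uv 2 by auto
    have B: "b \<triangleright> i = a" "b \<triangleright> a = c" "b \<triangleright> c = i"
      using A b dist[of i a i] dist[of i a c] dist[of i a b] by simp_all
    have C: "c \<triangleright> i = b" "c \<triangleright> b = a" "c \<triangleright> a = i"
      using B b dist[of i b i] dist[of i b a] dist[of i b c] by simp_all
    show ?thesis
    proof (rule op_tableI[of "[i, a, b, c]"])
      show "distinct [i, a, b, c]" using b(5) ni by simp
      show "set [i, a, b, c] = X" using Xe by simp
      show "map (\<lambda>x. map ((\<triangleright>) x) [i, a, b, c]) [i, a, b, c] = map (map ((!) [i, a, b, c])) T_table"
        by (simp add: T_table_def A B C b(2-4))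
    qed
  qed
qed

lemma shift: "x \<triangleright> y = z \<Longrightarrow> (i \<triangleright> x) \<triangleright> i \<triangleright> y = i \<triangleright> z"
  using dist[of i x y] by simp

section \<open>Four braided neighbours\<close>

text \<open>
  The element \<open>x = a \<triangleright> d\<close> decides everything: the cycle of \<open>a\<close> starts \<open>b \<mapsto> i \<mapsto> d \<mapsto> x\<close>, and \<open>x\<close> cannot be
  another neighbour of \<open>i\<close>. Then \<open>x\<close> has the same neighbours as \<open>i\<close>, and the graph is an octahedron
  with opposite pairs \<open>{i, x}\<close>, \<open>{a, c}\<close>, \<open>{b, d}\<close>.
\<close>

lemma four_cycle_braided:
  assumes i: "i \<in> X" and card: "card (N i) = 4" and br: "\<And>j. j \<in> N i \<Longrightarrow> br i j"
    and Ni: "N i = {a, b, c, d}" "i \<triangleright> a = b" "i \<triangleright> b = c" "i \<triangleright> c = d" "i \<triangleright> d = a" "distinct [a, b, c, d]"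
  shows "op_table X (\<triangleright>) B_table"
proof -
  have brs: "br x y" if "y \<in> N x" for x y using braided_nbrs[OF i br that] .
  have X: "a \<in> X" "b \<in> X" "c \<in> X" "d \<in> X" using Ni(1) N_sub by auto
  have iN: "i \<in> N a" "i \<in> N b" "i \<in> N c" "i \<in> N d" using Ni(1) N_sym by auto
  have ni: "i \<noteq> a" "i \<noteq> b" "i \<noteq> c" "i \<noteq> d" using Ni(1) irrefl[of i] by auto
  have A: "a \<triangleright> b = i" "a \<triangleright> i = d" "d \<triangleright> a = i"
    using brD[OF br, of a] brD[OF br, of d] Ni by auto
  define x where "x = a \<triangleright> d"
  have dN: "d \<in> N a" using N_stable[of a i] iN A by simp
  then have xN: "x \<in> N a" by (simp add: x_def)
  have dx: "d \<triangleright> x = a" using brD(2)[OF brs[OF dN]] by (simp add: x_def)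
  \<comment> \<open>\<open>x = b\<close> closes a three-cycle of \<open>a\<close>, and \<open>x = c\<close> contradicts rotation by \<open>i\<close>.\<close>
  have xNi: "x \<notin> N i"
  proof
    assume "x \<in> N i"
    moreover have "x \<noteq> b"
    proof
      assume "x = b"
      then have "((\<triangleright>) a ^^ 3) d = d" using A by (simp add: eval_nat_numeral flip: x_def)
      moreover have "((\<triangleright>) i ^^ 3) j \<noteq> j" if "j \<in> N i" for j
        using that Ni by (auto simp: eval_nat_numeral)
      ultimately show False using no_short_cycle[OF i _ dN, of 3] by blast
    qed
    moreover have "x \<noteq> c"
    proof
      assume "x = c"
      then have "i \<triangleright> d \<triangleright> c = b" using dx Ni by simp
      moreover have "i \<triangleright> d \<triangleright> c = c" using dist[of i d c] Ni x_def \<open>x = c\<close> by simp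
      ultimately show False using Ni by simp
    qed
    moreover have "x \<noteq> d" using dN by (simp add: x_def N_def)
    moreover have "x \<noteq> a" using xN by auto
    ultimately show False using Ni(1) by blast
  qed
  have ix: "i \<triangleright> x = x" using xNi act_fixed by blast
  have xX: "x \<in> X" using xN N_sub by blast
  have xi: "x \<noteq> i"
  proof
    assume "x = i"
    then have "a \<triangleright> d = a \<triangleright> b" using A x_def by simp
    then show False using Ni(6) by simp
  qed
  have ax: "a \<triangleright> x = b" using dist[of i d x] dx Ni ix by simp
  have "a \<in> N x" using xN N_sym by blast
  then have "N i \<subseteq> N x"
    using N_comm[OF xNi, of a] N_comm[OF xNi, of b] N_comm[OF xNi, of c] Ni by auto
  then have Nx: "N x = {a, b, c, d}" using N_eqI[OF i xX] Ni(1) by simp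
  have Na: "N a = {b, d, i, x}"
  proof (rule card_subset_eq[symmetric])
    show "{b, d, i, x} \<subseteq> N a" using dN iN xN A(1) ni by (auto simp: N_def)
    have "x \<noteq> b" "x \<noteq> d" using xNi Ni(1) by auto
    then have "card {b, d, i, x} = 4" using xi ni Ni(6) by simp
    then show "card {b, d, i, x} = card (N a)"
      using card card_N[OF i X(1)] by simp
  qed simp
  have Nb: "N b = {c, a, i, x}" using N_image[of i a] by (simp add: Na Ni(2-5) ix)
  have Nc: "N c = {d, b, i, x}" using N_image[of i b] by (simp add: Nb Ni(2-5) ix)
  have Nd: "N d = {a, c, i, x}" using N_image[of i c] by (simp add: Nc Ni(2-5) ix)
  have Xe: "{i, x, a, b, c, d} = X"
  proof (rule connected)
    fix y assume "y \<in> {i, x, a, b, c, d}"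
    then show "N y \<subseteq> {i, x, a, b, c, d}" by (elim insertE) (simp_all add: Ni(1) Nx Na Nb Nc Nd)
  qed (use i xX X in auto)
  have "c \<notin> N a" using Na Ni(6) ni xNi Ni(1) by auto
  then have A': "a \<triangleright> c = c" "a \<triangleright> d = x" using act_fixed by (auto simp: x_def)
  note A = A(1,2) A' ax
  note B = A[THEN shift[where i = i], unfolded Ni(2-5) ix idem]
  note C = B[THEN shift[where i = i], unfolded Ni(2-5) ix idem]
  note D = C[THEN shift[where i = i], unfolded Ni(2-5) ix idem]
  have xa: "x \<triangleright> a = d" using brD(1)[OF brs[OF dN]] by (simp add: x_def)
  have xb: "x \<triangleright> b = a" using dist[of i x a] xa Ni ix by simp
  have xc: "x \<triangleright> c = b" using dist[of i x b] xb Ni ix by simp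
  have xd: "x \<triangleright> d = c" using dist[of i x c] xc Ni ix by simp
  have xfi: "x \<triangleright> i = i" using ix comm by blast
  show ?thesis
    using Xe A B C D xa xb xc xd xfi ix Ni(2-) xi ni xNi[unfolded Ni(1)]
    by (intro op_tableI[of "[i, x, a, b, c, d]"]) (simp_all add: B_table_def)
qed

text \<open>
  When all elements act as involutions, a braided pair spans a line \<open>{x, y, x \<triangleright> y}\<close> in which any two
  points act on each other with the third point as the result, as in a Fischer space.
\<close>

lemma involutive_braided:
  assumes inv: "\<forall>x y. x \<triangleright> x \<triangleright> y = y" and brs: "\<forall>x. \<forall>y \<in> N x. br x y" and y: "y \<in> N x"
  shows "y \<triangleright> x = x \<triangleright> y" "x \<triangleright> x \<triangleright> y = y" "(x \<triangleright> y) \<triangleright> x = y" "y \<triangleright> x \<triangleright> y = x" "(x \<triangleright> y) \<triangleright> y = x"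
proof -
  have c: "y \<triangleright> x = x \<triangleright> y" if "y \<in> N x" for x y
  proof -
    have "br x y" using brs that by blast
    then have "x \<triangleright> x \<triangleright> y \<triangleright> x = x \<triangleright> y" using brD(3) by simp
    then show ?thesis using inv by simp
  qed
  show "y \<triangleright> x = x \<triangleright> y" by (rule c[OF y])
  show "x \<triangleright> x \<triangleright> y = y" using inv by blast
  have b: "br x y" using brs y by blast
  show "(x \<triangleright> y) \<triangleright> x = y" "y \<triangleright> x \<triangleright> y = x" using brD[OF b] by auto
  have "x \<triangleright> y \<in> N y" using br_third(2)[OF b] by (simp add: br_def N_def)
  then show "(x \<triangleright> y) \<triangleright> y = x" using c brD(2)[OF b] by simp
qed

lemma line_ops:
  assumes inv: "\<forall>x y. x \<triangleright> x \<triangleright> y = y" and brs: "\<forall>x. \<forall>y \<in> N x. br x y"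
    and "x \<triangleright> y = z" "z \<noteq> y"
  shows "x \<triangleright> y = z" "y \<triangleright> x = z" "x \<triangleright> z = y" "z \<triangleright> x = y" "y \<triangleright> z = x" "z \<triangleright> y = x"
    "y \<in> N x" "x \<in> N y" "z \<in> N x" "x \<in> N z" "z \<in> N y" "y \<in> N z"
proof -
  have y: "y \<in> N x" using assms(3,4) by (simp add: N_def)
  show ops: "x \<triangleright> y = z" "y \<triangleright> x = z" "x \<triangleright> z = y" "z \<triangleright> x = y" "y \<triangleright> z = x" "z \<triangleright> y = x"
    using involutive_braided[OF inv brs y] assms(3) by auto
  have "x \<noteq> y" using y by auto
  moreover from this have "z \<noteq> x" using assms(3) inj[of x y x] by auto
  ultimately show "y \<in> N x" "x \<in> N y" "z \<in> N x" "x \<in> N z" "z \<in> N y" "y \<in> N z"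
    using ops assms(4) by (simp_all add: N_def)
qed

text \<open>
  Otherwise \<open>a\<close> fixes \<open>b\<close> and moves \<open>i\<close> to \<open>i \<triangleright> a\<close>, so \<open>b\<close> is a neighbour of \<open>i \<triangleright> a\<close>;
  applying \<open>i\<close> turns this into an edge between \<open>a\<close> and \<open>i \<triangleright> b\<close>.
\<close>

lemma meets_line:
  assumes inv: "\<forall>x y. x \<triangleright> x \<triangleright> y = y" and brs: "\<forall>x. \<forall>y \<in> N x. br x y"
    and "a \<in> N i" "b \<in> N i" "b \<notin> N a"
  shows "i \<triangleright> b \<in> N a"
proof -
  have "a \<triangleright> b \<in> N (a \<triangleright> i)" using assms(4) by simp
  then have "b \<in> N (i \<triangleright> a)"
    using involutive_braided(1)[OF inv brs assms(3)] act_fixed[OF assms(5)] by simp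
  then show ?thesis using N_act[of i "i \<triangleright> b" a] inv by simp
qed

text \<open>
  The lines through \<open>i\<close> are \<open>{i, a, a'}\<close> and \<open>{i, b, b'}\<close>. By \<open>meets_line\<close> there is, up to exchanging
  \<open>b\<close> and \<open>b'\<close>, a line \<open>{a, b, c}\<close>, and applying \<open>i\<close> to it gives \<open>{a', b', c}\<close>. These four lines on six points are the dual affine plane
  of order two, the geometry of the transpositions in \<open>\<S>\<^sub>4\<close>.
\<close>

lemma double_transposition_braided:
  assumes i: "i \<in> X" and card: "card (N i) = 4" and br: "\<And>j. j \<in> N i \<Longrightarrow> br i j"
    and Ni: "N i = {a, a', b, b'}" "i \<triangleright> a = a'" "i \<triangleright> a' = a" "i \<triangleright> b = b'" "i \<triangleright> b' = b"
      "distinct [a, a', b, b']"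
  shows "op_table X (\<triangleright>) A_table"
proof -
  have brs: "\<forall>x. \<forall>y \<in> N x. br x y" using braided_nbrs[OF i br] by blast
  have "i \<triangleright> i \<triangleright> j = j" if "j \<in> N i" for j using that Ni by auto
  then have inv: "\<forall>x y. x \<triangleright> x \<triangleright> y = y" using involutive[OF i] by blast
  note line = line_ops[OF inv brs]
  have ni: "i \<noteq> a" "i \<noteq> a'" "i \<noteq> b" "i \<noteq> b'" using Ni(1) irrefl[of i] by auto
  have main: "op_table X (\<triangleright>) A_table"
    if ab: "b \<in> N a" and Ni: "N i = {a, a', b, b'}" "i \<triangleright> b = b'" "i \<triangleright> b' = b"
      and ne: "distinct [a, a', b, b']" "i \<noteq> b" "i \<noteq> b'" for b b'
  proof -
    have X: "a \<in> X" "a' \<in> X" "b \<in> X" "b' \<in> X" using Ni(1) N_sub by auto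
    have "a' \<noteq> a" "b' \<noteq> b" using ne by auto
    note l1 = line[OF \<open>i \<triangleright> a = a'\<close> \<open>a' \<noteq> a\<close>]
    note l2 = line[OF \<open>i \<triangleright> b = b'\<close> \<open>b' \<noteq> b\<close>]
    define c where "c = a \<triangleright> b"
    have "c \<noteq> b" using ab by (simp add: c_def N_def)
    note l3 = line[OF c_def[symmetric] this]
    have cne: "c \<noteq> a" "c \<noteq> i" "c \<noteq> a'" "c \<noteq> b'"
    proof -
      show "c \<noteq> a" using l3(9) by auto
      show "c \<noteq> i" using l3(3) l1(2) ne(1) by auto
      show "c \<noteq> a'" using l3(3) l1(5) ne(2) by auto
      show "c \<noteq> b'" using l3(5) l2(5) ni by auto
    qed
    have cNi: "c \<notin> N i" using cne \<open>c \<noteq> b\<close> Ni(1) by simp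
    have ic: "i \<triangleright> c = c" using act_fixed[OF cNi] .
    have cX: "c \<in> X" using l3(9) N_sub by blast
    have cardX: "card (N x) = 4" if "x \<in> X" for x using card card_N[OF i that] by simp
    have Na: "N a = {i, a', b, c}"
      by (rule card_subset_eq[symmetric])
         (use l1(8,11) l3(7,9) cardX[OF X(1)] ne ni cne \<open>c \<noteq> b\<close> in auto)
    have Nb: "N b = {i, b', a, c}"
      by (rule card_subset_eq[symmetric])
         (use l2(8,11) l3(8,11) cardX[OF X(3)] ne ni cne \<open>c \<noteq> b\<close> in auto)
    have Na': "N a' = {i, a, b', c}" using N_image[of i a] by (simp add: l1 l2 ic Na)
    have Nb': "N b' = {i, b, a', c}" using N_image[of i b] by (simp add: l1 l2 ic Nb)
    have "a' \<triangleright> b' = c" using dist[of i a b] by (simp add: l1 l2 ic flip: c_def)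
    note l4 = line[OF this cne(4)]
    have Nc: "N c = {a, b, a', b'}"
      by (rule card_subset_eq[symmetric])
         (use l3(10,12) l4(10,12) cardX[OF cX] ne in auto)
    have Xe: "{i, a, a', b, b', c} = X"
    proof (rule connected)
      fix y assume "y \<in> {i, a, a', b, b', c}"
      then show "N y \<subseteq> {i, a, a', b, b', c}"
        by (elim insertE) (simp_all add: Ni(1) Na Na' Nb Nb' Nc)
    qed (use i cX X in auto)
    have "b' \<notin> N a" "a' \<notin> N b" using Na Nb ne ni cne by auto
    then have f: "a \<triangleright> b' = b'" "b \<triangleright> a' = a'" by (simp_all add: act_fixed)
    then have f': "b' \<triangleright> a = a" "a' \<triangleright> b = b" "c \<triangleright> i = i" using comm ic by auto
    show ?thesis
    proof (rule op_tableI[of "[i, a, a', b, b', c]"])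
      show "distinct [i, a, a', b, b', c]" using ne ni cne \<open>c \<noteq> b\<close> by auto
      show "set [i, a, a', b, b', c] = X" using Xe by simp
    qed (simp add: A_table_def l1 l2 l3 l4 f f' ic)
  qed
  show ?thesis
  proof (cases "b \<in> N a")
    case True
    then show ?thesis using main[of b b'] Ni ni by simp
  next
    case False
    then have "b' \<in> N a" using meets_line[OF inv brs, of a i b] Ni by simp
    moreover have "N i = {a, a', b', b}" using Ni(1) by auto
    ultimately show ?thesis using main[OF _ _ Ni(5,4)] Ni(6) ni by simp metis
  qed
qed

section \<open>Four neighbours with Hurwitz orbits of size four\<close>

text \<open>
  Under these hypotheses every element fixes or swaps the points \<open>i\<close> and \<open>l\<close>, so \<open>{i, l}\<close> would
  be all of \<open>X\<close>.
\<close>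

lemma pair_not_closed:
  assumes "i \<in> X" "N l = N i" "l \<noteq> i" "\<And>z. z \<in> N i \<Longrightarrow> z \<triangleright> i = l" and inv: "\<And>x y. x \<triangleright> x \<triangleright> y = y"
  shows False
proof -
  obtain a where a: "a \<in> N i" using N_nonempty[OF assms(1)] by blast
  have lX: "l \<in> X" using assms(4)[OF a] act_in[OF assms(1)] by blast
  have "z \<triangleright> i \<in> {i, l} \<and> z \<triangleright> l \<in> {i, l}" for z
  proof (cases "z \<in> N i")
    case True
    then show ?thesis using assms(4) inv by (metis insertCI)
  next
    case False
    then have "i \<notin> N z" "l \<notin> N z" using assms(2) N_sym by auto
    then show ?thesis by (simp add: act_fixed)
  qed
  then have "{i, l} = X" using assms(1) lX by (intro indecomposable) auto
  then show False using a N_mem(1)[OF a] assms(2) irrefl by blast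
qed

text \<open>
  An orbit of size four means \<open>i \<triangleright> j \<triangleright> i \<triangleright> j = j\<close>, which forces \<open>a \<triangleright> b = d\<close>. If \<open>a\<close> and \<open>c\<close> commute, then
  \<open>a\<close> permutes \<open>{i, x, b, d}\<close> for some \<open>x\<close> with the same neighbours as \<open>i\<close>, and a
  four-cycle with \<open>b \<mapsto> d\<close> on this set would make \<open>i\<close> and \<open>x\<close> adjacent. So the graph is complete on five
  points, and \<open>a\<close> has two possible actions, one for each of the two affine racks.
\<close>

lemma four_cycle_square_commuting:
  assumes i: "i \<in> X" and card: "card (N i) = 4" and lab: "\<And>j. j \<in> N i \<Longrightarrow> i \<triangleright> j \<triangleright> i \<triangleright> j = j"
    and Ni: "N i = {a, b, c, d}" "i \<triangleright> a = b" "i \<triangleright> b = c" "i \<triangleright> c = d" "i \<triangleright> d = a" "distinct [a, b, c, d]"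
  shows "op_table X (\<triangleright>) Aff52_table \<or> op_table X (\<triangleright>) Aff53_table"
proof -
  have X: "a \<in> X" "b \<in> X" "c \<in> X" "d \<in> X" using Ni(1) N_sub by auto
  have iN: "i \<in> N a" "i \<in> N b" "i \<in> N c" "i \<in> N d" using Ni(1) N_sym by auto
  have ni: "i \<noteq> a" "i \<noteq> b" "i \<noteq> c" "i \<noteq> d" using Ni(1) irrefl[of i] by auto
  have two: "x \<triangleright> x \<triangleright> y \<noteq> y" if "y \<in> N x" for x y
  proof -
    have "((\<triangleright>) i ^^ 2) j \<noteq> j" if "j \<in> N i" for j
      using that Ni by (auto simp: eval_nat_numeral)
    from no_short_cycle[OF i this \<open>y \<in> N x\<close>] show ?thesis by (simp add: eval_nat_numeral)
  qed
  have "i \<triangleright> a \<triangleright> b = i \<triangleright> d" using lab[of a] Ni by simp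
  then have ab: "a \<triangleright> b = d" by simp
  then have bN: "b \<in> N a" using Ni(6) by (auto simp: N_def)
  have cardN: "card (N x) = 4" if "x \<in> X" for x using card card_N[OF i that] by simp
  obtain u v where uv: "N a = {b, d, u, v}" "a \<triangleright> d = u" "a \<triangleright> u = v" "a \<triangleright> v = b" "distinct [b, d, u, v]"
    using orbit4[OF order_refl im_N cardN[OF X(1)] bN] ab two[OF bN] by metis
  show ?thesis
  proof (cases "c \<in> N a")
    case True
    have "b \<noteq> i" "b \<noteq> c" "d \<noteq> i" "d \<noteq> c" "c \<noteq> i" using ni Ni(6) by auto
    then have iuv: "{u, v} = {i, c}" using iN(1) True uv(1,5) by auto
    have Ns: "N a = {i, b, c, d}" using uv(1) iuv by auto
    have Nb: "N b = {i, c, d, a}" using N_image[of i a] by (simp add: Ns Ni(2-5))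
    have Nc: "N c = {i, d, a, b}" using N_image[of i b] by (simp add: Nb Ni(2-5))
    have Nd: "N d = {i, a, b, c}" using N_image[of i c] by (simp add: Nc Ni(2-5))
    have Xe: "{i, a, b, c, d} = X"
    proof (rule connected)
      fix y assume "y \<in> {i, a, b, c, d}"
      then show "N y \<subseteq> {i, a, b, c, d}" by (elim insertE) (simp_all add: Ni(1) Ns Nb Nc Nd)
    qed (use i X in auto)
    have dis: "distinct [i, a, b, c, d]" using ni Ni(6) by simp
    from iuv consider "u = i" "v = c" | "u = c" "v = i" by (metis doubleton_eq_iff)
    then show ?thesis
    proof cases
      case 1
      have A: "a \<triangleright> i = c" "a \<triangleright> b = d" "a \<triangleright> c = b" "a \<triangleright> d = i" using ab uv 1 by auto
      note B = A[THEN shift[where i = i], unfolded Ni(2-5) idem]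
      note C = B[THEN shift[where i = i], unfolded Ni(2-5) idem]
      note D = C[THEN shift[where i = i], unfolded Ni(2-5) idem]
      have "op_table X (\<triangleright>) Aff52_table"
        by (rule op_tableI[OF dis]) (simp_all add: Xe Aff52_table_def A B C D Ni(2-5))
      then show ?thesis ..
    next
      case 2
      have A: "a \<triangleright> i = b" "a \<triangleright> b = d" "a \<triangleright> c = i" "a \<triangleright> d = c" using ab uv 2 by auto
      note B = A[THEN shift[where i = i], unfolded Ni(2-5) idem]
      note C = B[THEN shift[where i = i], unfolded Ni(2-5) idem]
      note D = C[THEN shift[where i = i], unfolded Ni(2-5) idem]
      have "op_table X (\<triangleright>) Aff53_table"
        by (rule op_tableI[OF dis]) (simp_all add: Xe Aff53_table_def A B C D Ni(2-5))
      then show ?thesis ..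
    qed
  next
    case False
    have idist: "i \<in> {u, v}" using iN(1) uv(1) ni by auto
    have twin: "N x = N i" if x: "x \<in> {u, v}" "x \<noteq> i" for x
    proof -
      have xN: "x \<in> N a" using x uv(1) by auto
      have "x \<noteq> b" "x \<noteq> d" using x uv(5) by auto
      moreover have "x \<noteq> a" "x \<noteq> c" using xN False by auto
      ultimately have xi: "x \<notin> N i" using Ni(1) by simp
      have "a \<in> N x" using xN N_sym by blast
      then have "N i \<subseteq> N x"
        using N_comm[OF xi, of a] N_comm[OF xi, of b] N_comm[OF xi, of c] Ni by auto
      then show ?thesis using N_eqI[OF i] xN N_sub by blast
    qed
    have dNi: "d \<in> N i" using Ni(1) by simp
    show ?thesis
    proof (cases "u = i")
      case True
      then have "N v = N i" using twin[of v] uv(5) by auto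
      moreover have "i \<in> N v" using N_act[of a d i] dNi uv(2,3) True by simp
      ultimately show ?thesis by simp
    next
      case False
      then have "N u = N i" "v = i" using twin[of u] idist by auto
      moreover from this have "u \<in> N i" using N_act[of a d u] dNi uv(2,3) by simp
      ultimately show ?thesis by (metis irrefl)
    qed
  qed
qed

text \<open>
  All elements act as involutions, so the relation for orbits of size four says that \<open>x \<triangleright> y\<close> commutes
  with \<open>y\<close>. Put \<open>l = a \<triangleright> i\<close>. Depending on whether \<open>a\<close> is adjacent to none or to both of \<open>c\<close> and \<open>d\<close>,
  the pair \<open>{i, l}\<close> is closed under the action or the graph is bipartite; being adjacent to exactly
  one of them contradicts that \<open>N l\<close> is closed under \<open>i\<close>.
\<close>

lemma double_transposition_square_commuting:
  assumes i: "i \<in> X" and card: "card (N i) = 4" and lab: "\<And>j. j \<in> N i \<Longrightarrow> i \<triangleright> j \<triangleright> i \<triangleright> j = j"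
    and Ni: "N i = {a, b, c, d}" "i \<triangleright> a = b" "i \<triangleright> b = a" "i \<triangleright> c = d" "i \<triangleright> d = c" "distinct [a, b, c, d]"
  shows False
proof -
  have inv: "x \<triangleright> x \<triangleright> y = y" for x y
    by (rule involutive[OF i]) (use Ni in auto)
  have X: "a \<in> X" "b \<in> X" "c \<in> X" "d \<in> X" using Ni(1) N_sub by auto
  have iN: "i \<in> N a" "i \<in> N b" "i \<in> N c" "i \<in> N d" using Ni(1) N_sym by auto
  have ni: "i \<noteq> a" "i \<noteq> b" "i \<noteq> c" "i \<noteq> d" using Ni(1) irrefl[of i] by auto
  have cardN: "card (N x) = 4" if "x \<in> X" for x using card card_N[OF i that] by simp
  have labs: "x \<triangleright> y \<triangleright> x \<triangleright> y = y" if "y \<in> N x" for x y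
    by (rule invariant_nbrs[OF i, where Q = "\<lambda>x y. x \<triangleright> y \<triangleright> x \<triangleright> y = y"])
       (use lab that in \<open>auto simp flip: dist\<close>)
  have sq: "x \<triangleright> y \<notin> N y" if "y \<in> N x" for x y
  proof -
    have "x \<triangleright> x \<triangleright> y \<triangleright> x \<triangleright> y = x \<triangleright> y" using labs[OF that] by simp
    then show ?thesis using inv by (simp add: N_def)
  qed
  define l where "l = a \<triangleright> i"
  have ab: "b \<notin> N a" "d \<notin> N c" using sq[of a i] sq[of c i] Ni by auto
  have lNi: "l \<notin> N i" using sq[OF iN(1)] by (simp add: l_def)
  have il: "i \<triangleright> l = l" using act_fixed[OF lNi] .
  have bi: "b \<triangleright> i = l" using dist[of i a i] Ni il by (simp flip: l_def)
  have al: "a \<triangleright> l = i" using inv[of a i] by (simp add: l_def)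
  have lna: "l \<in> N a" using iN(1) by (simp add: l_def)
  have li: "l \<noteq> i" using iN(1) by (simp add: l_def N_def)
  have Nl: "N l = {a, b, a \<triangleright> c, a \<triangleright> d}"
    using N_image[of a i] by (simp add: Ni(1) act_fixed[OF ab(1)] flip: l_def)
  have one: False if "c \<in> N a" "d \<notin> N a" "N i = {a, b, c, d}" "i \<triangleright> d = c" "distinct [a, b, c, d]"
    "N l = {a, b, a \<triangleright> c, a \<triangleright> d}" for c d
  proof -
    have "d \<in> N l" using that(2,6) act_fixed by simp
    then have "c \<in> N l" using N_comm[OF lNi, of d] that(4) by simp
    then have "c = a \<triangleright> c" using that(2,5,6) act_fixed[OF that(2)] by auto
    then show False using that(1) by (simp add: N_def)
  qed
  have Nl': "N l = {a, b, a \<triangleright> d, a \<triangleright> c}" "N i = {a, b, d, c}" using Nl Ni(1) by auto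
  have "d \<in> N a" if "c \<in> N a" using one[OF that _ Ni(1,5,6) Nl] by blast
  moreover have "c \<in> N a" if "d \<in> N a" using one[OF that _ Nl'(2) Ni(4) _ Nl'(1)] Ni(6) by auto
  ultimately consider "c \<in> N a" "d \<in> N a" | "c \<notin> N a" "d \<notin> N a"
    by blast
  then show False
  proof cases
    case 1
    have lne: "l \<noteq> c" "l \<noteq> d" "l \<noteq> a" "l \<noteq> b" using lNi Ni(1) by auto
    have Na: "N a = {i, l, c, d}"
      by (rule card_subset_eq[symmetric])
         (use 1 iN lna ni li Ni(6) lne cardN[OF X(1)] in simp_all)
    have "a \<triangleright> c \<in> N a" using 1 by simp
    moreover have "a \<triangleright> c \<noteq> c" using 1 by (simp add: N_def)
    moreover have "a \<triangleright> c \<noteq> i" using al inj[of a c l] lne by auto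
    moreover have "a \<triangleright> c \<noteq> l" unfolding l_def using ni by simp
    ultimately have ac: "a \<triangleright> c = d" using Na by auto
    then have ad: "a \<triangleright> d = c" using inv[of a c] by simp
    have Nli: "N l = N i" using Nl Ni(1) ac ad by auto
    have lcN: "l \<in> N c" "a \<in> N c" "b \<in> N c"
      using Nli Ni(1) N_sym 1 N_act[of i d a] Ni by auto
    have Nc: "N c = {i, l, a, b}"
      by (rule card_subset_eq[symmetric])
         (use lcN iN ni li Ni(6) lne cardN[OF X(3)] in simp_all)
    have "c \<triangleright> i \<in> N c" using iN by simp
    moreover have "c \<triangleright> i \<notin> N i" using sq[OF iN(3)] .
    moreover have "c \<triangleright> i \<noteq> i" using iN by (simp add: N_def)
    ultimately have ci: "c \<triangleright> i = l" using Nc Ni(1) by auto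
    have "d \<triangleright> i = l" using dist[of i c i] Ni il ci by simp
    then have "z \<triangleright> i = l" if "z \<in> N i" for z using that Ni(1) ci bi l_def by auto
    then show False using pair_not_closed[OF i Nli li _ inv] by blast
  next
    case 2
    have fx: "a \<triangleright> c = c" "a \<triangleright> d = d" "c \<triangleright> a = a" "c \<triangleright> d = d"
      using act_fixed 2 ab comm by auto
    have Nli: "N l = N i" using Nl Ni(1) fx by simp
    define l' where "l' = c \<triangleright> i"
    have cbN: "b \<notin> N c" using N_act[of i a d] N_sym 2 Ni by auto
    have Nl': "N l' = N i"
      using N_image[of c i] by (simp add: Ni(1) fx act_fixed[OF cbN] flip: l'_def)
    have l'Ni: "l' \<notin> N i" using sq[OF iN(3)] by (simp add: l'_def)
    have di: "d \<triangleright> i = l'" using dist[of i c i] Ni act_fixed[OF l'Ni] by (simp flip: l'_def)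
    have l'i: "l' \<noteq> i" using iN(3) by (simp add: l'_def N_def)
    show False
    proof (cases "l' = l")
      case True
      then have "z \<triangleright> i = l" if "z \<in> N i" for z using that Ni(1) l'_def di bi l_def by auto
      then show False using pair_not_closed[OF i Nli li _ inv] by blast
    next
      case False
      define m where "m = a \<triangleright> l'"
      have Nm: "N m = N i"
        using N_image[of a l'] by (simp add: Nl' Ni(1) fx act_fixed[OF ab(1)] flip: m_def)
      have mi: "m \<noteq> i" "m \<noteq> l" "m \<noteq> l'"
      proof -
        show "m \<noteq> i" using False al inj[of a l' l] by (auto simp: m_def)
        show "m \<noteq> l" using l'i by (simp add: m_def l_def)
        have "a \<in> N l'" using Nl' Ni(1) by simp
        then have "l' \<in> N a" using N_sym by blast
        then show "m \<noteq> l'" by (simp add: m_def N_def)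
      qed
      have sub: "{i, l, l', m} \<subseteq> N a" "{i, l, l', m} \<subseteq> N c"
        using Nm Nl' Nli Ni(1) N_sym iN by auto
      have "card {i, l, l', m} = 4" using li l'i False mi by auto
      then have "N a = {i, l, l', m}" "N c = {i, l, l', m}"
        using card_subset_eq[OF finite_N sub(1)] card_subset_eq[OF finite_N sub(2)] cardN X by auto
      then have k: "N x = N i" if "x \<in> N a \<union> N c" for x using that Nm Nl' Nli by auto
      have k': "N x = N i" if "j \<in> N i" "x \<in> N j" for j x
      proof -
        consider "j \<in> {a, c}" | "j \<in> {b, d}" using \<open>j \<in> N i\<close> Ni(1) by auto
        then show ?thesis
        proof cases
          case 1 then show ?thesis using k \<open>x \<in> N j\<close> by (metis UnCI insertE singletonD)
        next
          case 2
          then have "i \<triangleright> j \<in> {a, c}" using Ni(3,5) by (elim insertE) simp_all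
          moreover have "i \<triangleright> x \<in> N (i \<triangleright> j)" using \<open>x \<in> N j\<close> by simp
          ultimately have "N (i \<triangleright> x) = N i" using k by (metis UnCI insertE singletonD)
          then have "N (i \<triangleright> i \<triangleright> x) = N (i \<triangleright> i)" by (simp only: N_image[of i i] N_image[of i "i \<triangleright> x"])
          then show ?thesis using inv by simp
        qed
      qed
      then show False using not_bipartite[OF i] by blast
    qed
  qed
qed

section \<open>Neighbourhoods of mixed type\<close>

text \<open>
  The braided pairs partition \<open>X\<close> into lines of three points. The auxiliary fact \<open>F\<close> says that
  an element \<open>x\<close> moves a neighbour \<open>y\<close> that is not on its line only within the line of \<open>y\<close>.
  It follows that the line \<open>{i, a, b}\<close> is closed under the action.
\<close>

lemma not_two_and_two:
  assumes i: "i \<in> X" and cN: "card (N i) = 4" and cL: "card (L i) = 2"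
  shows False
proof -
  have cardN: "card (N x) = 4" if "x \<in> X" for x using cN card_N[OF i that] by simp
  have cardL: "card (L x) = 2" if "x \<in> X" for x using cL card_L[OF i that] by simp
  have LX: "x \<in> X" "y \<in> X" if "y \<in> L x" for x y using that L_sub N_mem by blast+
  have neL: "y \<noteq> x" "x \<triangleright> y \<noteq> y" "x \<triangleright> y \<noteq> x" if "y \<in> L x" for x y
  proof -
    have "y \<in> N x" using that L_sub by blast
    then show "y \<noteq> x" "x \<triangleright> y \<noteq> y" by (auto simp: N_def)
    then show "x \<triangleright> y \<noteq> x" using inj[of x y x] by auto
  qed
  have Leq: "L x = {y, x \<triangleright> y}" "L y = {x, x \<triangleright> y}" if "y \<in> L x" for x y
  proof -
    have "x \<in> L y" "x \<triangleright> y \<in> L y" "x \<triangleright> y \<in> L x" using that L_third L_sym L_stable by blast+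
    then have "{y, x \<triangleright> y} \<subseteq> L x" "{x, x \<triangleright> y} \<subseteq> L y" using that by simp_all
    moreover have "card {y, x \<triangleright> y} = 2" "card {x, x \<triangleright> y} = 2" using neL[OF that] by auto
    ultimately show "L x = {y, x \<triangleright> y}" "L y = {x, x \<triangleright> y}"
      using card_subset_eq[OF finite_L] cardL LX[OF that] by metis+
  qed
  have F: "x \<triangleright> y \<in> L y" if x: "x \<in> X" and y: "y \<in> N x" "y \<notin> L x" for x y
  proof -
    \<comment> \<open>At most one point of \<open>L y\<close> is a neighbour of \<open>x\<close>, so another one is fixed by \<open>x\<close>, and \<open>x\<close> rotates the line about it.\<close>
    have out: "e = x \<triangleright> y" if "e \<in> L y" "e \<in> N x" for e
    proof -
      have "e \<notin> L x"
      proof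
        assume "e \<in> L x"
        have "y \<in> L e" "y \<noteq> x" using that(1) y(1) L_sym by auto
        then have "y = x \<triangleright> e" using Leq(2)[OF \<open>e \<in> L x\<close>] by blast
        then show False using y(2) \<open>e \<in> L x\<close> by simp
      qed
      moreover have "card (N x - L x) = 2"
        using cardN[OF x] cardL[OF x] L_sub by (simp add: card_Diff_subset)
      then have "N x - L x = {y, x \<triangleright> y}"
        using orbit2[of "N x - L x" x y] y by (metis Diff_iff Diff_subset L_stable N_stable image_subsetI)
      ultimately show ?thesis using that neL(1)[OF that(1)] by auto
    qed
    obtain e where e: "e \<in> L y"
      using cardL[of y] y(1) N_mem by (metis card.empty equals0I zero_neq_numeral)
    obtain e where e: "e \<in> L y" "e \<notin> N x"
    proof (cases "e \<in> N x")
      case True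
      have "y \<triangleright> e \<in> L y" using e by simp
      moreover have "y \<triangleright> e \<noteq> e" using neL(2)[OF e] .
      ultimately show ?thesis using that out[OF e True] out by metis
    qed (use that e in blast)
    have "x \<triangleright> y \<in> L (x \<triangleright> e)" using e(1) L_sym by simp
    then have "x \<triangleright> y \<in> L e" using act_fixed[OF e(2)] by simp
    moreover have "x \<triangleright> y \<noteq> y" using y by (simp add: N_def)
    moreover have ye: "y \<in> L e" using e(1) L_sym by blast
    ultimately have "x \<triangleright> y = e \<triangleright> y" using Leq(1)[OF ye] by blast
    then show ?thesis using L_third[OF ye] by simp
  qed
  have "card (N i - L i) = 2"
    using cN cL L_sub by (simp add: card_Diff_subset)
  moreover have "(\<triangleright>) i ` (N i - L i) \<subseteq> N i - L i" by auto
  moreover obtain c where c: "c \<in> N i - L i" using calculation(1) by (metis card.empty equals0I zero_neq_numeral)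
  ultimately obtain d where d: "N i - L i = {c, d}" "i \<triangleright> c = d" "i \<triangleright> d = c" "c \<noteq> d"
    using orbit2[OF Diff_subset] by metis
  have cX: "c \<in> X" using c N_sub by blast
  have dLc: "d \<in> L c" using F[OF i, of c] c d(2) by auto
  have ic: "i \<in> N c" "i \<notin> L c" using c N_sym L_sym by auto
  define a where "a = c \<triangleright> i"
  define b where "b = i \<triangleright> a"
  define e where "e = c \<triangleright> d"
  have aL: "a \<in> L i" using F[OF cX ic] by (simp add: a_def)
  have Li: "L i = {a, b}" using Leq(1)[OF aL] by (simp add: b_def)
  have Lc: "L c = {d, e}" using Leq(1)[OF dLc] by (simp add: e_def)
  have bL: "b \<in> L i" using Li by simp
  have ib: "i \<triangleright> b = a" using Leq(1)[OF bL] Li neL(2)[OF bL] by auto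
  have Ni: "N i = {a, b, c, d}" using d(1) Li L_sub[of i] by blast
  have ne: "a \<noteq> b" "c \<noteq> d" "c \<noteq> a" "c \<noteq> b" "d \<noteq> a" "d \<noteq> b" "i \<noteq> a" "i \<noteq> b" "i \<noteq> c" "i \<noteq> d"
    using d(1,4) Li neL(2)[OF aL] Ni irrefl[of i] by (auto simp: b_def)
  have eb: "e \<noteq> b" "e \<noteq> a" "e \<noteq> c" "e \<noteq> d"
  proof -
    have "b \<notin> L c" using Leq(2)[OF bL] L_sym[of b c] ne ib by auto
    then show "e \<noteq> b" using Lc by auto
    have "a \<notin> L c" using Leq(2)[OF aL] L_sym[of a c] ne by (auto simp flip: b_def)
    then show "e \<noteq> a" using Lc by auto
    show "e \<noteq> c" "e \<noteq> d" using neL(2,3)[OF dLc] by (simp_all add: e_def)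
  qed
  have eNi: "e \<notin> N i" using eb Ni by simp
  have ie: "i \<triangleright> e = e" using act_fixed[OF eNi] .
  have "a \<in> N c" using ic by (simp add: a_def)
  moreover have "a \<notin> L c" using ic by (simp add: a_def)
  moreover have "{i, a, d, e} \<subseteq> N c" using ic Lc L_sub[of c] calculation by auto
  moreover have "card {i, a, d, e} = 4"
    using ne eb ic(2) Lc by auto
  ultimately have Nc: "N c = {i, a, d, e}"
    using card_subset_eq[OF finite_N, of "{i, a, d, e}" c] cardN[OF cX] by simp
  have "b \<notin> N c" using Nc ne eb by auto
  then have cb: "c \<triangleright> b = b" by (rule act_fixed)
  have "c \<triangleright> a \<in> N c" using \<open>a \<in> N c\<close> by simp
  moreover have "c \<triangleright> a \<notin> L c" using \<open>a \<notin> L c\<close> by simp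
  moreover have "c \<triangleright> a \<noteq> a" using ne(7) by (simp add: a_def)
  ultimately have ca: "c \<triangleright> a = i" using Nc Lc by auto
  have Na: "N a = {i, b, c, e}" using N_image[of c i] by (simp add: Ni ca cb flip: a_def e_def)
  have Nb: "N b = {i, a, d, e}" using N_image[of i a] by (simp add: Na ib ie d flip: b_def)
  have ba: "b \<triangleright> i = a" "b \<triangleright> a = i" "a \<triangleright> i = b" "a \<triangleright> b = i"
    using L_ops[OF aL] L_ops[OF bL] by (simp_all add: ib flip: b_def)
  have di: "d \<triangleright> i = b" using dist[of i c i] by (simp add: d flip: a_def b_def)
  have ea: "e \<triangleright> a = b" using dist[of c d i] by (simp add: di cb flip: a_def e_def)
  have db: "d \<triangleright> b = i" using dist[of i c a] by (simp add: d ca flip: b_def)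
  have eb': "e \<triangleright> b = a" using dist[of i e a] by (simp add: ea ib ie flip: b_def)
  have "z \<triangleright> s \<in> {i, a, b}" if s: "s \<in> {i, a, b}" for z s
  proof (cases "z \<in> N s")
    case False
    then show ?thesis using s act_fixed N_sym by metis
  next
    case True
    from s show ?thesis
    proof (elim insertE emptyE)
      assume "s = i"
      then show ?thesis using True by (auto simp: Ni ba di simp flip: a_def)
    next
      assume "s = a"
      then show ?thesis using True by (auto simp: Na ba ca ea simp flip: b_def)
    next
      assume "s = b"
      then show ?thesis using True by (auto simp: Nb ba db eb' ib)
    qed
  qed
  moreover have "{i, a, b} \<subseteq> X" using i aL bL LX by blast
  ultimately have "{i, a, b} = X" by (intro indecomposable) auto
  then show False using cX ne by auto
qed

text \<open>
  The braided pairs partition \<open>X\<close> into blocks of four points, on which each point acts as a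
  three-cycle of the others. The two remaining neighbours \<open>b\<close>, \<open>b'\<close> of \<open>i\<close> lie in a common block together with
  points fixed by \<open>i\<close>. So \<open>i\<close> acts on this block as a transposition, which is not
  compatible with the three-cycles.
\<close>

lemma not_three_and_two:
  assumes i: "i \<in> X" and cN: "card (N i) = 5" and cL: "card (L i) = 3"
  shows False
proof -
  have cardL: "card (L x) = 3" if "x \<in> X" for x using cL card_L[OF i that] by simp
  have LX: "x \<in> X" "y \<in> X" if "y \<in> L x" for x y using that L_sub N_mem by blast+
  have Leq: "L y = insert x (L x - {y})" "x \<triangleright> x \<triangleright> y \<noteq> y" if y: "y \<in> L x" for x y
  proof -
    obtain u v where uv: "L x = {y, u, v}" "x \<triangleright> y = u" "x \<triangleright> u = v" "x \<triangleright> v = y" "distinct [y, u, v]"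
      using orbit3[OF L_sub _ cardL[OF LX(1)[OF y]] y] by (metis L_stable image_subsetI)
    have "u \<in> L y" using L_third[OF y] uv(2) by simp
    moreover have "v \<in> L y" using L_third[of v x] uv(1,4) L_sym by simp
    moreover have "x \<in> L y" using y L_sym by blast
    moreover have "x \<notin> L x" using L_sub irrefl by blast
    then have "card {x, u, v} = 3" using uv(1,5) by auto
    ultimately have "L y = {x, u, v}"
      using card_subset_eq[OF finite_L, of "{x, u, v}" y] cardL[OF LX(2)[OF y]] by simp
    then show "L y = insert x (L x - {y})" using uv(1,5) by auto
    show "x \<triangleright> x \<triangleright> y \<noteq> y" using uv(2,3,5) by auto
  qed
  have c2: "card (N i - L i) = 2"
    using cN cL L_sub by (simp add: card_Diff_subset)
  moreover have "(\<triangleright>) i ` (N i - L i) \<subseteq> N i - L i" by auto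
  moreover obtain b where b: "b \<in> N i - L i" using c2 by (metis card.empty equals0I zero_neq_numeral)
  ultimately obtain b' where b': "N i - L i = {b, b'}" "i \<triangleright> b = b'" "i \<triangleright> b' = b" "b \<noteq> b'"
    using orbit2[OF Diff_subset] by metis
  have bX: "b \<in> X" using b N_sub by blast
  \<comment> \<open>The block of \<open>b\<close> meets \<open>N i\<close> in at most \<open>b\<close> and \<open>b'\<close>.\<close>
  have only: "e = b'" if "e \<in> L b" "e \<in> N i" for e
  proof -
    have "e \<notin> L i"
    proof
      assume "e \<in> L i"
      then have "b \<in> insert i (L i - {e})" using Leq(1)[of e i] that(1) L_sym by blast
      then show False using b by auto
    qed
    moreover have "e \<noteq> b" using that(1) L_sub irrefl by blast
    ultimately show ?thesis using that(2) b'(1) by blast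
  qed
  obtain e where e: "e \<in> L b" "e \<notin> N i"
  proof -
    have "\<not> L b \<subseteq> {b'}"
    proof
      assume "L b \<subseteq> {b'}"
      then have "card (L b) \<le> card {b'}" by (intro card_mono) auto
      then show False using cardL[OF bX] by simp
    qed
    then show ?thesis using that only by blast
  qed
  have ie: "i \<triangleright> e = e" using act_fixed[OF e(2)] .
  have be: "b \<in> L e" using e(1) L_sym by blast
  define u where "u = e \<triangleright> b"
  have u: "u \<in> L e" using be by (simp add: u_def)
  have eb': "e \<triangleright> b' = i \<triangleright> u" using dist[of i e b] b' ie by (simp add: u_def)
  have "u \<noteq> b'"
  proof
    assume "u = b'"
    then have "e \<triangleright> e \<triangleright> b = b" using eb' b' by (simp flip: u_def)
    then show False using Leq(2)[OF be] by simp
  qed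
  moreover have ub: "u \<noteq> b" using be L_sub[of e] by (auto simp: u_def N_def)
  then have "u \<in> L b" using Leq(1)[OF e(1)] u by blast
  ultimately have "u \<notin> N i" using only by blast
  then have "e \<triangleright> b' = e \<triangleright> b" using eb' act_fixed by (simp add: u_def)
  then show False using b'(4) by simp
qed

section \<open>Five or six braided neighbours\<close>

text \<open>
  The cycle of \<open>a\<close> contains \<open>b \<mapsto> i \<mapsto> e \<mapsto> p\<close>. If \<open>p\<close> is not a neighbour of \<open>i\<close>, this closes to a four-cycle;
  if \<open>p = b\<close>, it closes to a three-cycle; and both are excluded at \<open>a\<close> as they are at \<open>i\<close>.
  For \<open>p = c\<close> and \<open>p = d\<close>, rotating the braid relations of \<open>a\<close> and \<open>e\<close> gives two values for one product.
\<close>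

lemma not_five_cycle:
  assumes i: "i \<in> X" and br: "\<And>j. j \<in> N i \<Longrightarrow> br i j"
    and Ni: "N i = {a, b, c, d, e}" "i \<triangleright> a = b" "i \<triangleright> b = c" "i \<triangleright> c = d" "i \<triangleright> d = e" "i \<triangleright> e = a"
      "distinct [a, b, c, d, e]"
  shows False
proof -
  have brs: "br x y" if "y \<in> N x" for x y using braided_nbrs[OF i br that] .
  have A: "a \<triangleright> b = i" "a \<triangleright> i = e" using brD[OF br, of a] brD[OF br, of e] Ni by auto
  have "i \<in> N a" using Ni(1) N_sym by auto
  then have eN: "e \<in> N a" using A N_stable[of a i] by simp
  define p where "p = a \<triangleright> e"
  have ep: "e \<triangleright> p = a" and pa: "p \<triangleright> a = e" using brD[OF brs[OF eN]] by (simp_all add: p_def)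
  have pN: "p \<noteq> a" "p \<noteq> e" using eN inj[of a e a] Ni(7) by (auto simp: p_def N_def)
  show False
  proof (cases "p \<in> N i")
    case True
    then consider "p = b" | "p = c" | "p = d" using pN Ni(1) by auto
    then show False
    proof cases
      case 1
      have "((\<triangleright>) i ^^ 3) j \<noteq> j" if "j \<in> N i" for j using that Ni by (auto simp: eval_nat_numeral)
      from no_short_cycle[OF i this eN] show False using A 1 by (simp add: eval_nat_numeral flip: p_def)
    next
      case 2
      have "a \<triangleright> d = b" using dist[of i e p] ep Ni 2 by simp
      moreover have "d \<triangleright> b = a" using dist[of i c a] pa Ni 2 by simp
      then have "e \<triangleright> c = b" using dist[of i d b] Ni by simp
      then have "a \<triangleright> d = c" using dist[of i e c] Ni by simp
      ultimately show False using Ni(7) by simp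
    next
      case 3
      have "a \<triangleright> e = b" using dist[of i e p] ep Ni 3 by simp
      then show False using 3 Ni(7) by (simp add: p_def)
    qed
  next
    case False
    have "a \<triangleright> p = b" using dist[of i e p] ep Ni act_fixed[OF False] by simp
    moreover have "((\<triangleright>) i ^^ 4) j \<noteq> j" if "j \<in> N i" for j using that Ni by (auto simp: eval_nat_numeral)
    from no_short_cycle[OF i this eN] have "a \<triangleright> a \<triangleright> a \<triangleright> a \<triangleright> e \<noteq> e" by (simp add: eval_nat_numeral)
    ultimately show False using A by (simp flip: p_def)
  qed
qed

text \<open>
  The two-cycles partition \<open>X\<close> into lines of three points (\<open>Dsym\<close>). Consider the line through a neighbour \<open>a\<close> of \<open>i\<close>
  that is not on the line of \<open>i\<close>. If \<open>i\<close> fixed another point of it, the line would also contain \<open>i \<triangleright> a\<close>,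
  which lies on a longer cycle of \<open>a\<close>. So the other two points are neighbours of \<open>i\<close>. They avoid the line of \<open>i\<close>,
  the point \<open>a\<close>, and the two points next to \<open>a\<close> in its cycle under \<open>i\<close>. Six neighbours do not leave room for two such points.
\<close>

lemma not_mixed_transposition:
  assumes i: "i \<in> X" and br: "\<And>j. j \<in> N i \<Longrightarrow> br i j" and cN: "card (N i) \<le> 6"
    and cD: "card {y \<in> N i. i \<triangleright> i \<triangleright> y = y} = 2" and a: "a \<in> N i" "i \<triangleright> i \<triangleright> a \<noteq> a"
  shows False
proof -
  define D where "D = (\<lambda>x. {y \<in> N x. x \<triangleright> x \<triangleright> y = y})"
  have brs: "br x y" if "y \<in> N x" for x y using braided_nbrs[OF i br that] .
  have fD: "finite (D x)" for x by (simp add: D_def)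
  have D_act: "z \<triangleright> y \<in> D (z \<triangleright> x) \<longleftrightarrow> y \<in> D x" for x y z
    by (simp add: D_def flip: dist)
  have cardD: "card (D x) = 2" if "x \<in> X" for x
  proof (rule homogeneous[OF i that])
    show "card (D i) = 2" using cD by (simp add: D_def)
  next
    fix x z assume "card (D x) = 2"
    moreover have "D (z \<triangleright> x) = (\<triangleright>) z ` D x"
    proof (intro equalityI subsetI)
      fix y assume y: "y \<in> D (z \<triangleright> x)"
      obtain w where w: "z \<triangleright> w = y" using surj by blast
      then have "w \<in> D x" using y D_act by blast
      then show "y \<in> (\<triangleright>) z ` D x" using w by blast
    qed (use D_act in blast)
    ultimately show "card (D (z \<triangleright> x)) = 2" by (simp add: card_image inj_on_def)
  qed
  have Dsym: "x \<in> D y" "y \<triangleright> x = x \<triangleright> y" "D y = {x, x \<triangleright> y}" "x \<triangleright> y \<in> D x" if "y \<in> D x" for x y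
  proof -
    have y: "y \<in> N x" "x \<triangleright> x \<triangleright> y = y" using that by (auto simp: D_def)
    note b = brD[OF brs[OF y(1)]]
    have "x \<triangleright> y \<triangleright> x = x \<triangleright> x \<triangleright> y" using b(3) y(2) by simp
    then show c: "y \<triangleright> x = x \<triangleright> y" by simp
    have xy: "x \<in> N y" using y(1) N_sym by blast
    then show xD: "x \<in> D y" using b(2) by (simp add: D_def c)
    have "y \<triangleright> y \<triangleright> x \<triangleright> y = x \<triangleright> y" using b(2) by (simp add: c)
    then have "x \<triangleright> y \<in> D y" using xy N_stable[of y x] by (simp add: D_def c)
    moreover have "x \<noteq> x \<triangleright> y" using y(1) inj[of x x y] by auto
    then have "card {x, x \<triangleright> y} = 2" by simp
    ultimately show "D y = {x, x \<triangleright> y}"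
      using card_subset_eq[OF fD, of "{x, x \<triangleright> y}" y] xD cardD N_mem(1)[OF y(1)] by simp
    show "x \<triangleright> y \<in> D x" using y by (simp add: D_def)
  qed
  define b where "b = i \<triangleright> a"
  obtain z where z: "i \<triangleright> z = a" using surj by blast
  have zN: "z \<in> N i" using a(1) z N_stable by blast
  have bN: "b \<in> N i" using a(1) by (simp add: b_def)
  obtain w where w: "i \<triangleright> w = z" using surj by blast
  have wN: "w \<in> N i" using zN w N_stable by blast
  have ab: "a \<triangleright> b = i" using brD(2)[OF brs[OF a(1)]] by (simp add: b_def)
  have ai: "a \<triangleright> i = z" using brD(1)[OF brs[OF zN]] by (simp add: z)
  have za: "z \<triangleright> a = i" using brD(2)[OF brs[OF zN]] by (simp add: z)
  have zi: "z \<triangleright> i = w" using brD(1)[OF brs[OF wN]] by (simp add: w)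
  have bz: "b \<noteq> z" using a(2) z unfolding b_def by metis
  have wa: "w \<noteq> a" using bz w by (auto simp: b_def)
  have bDa: "b \<notin> D a" using ab ai bz by (auto simp: D_def)
  have aDz: "a \<notin> D z" using za zi wa by (auto simp: D_def)
  have aDi: "a \<notin> D i" using a(2) by (simp add: D_def)
  have Di: "i \<triangleright> y \<in> D i \<longleftrightarrow> y \<in> D i" for y using D_act[of i y i] by simp
  have bDi: "b \<notin> D i" using aDi Di by (simp add: b_def)
  have zDi: "z \<notin> D i" using aDi Di[of z] by (simp add: z)
  have "D a \<subseteq> N i - (D i \<union> {a, b, z})"
  proof
    fix c assume c: "c \<in> D a"
    have "c \<noteq> b" using c bDa by blast
    moreover have "c \<noteq> z" using Dsym(1)[OF c] aDz by blast
    moreover have "c \<noteq> a" using c by (auto simp: D_def)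
    moreover have "c \<in> N i"
    proof (rule ccontr)
      assume "c \<notin> N i"
      then have "i \<triangleright> c = c" by (rule act_fixed)
      moreover have "i \<triangleright> a \<in> D (i \<triangleright> c)" using D_act Dsym(1)[OF c] by blast
      ultimately have "b \<in> D c" by (simp add: b_def)
      moreover have "b \<noteq> a" using a(1) by (simp add: b_def N_def)
      ultimately have "b = a \<triangleright> c" using Dsym(3)[OF c] by blast
      then show False using Dsym(4)[OF c] bDa by simp
    qed
    moreover have "c \<notin> D i"
    proof
      assume ci: "c \<in> D i"
      have "a \<noteq> i" using a(1) by auto
      then have "a = i \<triangleright> c" using Dsym(1)[OF c] Dsym(3)[OF ci] by blast
      then show False using ci Di aDi by simp
    qed
    ultimately show "c \<in> N i - (D i \<union> {a, b, z})" by simp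
  qed
  then have "card (D a) \<le> card (N i - (D i \<union> {a, b, z}))"
    by (intro card_mono) auto
  also have "\<dots> = card (N i) - card (D i \<union> {a, b, z})"
    using a(1) bN zN fD by (intro card_Diff_subset) (auto simp: D_def)
  also have "card (D i \<union> {a, b, z}) = card (D i) + card {a, b, z}"
    using aDi bDi zDi fD by (intro card_Un_disjoint) auto
  also have "card {a, b, z} = 3"
    using bz a(1) z by (auto simp: b_def N_def)
  finally show False using cN cardD[OF i] cardD N_mem(1)[OF a(1)] by simp
qed

text \<open>
  Each three-cycle of \<open>i\<close> forms a tetrahedron together with \<open>i\<close> (\<open>tetra\<close>). A neighbour \<open>x\<close> of \<open>a\<close>
  that commutes with \<open>i\<close> would be adjacent to all of \<open>a\<close>, \<open>b\<close>, \<open>c\<close>, but with them in different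
  three-cycles of \<open>x\<close>, which needs nine neighbours. So the graph is complete
  on seven points, where an edge would lie in two tetrahedra.
\<close>

lemma not_two_three_cycles:
  assumes i: "i \<in> X" and br: "\<And>j. j \<in> N i \<Longrightarrow> br i j" and cN: "card (N i) = 6"
    and three: "\<And>j. j \<in> N i \<Longrightarrow> i \<triangleright> i \<triangleright> i \<triangleright> j = j"
  shows False
proof -
  have brs: "br x y" if "y \<in> N x" for x y using braided_nbrs[OF i br that] .
  have cardN: "card (N x) = 6" if "x \<in> X" for x using cN card_N[OF i that] by simp
  have thr: "x \<triangleright> x \<triangleright> x \<triangleright> y = y" for x y
  proof (cases "y \<in> N x")
    case True
    show ?thesis
      by (rule invariant_nbrs[OF i, where Q = "\<lambda>x y. x \<triangleright> x \<triangleright> x \<triangleright> y = y"])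
         (use three True in \<open>auto simp flip: dist\<close>)
  qed (simp add: act_fixed)
  have tetra: "y \<triangleright> x \<triangleright> y = x" "y \<triangleright> x = x \<triangleright> x \<triangleright> y" "y \<triangleright> x \<triangleright> x \<triangleright> y = x \<triangleright> y" if "y \<in> N x" for x y
  proof -
    show 1: "y \<triangleright> x \<triangleright> y = x" using brD(2)[OF brs[OF that]] .
    have "x \<triangleright> x \<triangleright> y \<in> N x" using that by simp
    from brD(1)[OF brs[OF this]] have "y \<triangleright> x = x \<triangleright> x \<triangleright> y" using thr by simp
    then show 2: "y \<triangleright> x = x \<triangleright> x \<triangleright> y" .
    show "y \<triangleright> x \<triangleright> x \<triangleright> y = x \<triangleright> y" using thr[of y "x \<triangleright> y"] by (simp add: 1 2)
  qed
  obtain a where aN: "a \<in> N i" using N_nonempty[OF i] by blast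
  define b where "b = i \<triangleright> a"
  define c where "c = i \<triangleright> b"
  have ic: "i \<triangleright> c = a" using thr[of i a] by (simp add: b_def c_def)
  have bN: "b \<in> N i" and cNi: "c \<in> N i" using aN by (simp_all add: b_def c_def)
  note io = b_def[symmetric] c_def[symmetric] ic
  have A: "a \<triangleright> b = i" "a \<triangleright> i = c" "a \<triangleright> c = b"
    using tetra[OF aN] by (simp_all add: io)
  have abc: "a \<noteq> b" "b \<noteq> c" "a \<noteq> c"
    using aN bN cNi ic by (auto simp: N_def b_def c_def)
  have aX: "a \<in> X" using aN N_sub by blast
  have "N a \<subseteq> insert i (N i)"
  proof
    fix x assume xN: "x \<in> N a"
    show "x \<in> insert i (N i)"
    proof (rule ccontr)
      assume "x \<notin> insert i (N i)"
      then have xi: "x \<noteq> i" "x \<notin> N i" by auto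
      have ix: "i \<triangleright> x = x" using act_fixed[OF xi(2)] .
      have ax: "a \<in> N x" using xN N_sym by blast
      then have bx: "b \<in> N x" using N_comm[OF xi(2)] by (simp add: b_def)
      then have cx: "c \<in> N x" using N_comm[OF xi(2)] by (simp add: c_def)
      have axa: "a \<triangleright> x \<triangleright> a = x" using tetra(1)[OF ax] .
      have xa: "x \<triangleright> a \<noteq> b" "x \<triangleright> a \<noteq> c"
        using axa A xi bN by auto
      have sh: "x \<triangleright> b = i \<triangleright> x \<triangleright> a" "x \<triangleright> c = i \<triangleright> x \<triangleright> b"
        using dist[of i x a] dist[of i x b] by (simp_all add: io ix)
      have xb: "x \<triangleright> b \<noteq> c" "x \<triangleright> b \<noteq> a"
        using xa sh(1) c_def ic inj by metis+
      have xc: "x \<triangleright> c \<noteq> a" "x \<triangleright> c \<noteq> b"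
        using xb sh(2) b_def ic inj by metis+
      have self: "x \<triangleright> a \<noteq> a" "x \<triangleright> b \<noteq> b" "x \<triangleright> c \<noteq> c" using ax bx cx by (simp_all add: N_def)
      \<comment> \<open>Six neighbours of \<open>x\<close> are used up, but \<open>x \<triangleright> x \<triangleright> a\<close> is a seventh.\<close>
      have "card {a, b, c, x \<triangleright> a, x \<triangleright> b, x \<triangleright> c} = 6"
        using abc xa xb xc self by auto
      moreover have "{a, b, c, x \<triangleright> a, x \<triangleright> b, x \<triangleright> c} \<subseteq> N x" using ax bx cx by simp
      ultimately have Nx: "N x = {a, b, c, x \<triangleright> a, x \<triangleright> b, x \<triangleright> c}"
        using card_subset_eq[OF finite_N] cardN N_mem(2)[OF ax] by metis
      have "x \<triangleright> x \<triangleright> a \<in> N x" using ax by simp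
      moreover have "x \<triangleright> x \<triangleright> a \<noteq> x \<triangleright> a" "x \<triangleright> x \<triangleright> a \<noteq> x \<triangleright> b" "x \<triangleright> x \<triangleright> a \<noteq> x \<triangleright> c"
        using xa self by simp_all
      moreover have "x \<triangleright> x \<triangleright> a \<noteq> a" using thr[of x a] self(1) by metis
      moreover have "x \<triangleright> x \<triangleright> a \<noteq> b" using thr[of x a] xb(2) by metis
      moreover have "x \<triangleright> x \<triangleright> a \<noteq> c" using thr[of x a] xc(1) by metis
      ultimately show False using Nx by blast
    qed
  qed
  then have sub: "N a \<subseteq> insert i (N i - {a})" by auto
  have "card (insert i (N i - {a})) = 6" using aN cN by simp
  then have Na: "N a = insert i (N i - {a})"
    using card_subset_eq[OF _ sub] cardN[OF aX] by simp
  have "\<not> N i \<subseteq> {a, b, c}"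
  proof
    assume "N i \<subseteq> {a, b, c}"
    then have "card (N i) \<le> card {a, b, c}" by (intro card_mono) auto
    also have "\<dots> \<le> 3" by (simp add: card_insert_if)
    finally show False using cN by simp
  qed
  then obtain y where y: "y \<in> N i" "y \<notin> {a, b, c}" by blast
  define u where "u = i \<triangleright> y"
  define v where "v = i \<triangleright> u"
  have iv: "i \<triangleright> v = y" using thr[of i y] by (simp add: u_def v_def)
  have Y: "y \<triangleright> u = i" "y \<triangleright> v = u" using tetra[OF y(1)] by (simp_all add: u_def v_def)
  have uN: "u \<in> N i" "v \<in> N i" using y(1) by (simp_all add: u_def v_def)
  have uv: "y \<noteq> u" "u \<noteq> v" "y \<noteq> v" using y(1) uN iv by (auto simp: N_def u_def v_def)
  have uvo: "u \<notin> {a, b, c}" "v \<notin> {a, b, c}"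
  proof -
    have *: "s \<in> {a, b, c}" if "i \<triangleright> s \<in> {a, b, c}" for s
      using that inj[of i s a] inj[of i s b] inj[of i s c] by (auto simp: io)
    show u: "u \<notin> {a, b, c}" using *[of y] y(2) unfolding u_def by blast
    show "v \<notin> {a, b, c}" using *[of u] u unfolding v_def by blast
  qed
  have "{a, b, c, y, u, v} \<subseteq> N i" using aN bN cNi y(1) uN by simp
  moreover have "card {a, b, c, y, u, v} = 6" using abc uv y(2) uvo by auto
  ultimately have Ni: "N i = {a, b, c, y, u, v}"
    using card_subset_eq[OF finite_N] cN by metis
  have yNa: "y \<in> N a" using Na y by simp
  have "a \<triangleright> y \<in> N a" using yNa by simp
  moreover have "a \<triangleright> y \<noteq> i" using A(1) y(2) inj[of a y b] by auto
  moreover have "a \<triangleright> y \<noteq> b" using A(3) y(2) inj[of a y c] by auto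
  moreover have "a \<triangleright> y \<noteq> c" using A(2) y(1) inj[of a y i] by auto
  moreover have "a \<triangleright> y \<noteq> y" using yNa by (simp add: N_def)
  ultimately consider "a \<triangleright> y = u" | "a \<triangleright> y = v" using Na Ni by auto
  then show False
  proof cases
    case 1
    then have "a = i" using tetra(1)[OF yNa] Y(1) by simp
    then show False using aN by simp
  next
    case 2
    then have "a = u" using tetra(1)[OF yNa] Y(2) by simp
    then show False using uvo by simp
  qed
qed

text \<open>
  The cycle of \<open>a\<close> contains \<open>b \<mapsto> i \<mapsto> f \<mapsto> p\<close>. As cycles of length three and four are excluded, \<open>p\<close> is one
  of \<open>c\<close>, \<open>d\<close>, \<open>e\<close>, and \<open>p = e\<close> is incompatible with rotation by \<open>i\<close>. Rotating the braid relations of the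
  pair \<open>a\<close>, \<open>f\<close> then gives the whole action of \<open>a\<close>: in both cases the graph is complete
  on seven points, and the two cases are the two affine racks.
\<close>

lemma six_cycle:
  assumes i: "i \<in> X" and br: "\<And>j. j \<in> N i \<Longrightarrow> br i j" and cN: "card (N i) = 6"
    and Ni: "N i = {a, b, c, d, e, f}" "i \<triangleright> a = b" "i \<triangleright> b = c" "i \<triangleright> c = d" "i \<triangleright> d = e" "i \<triangleright> e = f"
      "i \<triangleright> f = a" "distinct [a, b, c, d, e, f]"
  shows "op_table X (\<triangleright>) Aff73_table \<or> op_table X (\<triangleright>) Aff75_table"
proof -
  have brs: "br x y" if "y \<in> N x" for x y using braided_nbrs[OF i br that] .
  have X: "a \<in> X" "b \<in> X" "c \<in> X" "d \<in> X" "e \<in> X" "f \<in> X" using Ni(1) N_sub by auto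
  have ni: "i \<noteq> a" "i \<noteq> b" "i \<noteq> c" "i \<noteq> d" "i \<noteq> e" "i \<noteq> f" using Ni(1) irrefl[of i] by auto
  have A: "a \<triangleright> b = i" "a \<triangleright> i = f" using brD[OF br, of a] brD[OF br, of f] Ni by auto
  have iN: "i \<in> N a" using Ni(1) N_sym by auto
  then have fN: "f \<in> N a" using A N_stable[of a i] by simp
  define p where "p = a \<triangleright> f"
  have fp: "f \<triangleright> p = a" and pa: "p \<triangleright> a = f" using brD[OF brs[OF fN]] by (simp_all add: p_def)
  have pN: "p \<noteq> a" "p \<noteq> f" using fN inj[of a f a] Ni(8) by (auto simp: p_def N_def)
  have "p \<in> N i"
  proof (rule ccontr)
    assume "p \<notin> N i"
    then have "a \<triangleright> p = b" using dist[of i f p] fp Ni act_fixed by simp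
    moreover have "((\<triangleright>) i ^^ 4) j \<noteq> j" if "j \<in> N i" for j using that Ni by (auto simp: eval_nat_numeral)
    from no_short_cycle[OF i this fN] have "a \<triangleright> a \<triangleright> a \<triangleright> a \<triangleright> f \<noteq> f" by (simp add: eval_nat_numeral)
    ultimately show False using A by (simp flip: p_def)
  qed
  moreover have "p \<noteq> b"
  proof
    assume pb: "p = b"
    have "((\<triangleright>) i ^^ 3) j \<noteq> j" if "j \<in> N i" for j using that Ni by (auto simp: eval_nat_numeral)
    from no_short_cycle[OF i this fN] show False using A pb by (simp add: eval_nat_numeral flip: p_def)
  qed
  moreover have "p \<noteq> e"
  proof
    assume pe: "p = e"
    have "a \<triangleright> f = b" using dist[of i f p] fp Ni pe by simp
    then show False using pe Ni(8) by (simp add: p_def)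
  qed
  ultimately have pcd: "p = c \<or> p = d" using pN Ni(1) by auto
  have complete: "{i, a, b, c, d, e, f} = X" if Na: "N a = {b, c, d, e, f, i}"
  proof -
    have Nb: "N b = {c, d, e, f, a, i}" using N_image[of i a] by (simp add: Na Ni(2-7))
    have Nc: "N c = {d, e, f, a, b, i}" using N_image[of i b] by (simp add: Nb Ni(2-7))
    have Nd: "N d = {e, f, a, b, c, i}" using N_image[of i c] by (simp add: Nc Ni(2-7))
    have Ne: "N e = {f, a, b, c, d, i}" using N_image[of i d] by (simp add: Nd Ni(2-7))
    have Nf: "N f = {a, b, c, d, e, i}" using N_image[of i e] by (simp add: Ne Ni(2-7))
    show ?thesis
    proof (rule connected)
      fix y assume "y \<in> {i, a, b, c, d, e, f}"
      then show "N y \<subseteq> {i, a, b, c, d, e, f}"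
        by (elim insertE) (simp_all add: Ni(1) Na Nb Nc Nd Ne Nf)
    qed (use i X in auto)
  qed
  {
    assume pc: "p = c"
    have A2: "a \<triangleright> f = c" "a \<triangleright> d = b"
      using dist[of i f p] fp Ni pc by (simp_all add: p_def)
    have "d \<triangleright> b = a" using dist[of i c a] pa Ni pc by simp
    then have "e \<triangleright> c = b" using dist[of i d b] Ni by simp
    then have "f \<triangleright> d = c" using dist[of i e c] Ni by simp
    then have A3: "a \<triangleright> e = d" using dist[of i f d] Ni by simp
    have "{b, c, d, e, f, i} \<subseteq> N a"
      using A A2 A3 Ni(8) ni iN N_stable[of a f] fN by (auto simp: N_def)
    moreover have "card {b, c, d, e, f, i} = 6" using Ni(8) ni by auto
    ultimately have Na: "N a = {b, c, d, e, f, i}"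
      using card_subset_eq[OF finite_N, of "{b, c, d, e, f, i}" a] cN card_N[OF i X(1)] by simp
    have cNa: "c \<in> N a" using Na by simp
    then have "a \<triangleright> c \<in> N a" "a \<triangleright> c \<noteq> c" using N_stable by (blast, simp add: N_def)
    moreover have "a \<triangleright> c \<noteq> i" "a \<triangleright> c \<noteq> f" "a \<triangleright> c \<noteq> b" "a \<triangleright> c \<noteq> d"
      using inj[of a c b] inj[of a c i] inj[of a c d] inj[of a c e] A A2 A3 Ni(8) ni by auto
    ultimately have A4: "a \<triangleright> c = e" unfolding Na by blast
    note A = A A2 A3 A4
    note B = A[THEN shift[where i = i], unfolded Ni(2-7) idem]
    note C = B[THEN shift[where i = i], unfolded Ni(2-7) idem]
    note D = C[THEN shift[where i = i], unfolded Ni(2-7) idem]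
    note E = D[THEN shift[where i = i], unfolded Ni(2-7) idem]
    note F = E[THEN shift[where i = i], unfolded Ni(2-7) idem]
    note Xe = complete[OF Na]
    have "distinct [i, a, b, c, d, e, f]" using ni Ni(8) by auto
    then have "op_table X (\<triangleright>) Aff75_table"
      by (rule op_tableI) (simp_all add: Xe Aff75_table_def A B C D E F Ni(2-7))
  }
  moreover
  {
    assume pd: "p = d"
    have A2: "a \<triangleright> f = d" "a \<triangleright> e = b"
      using dist[of i f p] fp Ni pd by (simp_all add: p_def)
    have "e \<triangleright> b = a" using dist[of i d a] pa Ni pd by simp
    then have "f \<triangleright> c = b" using dist[of i e b] Ni by simp
    then have A3: "a \<triangleright> d = c" using dist[of i f c] Ni by simp
    have "c \<in> N a" using A3 N_stable[of a d] A2 N_stable[of a f] fN by simp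
    then have "{b, c, d, e, f, i} \<subseteq> N a"
      using A A2 A3 Ni(8) ni iN fN by (auto simp: N_def)
    moreover have "card {b, c, d, e, f, i} = 6" using Ni(8) ni by auto
    ultimately have Na: "N a = {b, c, d, e, f, i}"
      using card_subset_eq[OF finite_N, of "{b, c, d, e, f, i}" a] cN card_N[OF i X(1)] by simp
    have cNa: "c \<in> N a" using Na by simp
    then have "a \<triangleright> c \<in> N a" "a \<triangleright> c \<noteq> c" using N_stable by (blast, simp add: N_def)
    moreover have "a \<triangleright> c \<noteq> i" "a \<triangleright> c \<noteq> f" "a \<triangleright> c \<noteq> b" "a \<triangleright> c \<noteq> d"
      using inj[of a c b] inj[of a c i] inj[of a c e] inj[of a c f] A A2 A3 Ni(8) ni by auto
    ultimately have A4: "a \<triangleright> c = e" unfolding Na by blast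
    note A = A A2 A3 A4
    note B = A[THEN shift[where i = i], unfolded Ni(2-7) idem]
    note C = B[THEN shift[where i = i], unfolded Ni(2-7) idem]
    note D = C[THEN shift[where i = i], unfolded Ni(2-7) idem]
    note E = D[THEN shift[where i = i], unfolded Ni(2-7) idem]
    note F = E[THEN shift[where i = i], unfolded Ni(2-7) idem]
    note Xe = complete[OF Na]
    have "distinct [i, a, b, c, d, e, f]" using ni Ni(8) by auto
    then have "op_table X (\<triangleright>) Aff73_table"
      by (rule op_tableI) (simp_all add: Xe Aff73_table_def A B C D E F Ni(2-7))
  }
  ultimately show ?thesis using pcd by blast
qed

lemma other_pair:
  assumes inv: "\<forall>x y. x \<triangleright> x \<triangleright> y = y" and card: "card (N x) = 6"
    and a: "a \<in> N x" and b: "b \<in> N x" "b \<noteq> a" "b \<noteq> x \<triangleright> a"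
  shows "\<exists>e. N x = {a, x \<triangleright> a, b, x \<triangleright> b, e, x \<triangleright> e} \<and> distinct [a, x \<triangleright> a, b, x \<triangleright> b, e, x \<triangleright> e]"
proof -
  have inv': "x \<triangleright> x \<triangleright> y = y" for x y using inv by blast
  have d: "distinct [a, x \<triangleright> a, b, x \<triangleright> b]"
    using a b inv'[of x a] inv'[of x b] by (auto simp: N_def)
  have s: "{a, x \<triangleright> a, b, x \<triangleright> b} \<subseteq> N x" using a b by simp
  define B where "B = N x - {a, x \<triangleright> a, b, x \<triangleright> b}"
  have "card {a, x \<triangleright> a, b, x \<triangleright> b} = 4" using d by auto
  then have cB: "card B = 2"
    using s card by (simp add: B_def card_Diff_subset)
  have im: "(\<triangleright>) x ` B \<subseteq> B"
  proof
    fix y assume "y \<in> (\<triangleright>) x ` B"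
    then obtain w where w: "y = x \<triangleright> w" "w \<in> N x" "w \<notin> {a, x \<triangleright> a, b, x \<triangleright> b}" by (auto simp: B_def)
    have "x \<triangleright> w \<noteq> a" "x \<triangleright> w \<noteq> b"
      using w(3) inv'[of x w] by auto
    then show "y \<in> B" using w by (simp add: B_def)
  qed
  obtain e where "e \<in> B" using cB by (metis card.empty equals0I zero_neq_numeral)
  then obtain f where e: "B = {e, f}" "x \<triangleright> e = f" "e \<noteq> f"
    using orbit2[of B x e] im cB by (metis B_def Diff_subset)
  have "N x = {a, x \<triangleright> a, b, x \<triangleright> b} \<union> B" using s by (auto simp: B_def)
  then have "N x = {a, x \<triangleright> a, b, x \<triangleright> b, e, x \<triangleright> e}" using e by auto
  moreover have "e \<notin> {a, x \<triangleright> a, b, x \<triangleright> b}" "f \<notin> {a, x \<triangleright> a, b, x \<triangleright> b}" using e(1) by (auto simp: B_def)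
  then have "distinct [a, x \<triangleright> a, b, x \<triangleright> b, e, x \<triangleright> e]" using d e by auto
  ultimately show ?thesis by blast
qed

text \<open>
  If \<open>a\<close> were adjacent to both points of the line, then its six neighbours would be \<open>x\<close>, \<open>x \<triangleright> a\<close>, the
  two points \<open>b\<close>, \<open>x \<triangleright> b\<close> and the third points of the lines from \<open>a\<close> to these. But \<open>a\<close> also meets the third
  line through \<open>x\<close>, in a point \<open>e\<close>, so \<open>e\<close> is one of these third points; say \<open>e = a \<triangleright> b\<close>.
  Then the third point \<open>v\<close> for \<open>x \<triangleright> b\<close> is fixed by \<open>x\<close>, and the two ways to compute \<open>(x \<triangleright> a) \<triangleright> b\<close> disagree.
\<close>

lemma meets_line_once:
  assumes inv: "\<forall>x y. x \<triangleright> x \<triangleright> y = y" and brs: "\<forall>x. \<forall>y \<in> N x. br x y"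
    and card: "\<forall>x \<in> X. card (N x) = 6"
    and a: "a \<in> N x" and b: "b \<in> N x" "b \<noteq> a" "b \<noteq> x \<triangleright> a"
  shows "b \<in> N a \<longleftrightarrow> x \<triangleright> b \<notin> N a"
proof -
  have inv': "x \<triangleright> x \<triangleright> y = y" for x y using inv by blast
  note ops = involutive_braided[OF inv brs]
  have xX: "x \<in> X" and aX: "a \<in> X" using N_mem[OF a] by auto
  have xa: "a \<triangleright> x = x \<triangleright> a" using ops(1)[OF a] .
  have xN: "x \<in> N a" using a N_sym by blast
  have main: False
    if b: "b \<in> N x" "b \<noteq> a" "b \<noteq> x \<triangleright> a" and ab: "b \<in> N a" "x \<triangleright> b \<in> N a"
      and e: "e \<in> N x" "e \<notin> {a, x \<triangleright> a, b, x \<triangleright> b}" and aeb: "a \<triangleright> b = e" for b e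
  proof -
    define v where "v = a \<triangleright> x \<triangleright> b"
    have vb: "(x \<triangleright> b) \<triangleright> v = a"
      using ops(4)[OF ab(2)] by (simp add: v_def)
    have "b \<triangleright> e = a" using ops(4)[OF ab(1)] aeb by simp
    then have "(x \<triangleright> b) \<triangleright> x \<triangleright> e = x \<triangleright> a" using dist[of x b e] by simp
    moreover have "a \<noteq> x \<triangleright> a" using a by (auto simp: N_def)
    ultimately have vxe: "v \<noteq> x \<triangleright> e" using vb by metis
    have va: "v \<in> N a" using ab(2) by (simp add: v_def)
    obtain g where g: "N x = {a, x \<triangleright> a, b, x \<triangleright> b, g, x \<triangleright> g}"
      using other_pair[OF inv card[rule_format, OF xX] a b] by blast
    have "e = g \<or> e = x \<triangleright> g" using g e by blast
    then have Nx: "N x = {a, x \<triangleright> a, b, x \<triangleright> b, e, x \<triangleright> e}" using g inv'[of x g] by auto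
    have vne: "v \<noteq> a" "v \<noteq> x \<triangleright> a" "v \<noteq> b" "v \<noteq> x \<triangleright> b" "v \<noteq> e" "v \<noteq> x"
    proof -
      show "v \<noteq> a" using va by auto
      have "x \<triangleright> b \<noteq> x" using b(1) inj[of x b x] by auto
      then show "v \<noteq> x \<triangleright> a" using inj[of a "x \<triangleright> b" x] xa by (auto simp: v_def)
      show "v \<noteq> b"
      proof
        assume "v = b"
        then have "a = x" using vb ops(5)[OF b(1)] by simp
        then show False using a by simp
      qed
      show "v \<noteq> x \<triangleright> b" using ab(2) by (simp add: v_def N_def)
      show "v \<noteq> e" using aeb b(1) inj[of a "x \<triangleright> b" b] by (auto simp: v_def N_def)
      show "v \<noteq> x"
      proof
        assume "v = x"
        then have "(x \<triangleright> b) \<triangleright> x = a" using vb by simp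
        then show False using ops(3)[OF b(1)] b(2) by simp
      qed
    qed
    then have "v \<notin> N x" using Nx vxe by blast
    then have "x \<triangleright> v = v" by (rule act_fixed)
    then have v': "(x \<triangleright> a) \<triangleright> b = v" using dist[of x a "x \<triangleright> b"] inv'[of x b] by (simp flip: v_def)
    have "e \<in> N a" using ab(1) N_stable[of a b] aeb by simp
    moreover have "x \<triangleright> a \<in> N a" using xN N_stable[of a x] xa by simp
    ultimately have "{x, x \<triangleright> a, b, x \<triangleright> b, e, v} \<subseteq> N a" using xN ab va by simp
    moreover have "distinct [x, x \<triangleright> a, b, x \<triangleright> b, e, v]"
    proof -
      have "x \<notin> N x" by simp
      then have "x \<notin> {x \<triangleright> a, b, x \<triangleright> b, e}" using Nx by blast
      moreover have "x \<triangleright> a \<noteq> x \<triangleright> b" "b \<noteq> x \<triangleright> b" using b by (auto simp: N_def)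
      ultimately show ?thesis using vne e b(3) by auto
    qed
    then have "card {x, x \<triangleright> a, b, x \<triangleright> b, e, v} = 6" using distinct_card by fastforce
    ultimately have Na: "N a = {x, x \<triangleright> a, b, x \<triangleright> b, e, v}"
      using card_subset_eq[OF finite_N] card[rule_format, OF aX] by metis
    have "x \<triangleright> e \<noteq> e" using e(1) by (simp add: N_def)
    moreover have "x \<triangleright> e \<noteq> x \<triangleright> a" "x \<triangleright> e \<noteq> x \<triangleright> b" using e(2) by auto
    moreover have "x \<triangleright> e \<noteq> b" using e(2) inv'[of x e] by auto
    moreover have "x \<triangleright> e \<noteq> x" using e(1) inj[of x e x] by auto
    ultimately have "x \<triangleright> e \<notin> N a" using Na vxe by blast
    then have "a \<triangleright> x \<triangleright> e = x \<triangleright> e" by (rule act_fixed)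
    moreover have "a \<triangleright> e = b" using inv'[of a b] aeb by simp
    then have "a \<triangleright> x \<triangleright> e = (x \<triangleright> a) \<triangleright> b" using dist[of a x e] xa by simp
    ultimately show False using v' vxe by simp
  qed
  have not_both: False if ab: "b \<in> N a" "x \<triangleright> b \<in> N a"
  proof -
    obtain g where g: "N x = {a, x \<triangleright> a, b, x \<triangleright> b, g, x \<triangleright> g}" "distinct [a, x \<triangleright> a, b, x \<triangleright> b, g, x \<triangleright> g]"
      using other_pair[OF inv card[rule_format, OF xX] a b] by blast
    define b' where "b' = x \<triangleright> b"
    have xb': "x \<triangleright> b' = b" using inv' by (simp add: b'_def)
    have b': "b' \<in> N x" "b' \<noteq> a" "b' \<noteq> x \<triangleright> a" using g(2) b(1) by (auto simp: b'_def)
    have ab': "b' \<in> N a" using ab by (simp add: b'_def)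
    obtain e where e: "e \<in> N x" "e \<in> N a" "e \<notin> {a, x \<triangleright> a, b, b'}"
    proof (cases "g \<in> N a")
      case True
      have "g \<in> N x" using g(1) by blast
      moreover have "g \<notin> {a, x \<triangleright> a, b, b'}" using g(2) by (auto simp: b'_def)
      ultimately show ?thesis using that True by blast
    next
      case False
      have "g \<in> N x" using g(1) by blast
      then have "x \<triangleright> g \<in> N a" "x \<triangleright> g \<in> N x" using meets_line[OF inv brs a _ False] by auto
      moreover have "x \<triangleright> g \<notin> {a, x \<triangleright> a, b, b'}" using g(2) by (auto simp: b'_def)
      ultimately show ?thesis using that by blast
    qed
    have ne1: "a \<triangleright> b \<noteq> e" using main[OF b ab e(1)] e(3) by (auto simp: b'_def)
    have "e \<notin> {a, x \<triangleright> a, b', x \<triangleright> b'}" using e(3) xb' by auto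
    moreover have "x \<triangleright> b' \<in> N a" using ab xb' by simp
    ultimately have ne2: "a \<triangleright> b' \<noteq> e" using main[OF b' ab' _ e(1)] by blast
    have ab2: "a \<triangleright> b \<noteq> b'"
    proof
      assume "a \<triangleright> b = b'"
      then have "b \<triangleright> b' = a" using ops(4)[OF ab(1)] by simp
      moreover have "b \<triangleright> b' = x" using ops(4)[OF b(1)] by (simp add: b'_def)
      ultimately show False using a by simp
    qed
    have 1: "x \<noteq> x \<triangleright> a" "b \<noteq> a \<triangleright> b" "b' \<noteq> a \<triangleright> b'" "x \<noteq> b" "x \<noteq> b'" "b \<noteq> b'" "x \<triangleright> a \<noteq> b" "x \<triangleright> a \<noteq> b'"
    proof -
      show "x \<noteq> x \<triangleright> a" using a inj[of x x a] by auto
      show "b \<noteq> a \<triangleright> b" "b' \<noteq> a \<triangleright> b'" using ab ab' N_def by auto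
      show "x \<noteq> b" "x \<noteq> b'" using b(1) b'(1) by auto
      show "b \<noteq> b'" "x \<triangleright> a \<noteq> b" "x \<triangleright> a \<noteq> b'" using g(2) b'(3) by (auto simp: b'_def)
    qed
    have 2: "b \<noteq> a \<triangleright> b'" using ab2 inv'[of a b'] by auto
    have 3: "x \<noteq> a \<triangleright> b" "x \<noteq> a \<triangleright> b'"
      using 1(7,8) inv'[of a b] inv'[of a b'] xa by auto
    have 4: "x \<triangleright> a \<noteq> a \<triangleright> b" "x \<triangleright> a \<noteq> a \<triangleright> b'"
      using 1(4,5) xa inj[of a x b] inj[of a x b'] by auto
    have "distinct [x, x \<triangleright> a, b, a \<triangleright> b, b', a \<triangleright> b']" using 1 2 3 4 ab2 by auto
    then have "card {x, x \<triangleright> a, b, a \<triangleright> b, b', a \<triangleright> b'} = 6" using distinct_card by fastforce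
    moreover have "x \<triangleright> a \<in> N a" using xN N_stable[of a x] xa by simp
    then have "{x, x \<triangleright> a, b, a \<triangleright> b, b', a \<triangleright> b'} \<subseteq> N a"
      using xN ab ab' by simp
    ultimately have "N a = {x, x \<triangleright> a, b, a \<triangleright> b, b', a \<triangleright> b'}"
      using card_subset_eq[OF finite_N] card[rule_format, OF aX] by metis
    moreover have "e \<noteq> x" using e(1) by auto
    ultimately show False using e(2,3) ne1 ne2 by auto
  qed
  then show ?thesis using meets_line[OF inv brs a b(1)] by blast
qed

text \<open>
  Choose \<open>b\<close> and \<open>e\<close> on the other two lines through \<open>i\<close> such that \<open>a\<close> is adjacent to both.
  With the help of \<open>meets_line_once\<close> the lines can be completed step by step to the ten lines on ten
  points of the geometry of transpositions in \<open>\<S>\<^sub>5\<close>, with \<open>i = (1 2)\<close>, \<open>a = (1 3)\<close>, \<open>b = (1 4)\<close>, \<open>e = (1 5)\<close>,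
  \<open>c = (3 4)\<close>, \<open>f = (3 5)\<close> and \<open>h = (4 5)\<close>.
\<close>

lemma transposition_class:
  assumes i: "i \<in> X" and br: "\<And>j. j \<in> N i \<Longrightarrow> br i j" and cN: "card (N i) = 6"
    and invi: "\<And>j. j \<in> N i \<Longrightarrow> i \<triangleright> i \<triangleright> j = j"
  shows "op_table X (\<triangleright>) C_table"
proof -
  have brs: "\<forall>x. \<forall>y \<in> N x. br x y" using braided_nbrs[OF i br] by blast
  have inv: "\<forall>x y. x \<triangleright> x \<triangleright> y = y" using involutive[OF i invi] by blast
  have inv': "x \<triangleright> x \<triangleright> y = y" for x y using inv by blast
  note line = line_ops[OF inv brs]
  have cardN: "\<forall>x \<in> X. card (N x) = 6" using cN card_N[OF i] by simp
  note one = meets_line_once[OF inv brs cardN]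
  obtain a where a: "a \<in> N i" using N_nonempty[OF i] by blast
  define a' where "a' = i \<triangleright> a"
  have "\<not> N i \<subseteq> {a, a'}"
  proof
    assume "N i \<subseteq> {a, a'}"
    then have "card (N i) \<le> card {a, a'}" by (intro card_mono) auto
    also have "\<dots> \<le> 2" by (simp add: card_insert_if)
    finally show False using cN by simp
  qed
  then obtain b0 where b0: "b0 \<in> N i" "b0 \<noteq> a" "b0 \<noteq> a'" by blast
  define b where "b = (if b0 \<in> N a then b0 else i \<triangleright> b0)"
  have b: "b \<in> N i" "b \<in> N a" "b \<noteq> a'" "b \<noteq> a"
  proof -
    show bN: "b \<in> N i" using b0 by (simp add: b_def)
    show ba: "b \<in> N a" using one[OF a b0(1)] b0 by (auto simp: b_def a'_def)
    have "i \<triangleright> b0 \<noteq> a" "i \<triangleright> b0 \<noteq> a'" using b0 inv'[of i b0] by (auto simp: a'_def)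
    then show "b \<noteq> a'" "b \<noteq> a" using b0 by (auto simp: b_def)
  qed
  define b' where "b' = i \<triangleright> b"
  obtain e0 where e0: "N i = {a, a', b, b', e0, i \<triangleright> e0}" "distinct [a, a', b, b', e0, i \<triangleright> e0]"
    using other_pair[OF inv cN a b(1)] b by (auto simp: a'_def b'_def)
  define e where "e = (if e0 \<in> N a then e0 else i \<triangleright> e0)"
  define e' where "e' = i \<triangleright> e"
  have Ni: "N i = {a, a', b, b', e, e'}" "distinct [a, a', b, b', e, e']"
    using e0 inv'[of i e0] by (auto simp: e_def e'_def)
  have eN: "e \<in> N i" "e' \<in> N i" "a' \<in> N i" "b' \<in> N i" using Ni(1) by auto
  have e0N: "e0 \<in> N i" "e0 \<noteq> a" "e0 \<noteq> i \<triangleright> a" using e0 by (auto simp flip: a'_def)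
  have ea: "e \<in> N a" using one[OF a e0N] by (auto simp: e_def)
  have ni: "i \<notin> {a, a', b, b', e, e'}" using Ni(1) irrefl by blast
  have neq: "a' \<noteq> a" "b' \<noteq> b" "e' \<noteq> e" using Ni(2) by auto
  note l1 = line[OF a'_def[symmetric] neq(1)]
  note l2 = line[OF b'_def[symmetric] neq(2)]
  note l3 = line[OF e'_def[symmetric] neq(3)]
  define c where "c = a \<triangleright> b"
  define f where "f = a \<triangleright> e"
  define h where "h = b \<triangleright> e"
  have eb: "e \<noteq> b" "e \<noteq> a" "e \<noteq> a'" "e \<noteq> b'" using Ni(2) by auto
  have cne: "c \<noteq> b" using b(2) by (simp add: c_def N_def)
  note l4 = line[OF c_def[symmetric] cne]
  have fne: "f \<noteq> e" using ea by (simp add: f_def N_def)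
  note l5 = line[OF f_def[symmetric] fne]
  have cNi: "c \<notin> N i" using one[OF l1(8) b(2)] b(1,3) ni l1(2) by (auto simp: c_def)
  have fNi: "f \<notin> N i" using one[OF l1(8) ea] eN(1) eb ni l1(2) by (auto simp: f_def)
  have ic: "i \<triangleright> c = c" "i \<triangleright> f = f" using act_fixed cNi fNi by auto
  have cfi: "c \<noteq> i" "f \<noteq> i" "c \<noteq> f"
  proof -
    show "c \<noteq> i" using l4(3) l1(2) b(3) by auto
    show "f \<noteq> i" using l5(3) l1(2) eb by auto
    show "c \<noteq> f" using eb by (simp add: c_def f_def)
  qed
  have l7': "a' \<triangleright> b' = c" "a' \<triangleright> e' = f"
    using dist[of i a b] dist[of i a e] by (simp_all add: ic flip: a'_def b'_def e'_def c_def f_def)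
  have cfN: "c \<noteq> b'" "f \<noteq> e'" "f \<noteq> b'" "f \<noteq> a" "f \<noteq> e" using cNi fNi eN a by auto
  note l7 = line[OF l7'(1) cfN(1)]
  note l8 = line[OF l7'(2) cfN(2)]
  have be: "e \<in> N b"
  proof (rule ccontr)
    \<comment> \<open>Otherwise \<open>b\<close> is adjacent to \<open>e'\<close> and \<open>f\<close>. Both lie on its third line, whereas the line through \<open>e'\<close> and \<open>f\<close> contains \<open>a'\<close>.\<close>
    assume no: "e \<notin> N b"
    have "e' \<in> N b" using one[OF b(1) eN(1)] no eb by (auto simp flip: b'_def e'_def)
    have "e \<noteq> a \<triangleright> b" using cNi eN(1) by (auto simp: c_def)
    then have fb: "f \<in> N b" using one[OF b(2) ea eb(1)] no by (simp add: f_def)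
    have "a \<noteq> b \<triangleright> i" using l2(2) Ni(2) by auto
    moreover have "a \<noteq> i" using ni by auto
    ultimately obtain g where g: "N b = {i, b', a, c, g, b \<triangleright> g}"
      using other_pair[OF inv _ l2(8) l4(8)] cardN N_mem(1)[OF b(1)] l2(2) l4(2) by metis
    have "e' \<notin> {i, b', a, c}" using Ni(2) ni cNi eN by auto
    moreover have "f \<notin> {i, b', a, c}" using cfi cfN by auto
    moreover have "f \<noteq> e'" using cfN by simp
    ultimately have "f = b \<triangleright> e'" using g fb \<open>e' \<in> N b\<close> inv'[of b g] by auto
    then have "e' \<triangleright> f = b" using line(5)[of b e' f] cfN by simp
    then show False using l8(5) b(3) by simp
  qed
  have hne: "h \<noteq> e" using be by (simp add: h_def N_def)
  note l6 = line[OF h_def[symmetric] hne]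
  have hNi: "h \<notin> N i" using one[OF l2(8) be] eN(1) eb ni l2(2) by (auto simp: h_def)
  have ih: "i \<triangleright> h = h" using act_fixed[OF hNi] .
  have hi: "h \<noteq> i" "h \<noteq> c" "h \<noteq> f"
  proof -
    show "h \<noteq> i" using l6(3) l2(2) eb by auto
    show "h \<noteq> c" using l4(2) eb(2) h_def by auto
    show "h \<noteq> f" using l5(2) l6(2) b(4) inj[of e a b] by auto
  qed
  have hN: "h \<noteq> e'" using hNi eN by auto
  have "b' \<triangleright> e' = h" using dist[of i b e] by (simp add: ih flip: b'_def e'_def h_def)
  note l9 = line[OF this hN]
  have d: "distinct [i, a, a', b, b', e, e', c, f, h]"
    using Ni ni cNi fNi hNi cfi hi by auto
  have six: "N x = {p, q, r, s, t, u}" if "{p, q, r, s, t, u} \<subseteq> N x" "distinct [p, q, r, s, t, u]" for x p q r s t u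
  proof -
    have "x \<in> X" using that(1) N_mem by blast
    moreover have "card {p, q, r, s, t, u} = 6" using distinct_card[OF that(2)] by simp
    ultimately show ?thesis using card_subset_eq[OF finite_N that(1)] cardN by simp
  qed
  have Na: "N a = {i, a', b, c, e, f}"
    by (rule six) (use l1(8,11) l4(7,9) l5(7,9) d in auto)
  have Nb: "N b = {i, b', a, c, e, h}"
    by (rule six) (use l2(8,11) l4(8,11) l6(7,9) d in auto)
  have Ne: "N e = {i, e', a, f, b, h}"
    by (rule six) (use l3(8,11) l5(8,11) l6(8,11) d in auto)
  have Na': "N a' = {i, a, b', c, e', f}" using N_image[of i a] by (simp add: Na ic l1 l2 l3)
  have Nb': "N b' = {i, b, a', c, e', h}" using N_image[of i b] by (simp add: Nb ic ih l1 l2 l3)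
  have Ne': "N e' = {i, e, a', f, b', h}" using N_image[of i e] by (simp add: Ne ic ih l1 l2 l3)
  have "b \<notin> N f" using N_sym[of b f] Nb d by auto
  moreover have "b \<noteq> f" "b \<noteq> a \<triangleright> f" using d l5(3) by auto
  ultimately have cf: "c \<in> N f" using one[OF l5(9) b(2)] by (simp add: c_def)
  have "a \<notin> N h" using N_sym[of a h] Na d by auto
  moreover have "a \<noteq> h" "a \<noteq> b \<triangleright> h" using d l6(3) by auto
  ultimately have ch: "c \<in> N h" using one[OF l6(9) l4(8)] l4(2) by simp
  have fc: "f \<in> N c" "h \<in> N c" using cf ch N_sym by auto
  have Nc: "N c = {a, b, a', b', f, h}"
    by (rule six) (use l4(10,12) l7(10,12) fc d in auto)
  have "c \<triangleright> f \<in> N c" using fc(1) by simp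
  moreover have "c \<triangleright> f \<noteq> f" using fc(1) by (simp add: N_def)
  moreover have "c \<triangleright> f \<noteq> a" "c \<triangleright> f \<noteq> b" "c \<triangleright> f \<noteq> a'" "c \<triangleright> f \<noteq> b'"
    using inj[of c f b] inj[of c f a] inj[of c f b'] inj[of c f a'] l4(4,6) l7(4,6) d by auto
  ultimately have "c \<triangleright> f = h" using Nc by blast
  note l10 = line[OF this hi(3)]
  have Nf: "N f = {a, e, a', e', c, h}"
    by (rule six) (use l5(10,12) l8(10,12) l10(8,11) d in auto)
  have Nh: "N h = {b, e, b', e', c, f}"
    by (rule six) (use l6(10,12) l9(10,12) l10(10,12) d in auto)
  have Xe: "{i, a, a', b, b', e, e', c, f, h} = X"
  proof (rule connected)
    fix y assume "y \<in> {i, a, a', b, b', e, e', c, f, h}"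
    then show "N y \<subseteq> {i, a, a', b, b', e, e', c, f, h}"
      by (elim insertE) (simp_all add: Ni(1) Na Na' Nb Nb' Ne Ne' Nc Nf Nh)
  next
    have "{c, f, h} \<subseteq> X" using l4(9) l5(9) l6(9) N_sub by blast
    then show "{i, a, a', b, b', e, e', c, f, h} \<subseteq> X" using i Ni(1) N_sub[of i] by auto
  qed simp
  have fi: "i \<triangleright> c = c" "i \<triangleright> f = f" "i \<triangleright> h = h"
    using d by (auto intro!: act_fixed simp: Ni(1))
  have fa: "a \<triangleright> b' = b'" "a \<triangleright> e' = e'" "a \<triangleright> h = h"
    using d by (auto intro!: act_fixed simp: Na)
  have fa': "a' \<triangleright> b = b" "a' \<triangleright> e = e" "a' \<triangleright> h = h"
    using d by (auto intro!: act_fixed simp: Na')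
  have fb: "b \<triangleright> a' = a'" "b \<triangleright> e' = e'" "b \<triangleright> f = f"
    using d by (auto intro!: act_fixed simp: Nb)
  have fb': "b' \<triangleright> a = a" "b' \<triangleright> e = e" "b' \<triangleright> f = f"
    using d by (auto intro!: act_fixed simp: Nb')
  have fe: "e \<triangleright> a' = a'" "e \<triangleright> b' = b'" "e \<triangleright> c = c"
    using d by (auto intro!: act_fixed simp: Ne)
  have fe': "e' \<triangleright> a = a" "e' \<triangleright> b = b" "e' \<triangleright> c = c"
    using d by (auto intro!: act_fixed simp: Ne')
  have fc: "c \<triangleright> i = i" "c \<triangleright> e = e" "c \<triangleright> e' = e'"
    using d by (auto intro!: act_fixed simp: Nc)
  have ff: "f \<triangleright> i = i" "f \<triangleright> b = b" "f \<triangleright> b' = b'"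
    using d by (auto intro!: act_fixed simp: Nf)
  have fh: "h \<triangleright> i = i" "h \<triangleright> a = a" "h \<triangleright> a' = a'"
    using d by (auto intro!: act_fixed simp: Nh)
  show ?thesis
    by (rule op_tableI[OF d]) (simp_all add: Xe C_table_def l1 l2 l3 l4 l5 l6 l7 l8 l9 l10 fi fa fa' fb fb' fe fe' fc ff fh)
qed

section \<open>Classification by the neighbourhood of a vertex\<close>

lemma not_one_transposition:
  assumes i: "i \<in> X" and br: "\<And>j. j \<in> N i \<Longrightarrow> br i j" and cN: "card (N i) \<le> 6"
    and R: "N i = {a, b} \<union> R" "i \<triangleright> a = b" "i \<triangleright> b = a" "a \<noteq> b" "r \<in> R" "\<And>y. y \<in> R \<Longrightarrow> i \<triangleright> i \<triangleright> y \<noteq> y"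
  shows False
proof -
  have "{y \<in> N i. i \<triangleright> i \<triangleright> y = y} = {a, b}" using R(1-3,6) by auto
  then have "card {y \<in> N i. i \<triangleright> i \<triangleright> y = y} = 2" using R(4) by simp
  then show False using not_mixed_transposition[OF i br cN] R(1,5,6) by blast
qed

lemma degree_five_braided:
  assumes i: "i \<in> X" and br: "\<And>j. j \<in> N i \<Longrightarrow> br i j" and cN: "card (N i) = 5"
  shows False
proof -
  obtain a where a: "a \<in> N i" using N_nonempty[OF i] by blast
  obtain xs where xs: "hd xs = a" "distinct xs" "set xs \<subseteq> N i"
      "map ((\<triangleright>) i) xs = rotate1 xs" "(\<triangleright>) i ` (N i - set xs) \<subseteq> N i - set xs"
    and len: "length xs \<ge> 2" "card (N i - set xs) \<noteq> 1"
      "card (N i - set xs) = card (N i) - length xs" "length xs \<le> card (N i)"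
    using cycle_N[OF order_refl im_N a] by blast
  have le: "card (N i) \<le> 6" using cN by simp
  have dec: "N i = set xs \<union> (N i - set xs)" using xs(3) by blast
  have "length xs = 2 \<or> length xs = 3 \<or> length xs = 5" using len cN by linarith
  then consider "length xs = 2" | "length xs = 3" | "length xs = 5" by blast
  then show False
  proof cases
    case 1
    then obtain a b where ab: "xs = [a, b]" using length_two by blast
    have c3: "card (N i - set xs) = 3" using len 1 cN by simp
    then obtain c where c: "c \<in> N i - set xs" by (metis card.empty equals0I zero_neq_numeral)
    obtain d e where R: "N i - set xs = {c, d, e}" "i \<triangleright> c = d" "i \<triangleright> d = e" "i \<triangleright> e = c" "distinct [c, d, e]"
      using orbit3[OF Diff_subset xs(5) c3 c] by metis
    have "N i = {a, b} \<union> {c, d, e}" using dec unfolding R(1) by (simp add: ab)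
    moreover have "i \<triangleright> a = b" "i \<triangleright> b = a" "a \<noteq> b" using xs(2,4) by (auto simp: ab)
    moreover have "i \<triangleright> i \<triangleright> y \<noteq> y" if "y \<in> {c, d, e}" for y using that R(2-) by auto
    ultimately show False using not_one_transposition[OF i br le, of a b "{c, d, e}" c] by blast
  next
    case 2
    then obtain a b c where ab: "xs = [a, b, c]" using length_three by blast
    have c2: "card (N i - set xs) = 2" using len 2 cN by simp
    then obtain d where d: "d \<in> N i - set xs" by (metis card.empty equals0I zero_neq_numeral)
    obtain e where R: "N i - set xs = {d, e}" "i \<triangleright> d = e" "i \<triangleright> e = d" "d \<noteq> e"
      using orbit2[OF Diff_subset xs(5) c2 d] by metis
    have "N i = {d, e} \<union> {a, b, c}" using dec unfolding R(1) by (simp add: ab Un_commute)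
    moreover have "i \<triangleright> i \<triangleright> y \<noteq> y" if "y \<in> {a, b, c}" for y using that xs(2,4) by (auto simp: ab)
    ultimately show False using not_one_transposition[OF i br le _ R(2-4), of "{a, b, c}" a] by blast
  next
    case 3
    then obtain a b c d e where ab: "xs = [a, b, c, d, e]" using length_five by blast
    have "N i - set xs = {}" using len 3 cN by simp
    then have Ni: "N i = {a, b, c, d, e}" using xs(3) by (auto simp: ab)
    have ops: "i \<triangleright> a = b" "i \<triangleright> b = c" "i \<triangleright> c = d" "i \<triangleright> d = e" "i \<triangleright> e = a"
      "distinct [a, b, c, d, e]" using xs(2,4) by (auto simp: ab)
    show False using not_five_cycle[OF i br Ni ops] by blast
  qed
qed

lemma degree_six_braided:
  assumes i: "i \<in> X" and br: "\<And>j. j \<in> N i \<Longrightarrow> br i j" and cN: "card (N i) = 6"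
  shows "op_table X (\<triangleright>) Aff73_table \<or> op_table X (\<triangleright>) Aff75_table \<or> op_table X (\<triangleright>) C_table"
proof -
  obtain a where a: "a \<in> N i" using N_nonempty[OF i] by blast
  obtain xs where xs: "hd xs = a" "distinct xs" "set xs \<subseteq> N i"
      "map ((\<triangleright>) i) xs = rotate1 xs" "(\<triangleright>) i ` (N i - set xs) \<subseteq> N i - set xs"
    and len: "length xs \<ge> 2" "card (N i - set xs) \<noteq> 1"
      "card (N i - set xs) = card (N i) - length xs" "length xs \<le> card (N i)"
    using cycle_N[OF order_refl im_N a] by blast
  have le: "card (N i) \<le> 6" using cN by simp
  have dec: "N i = set xs \<union> (N i - set xs)" using xs(3) by blast
  have "length xs = 2 \<or> length xs = 3 \<or> length xs = 4 \<or> length xs = 6" using len cN by linarith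
  then consider "length xs = 2" | "length xs = 3" | "length xs = 4" | "length xs = 6" by blast
  then show ?thesis
  proof cases
    case 1
    then obtain a b where ab: "xs = [a, b]" using length_two by blast
    have iab: "i \<triangleright> a = b" "i \<triangleright> b = a" "a \<noteq> b" using xs(2,4) by (auto simp: ab)
    have c4: "card (N i - set xs) = 4" using len 1 cN by simp
    then obtain c where c: "c \<in> N i - set xs" by (metis card.empty equals0I zero_neq_numeral)
    show ?thesis
    proof (rule orbit4[OF Diff_subset xs(5) c4 c])
      fix d e f
      assume R: "N i - set xs = {c, d, e, f}" "i \<triangleright> c = d" "i \<triangleright> d = e" "i \<triangleright> e = f" "i \<triangleright> f = c" "distinct [c, d, e, f]"
      have "N i = {a, b} \<union> {c, d, e, f}" using dec unfolding R(1) by (simp add: ab)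
      moreover have "i \<triangleright> i \<triangleright> y \<noteq> y" if "y \<in> {c, d, e, f}" for y using that R(2-) by auto
      ultimately show ?thesis
        using not_one_transposition[OF i br le _ iab, of "{c, d, e, f}" c] by blast
    next
      fix d e f
      assume R: "N i - set xs = {c, d, e, f}" "i \<triangleright> c = d" "i \<triangleright> d = c" "i \<triangleright> e = f" "i \<triangleright> f = e" "distinct [c, d, e, f]"
      have "N i = {a, b} \<union> {c, d, e, f}" using dec unfolding R(1) by (simp add: ab)
      then have "i \<triangleright> i \<triangleright> j = j" if "j \<in> N i" for j using that R(2-) iab by auto
      then show ?thesis using transposition_class[OF i br cN] by blast
    qed
  next
    case 2
    then obtain a b c where ab: "xs = [a, b, c]" using length_three by blast
    have c3: "card (N i - set xs) = 3" using len 2 cN by simp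
    then obtain d where d: "d \<in> N i - set xs" by (metis card.empty equals0I zero_neq_numeral)
    obtain e f where R: "N i - set xs = {d, e, f}" "i \<triangleright> d = e" "i \<triangleright> e = f" "i \<triangleright> f = d" "distinct [d, e, f]"
      using orbit3[OF Diff_subset xs(5) c3 d] by metis
    have "N i = {a, b, c} \<union> {d, e, f}" using dec unfolding R(1) by (simp add: ab)
    then have "i \<triangleright> i \<triangleright> i \<triangleright> j = j" if "j \<in> N i" for j using that R(2-) xs(4) by (auto simp: ab)
    then show ?thesis using not_two_three_cycles[OF i br cN] by blast
  next
    case 3
    then obtain a b c d where ab: "xs = [a, b, c, d]" using length_four by blast
    have c2: "card (N i - set xs) = 2" using len 3 cN by simp
    then obtain e where e: "e \<in> N i - set xs" by (metis card.empty equals0I zero_neq_numeral)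
    obtain f where R: "N i - set xs = {e, f}" "i \<triangleright> e = f" "i \<triangleright> f = e" "e \<noteq> f"
      using orbit2[OF Diff_subset xs(5) c2 e] by metis
    have "N i = {e, f} \<union> {a, b, c, d}" using dec unfolding R(1) by (simp add: ab Un_commute)
    moreover have "i \<triangleright> i \<triangleright> y \<noteq> y" if "y \<in> {a, b, c, d}" for y using that xs(2,4) by (auto simp: ab)
    ultimately show ?thesis
      using not_one_transposition[OF i br le _ R(2-4), of "{a, b, c, d}" a] by blast
  next
    case 4
    then obtain a b c d e f where ab: "xs = [a, b, c, d, e, f]" using length_six by blast
    have "N i - set xs = {}" using len 4 cN by simp
    then have Ni: "N i = {a, b, c, d, e, f}" using xs(3) by (auto simp: ab)
    have ops: "i \<triangleright> a = b" "i \<triangleright> b = c" "i \<triangleright> c = d" "i \<triangleright> d = e" "i \<triangleright> e = f" "i \<triangleright> f = a"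
      "distinct [a, b, c, d, e, f]" using xs(2,4) by (auto simp: ab)
    show ?thesis using six_cycle[OF i br cN Ni ops] by blast
  qed
qed

lemma degree_four_braided:
  assumes i: "i \<in> X" and br: "\<And>j. j \<in> N i \<Longrightarrow> br i j" and cN: "card (N i) = 4"
  shows "op_table X (\<triangleright>) A_table \<or> op_table X (\<triangleright>) B_table"
proof -
  obtain a where a: "a \<in> N i" using N_nonempty[OF i] by blast
  show ?thesis
    by (rule orbit4[OF order_refl im_N cN a])
       (use double_transposition_braided[OF i cN br] four_cycle_braided[OF i cN br] in blast)+
qed

lemma degree_four_square_commuting:
  assumes i: "i \<in> X" and lab: "\<And>j. j \<in> N i \<Longrightarrow> i \<triangleright> j \<triangleright> i \<triangleright> j = j" and cN: "card (N i) = 4"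
  shows "op_table X (\<triangleright>) Aff52_table \<or> op_table X (\<triangleright>) Aff53_table"
proof -
  obtain a where a: "a \<in> N i" using N_nonempty[OF i] by blast
  show ?thesis
    by (rule orbit4[OF order_refl im_N cN a])
       (use double_transposition_square_commuting[OF i cN lab] four_cycle_square_commuting[OF i cN lab] in blast)+
qed

text \<open>
  The numerical hypothesis says that the weights \<open>1/6\<close> of the braided and \<open>1/4\<close> of the other
  neighbours add up to at most one. When four neighbours are not braided, this leaves no room for orbits
  of more than four elements, hence the second hypothesis.
\<close>

theorem classification:
  assumes i: "i \<in> X" and le: "2 * card (L i) + 3 * card (N i - L i) \<le> 12"
    and lab: "card (N i - L i) = 4 \<Longrightarrow> \<forall>j \<in> N i. i \<triangleright> j \<triangleright> i \<triangleright> j = j"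
  shows "\<exists>T \<in> {D3_table, T_table, Aff52_table, Aff53_table, A_table, B_table, Aff73_table, Aff75_table, C_table}.
    op_table X (\<triangleright>) T"
proof -
  have br: "br i j" if "card (N i - L i) = 0" "j \<in> N i" for j
    using that by (auto simp: L_def)
  have ne1: "card B \<noteq> 1" if B: "B \<subseteq> N i" "(\<triangleright>) i ` B \<subseteq> B" for B
  proof
    assume "card B = 1"
    then obtain b where "B = {b}" using card_1_singletonE by blast
    then show False using B by (auto simp: N_def)
  qed
  have cN: "card (N i) = card (L i) + card (N i - L i)"
    using L_sub card_mono[OF finite_N L_sub] by (simp add: card_Diff_subset)
  have arith: "p + q = 2 \<or> p + q = 3 \<or> q = 0 \<and> p + q = 4 \<or> q = 0 \<and> p + q = 5 \<or> q = 0 \<and> p + q = 6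
      \<or> p = 2 \<and> p + q = 4 \<or> p = 3 \<and> p + q = 5 \<or> q = 4 \<and> p + q = 4"
    if "2 * p + 3 * q \<le> 12" "p \<noteq> 1" "q \<noteq> 1" "p + q \<noteq> 0" for p q :: nat
  proof -
    have "q = 0 \<or> q = 2 \<or> q = 3 \<or> q = 4" using that by linarith
    then show ?thesis
    proof (elim disjE)
      assume "q = 0"
      moreover from this have "p = 2 \<or> p = 3 \<or> p = 4 \<or> p = 5 \<or> p = 6" using that by linarith
      ultimately show ?thesis by auto
    next
      assume "q = 2"
      moreover from this have "p = 0 \<or> p = 2 \<or> p = 3" using that by linarith
      ultimately show ?thesis by auto
    qed (use that in auto)
  qed
  have n0: "card (N i) \<noteq> 0" using N_nonempty[OF i] by simp
  have c1: "card (L i) \<noteq> 1" by (rule ne1[OF L_sub]) auto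
  have c2: "card (N i - L i) \<noteq> 1" by (rule ne1) auto
  from arith[OF le c1 c2, folded cN, OF n0] consider "card (N i) = 2" | "card (N i) = 3"
    | "card (N i - L i) = 0" "card (N i) = 4" | "card (N i - L i) = 0" "card (N i) = 5"
    | "card (N i - L i) = 0" "card (N i) = 6" | "card (L i) = 2" "card (N i) = 4"
    | "card (L i) = 3" "card (N i) = 5" | "card (N i - L i) = 4" "card (N i) = 4"
    by metis
  then show ?thesis
  proof cases
    case 1 then show ?thesis using degree_two[OF i] by blast
  next
    case 2 then show ?thesis using degree_three[OF i] by blast
  next
    case 3 then show ?thesis using degree_four_braided[OF i br] by blast
  next
    case 4 then show ?thesis using degree_five_braided[OF i br] by blast
  next
    case 5 then show ?thesis using degree_six_braided[OF i br] by blast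
  next
    case 6 then show ?thesis using not_two_and_two[OF i] by blast
  next
    case 7 then show ?thesis using not_three_and_two[OF i] by blast
  next
    case 8 then show ?thesis using degree_four_square_commuting[OF i _ 8(2)] lab by blast
  qed
qed

end

section \<open>Weights of Hurwitz orbits\<close>

definition orbit_weight :: "nat \<Rightarrow> real" where
  "orbit_weight n = (if n \<ge> 3 then (real n - 2) / (2 * real n) else 0)"

lemma orbit_weight_eq: "n \<ge> 3 \<Longrightarrow> orbit_weight n = 1 / 2 - 1 / real n"
  by (simp add: orbit_weight_def field_simps)

lemma orbit_weight_nonneg: "orbit_weight n \<ge> 0"
  by (simp add: orbit_weight_def)

lemma orbit_weight_mono: assumes "m \<le> n" shows "orbit_weight m \<le> orbit_weight n"
proof (cases "m \<ge> 3")
  case True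
  then have "1 / real n \<le> 1 / real m" using assms by (intro divide_left_mono) auto
  then show ?thesis using True assms by (simp add: orbit_weight_eq)
qed (simp add: orbit_weight_def)

lemma orbit_weight_values:
  "orbit_weight 2 = 0" "orbit_weight 3 = 1 / 6" "orbit_weight 4 = 1 / 4" "orbit_weight 5 = 3 / 10"
  "orbit_weight n \<le> 1 / 2"
  by (simp_all add: orbit_weight_def)

text \<open>
  Counting the elements \<open>j\<close> by orbit size turns the series into a finite sum over \<open>j\<close>.
\<close>

lemma hurwitz_sum:
  assumes fin: "finite (carrier R)"
  shows "(\<Sum>\<^sub>\<infinity>n\<in>{3..}. (real n - 2) / (2 * real n) * real (hurwitz_orbit_count R i n))
    = (\<Sum>j\<in>carrier R. orbit_weight (card (hurwitz_orbit R i j)))"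
proof -
  define s where "s = (\<lambda>j. card (hurwitz_orbit R i j))"
  obtain M where M: "s j \<le> M" if "j \<in> carrier R" for j
    using fin by (meson finite_imageI finite_nat_set_iff_bounded_le imageI)
  have cnt: "real (hurwitz_orbit_count R i n) = (\<Sum>j\<in>carrier R. of_bool (s j = n))" for n
    using fin by (simp add: hurwitz_orbit_count_def s_def sum.If_cases of_bool_def Int_def flip: Collect_conj_eq)
  have "(\<Sum>\<^sub>\<infinity>n\<in>{3..}. (real n - 2) / (2 * real n) * real (hurwitz_orbit_count R i n))
    = (\<Sum>\<^sub>\<infinity>n\<in>{3..M}. (real n - 2) / (2 * real n) * real (hurwitz_orbit_count R i n))"
  proof (rule infsum_cong_neutral)
    fix n assume "n \<in> {3..} - {3..M}"
    then have "n > M" by auto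
    then have "{j \<in> carrier R. card (hurwitz_orbit R i j) = n} = {}" using M by (fastforce simp: s_def)
    then show "(real n - 2) / (2 * real n) * real (hurwitz_orbit_count R i n) = 0"
      by (simp only: hurwitz_orbit_count_def card.empty of_nat_0 mult_zero_right)
  qed auto
  also have "\<dots> = (\<Sum>n\<in>{3..M}. \<Sum>j\<in>carrier R. (real n - 2) / (2 * real n) * of_bool (s j = n))"
    by (simp add: cnt sum_distrib_left)
  also have "\<dots> = (\<Sum>j\<in>carrier R. \<Sum>n\<in>{3..M}. (real n - 2) / (2 * real n) * of_bool (s j = n))"
    by (rule sum.swap)
  also have "\<dots> = (\<Sum>j\<in>carrier R. orbit_weight (s j))"
  proof (rule sum.cong[OF refl])
    fix j assume j: "j \<in> carrier R"
    have "(\<Sum>n\<in>{3..M}. (real n - 2) / (2 * real n) * of_bool (s j = n))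
      = (\<Sum>n\<in>{3..M}. if n = s j then (real n - 2) / (2 * real n) else 0)"
      by (intro sum.cong) auto
    also have "\<dots> = orbit_weight (s j)" using M[OF j] by (simp add: orbit_weight_def)
    finally show "(\<Sum>n\<in>{3..M}. (real n - 2) / (2 * real n) * of_bool (s j = n)) = orbit_weight (s j)" .
  qed
  finally show ?thesis by (simp add: s_def)
qed

lemma hurwitz_pow_in_orbit: "(hurwitz_map R ^^ n) (i, j) \<in> hurwitz_orbit R i j"
  unfolding hurwitz_orbit_def hurwitz_power_def
  by (rule CollectI, rule exI[of _ "int n"]) simp

lemma hurwitz_orbit_sub:
  assumes R: "is_rack R" and ij: "i \<in> carrier R" "j \<in> carrier R"
  shows "hurwitz_orbit R i j \<subseteq> carrier R \<times> carrier R"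
proof -
  let ?S = "carrier R \<times> carrier R"
  have c: "bij_betw (hurwitz_map R) ?S ?S" by (rule bij_betw_hurwitz_map[OF R])
  have d: "bij_betw (inv_into ?S (hurwitz_map R)) ?S ?S" by (rule bij_betw_inv_into[OF c])
  have pow: "(h ^^ n) (i, j) \<in> ?S" if "bij_betw h ?S ?S" for h n
  proof (induction n)
    case (Suc n)
    then show ?case using bij_betw_apply[OF that] by simp
  qed (use ij in simp)
  show ?thesis
  proof
    fix p assume "p \<in> hurwitz_orbit R i j"
    then obtain m where "p = hurwitz_power R m (i, j)" by (auto simp: hurwitz_orbit_def)
    then show "p \<in> ?S" using pow[OF c, of "nat m"] pow[OF d, of "nat (- m)"]
      by (simp add: hurwitz_power_def)
  qed
qed

text \<open>
  If \<open>c\<^sup>n\<close> fixes \<open>(i, j)\<close>, then the first \<open>n\<close> powers already form a set that is closed under \<open>c\<close> and its inverse.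
\<close>

lemma card_hurwitz_orbit_le:
  assumes R: "is_rack R" and ij: "i \<in> carrier R" "j \<in> carrier R"
    and n: "n > 0" "(hurwitz_map R ^^ n) (i, j) = (i, j)"
  shows "card (hurwitz_orbit R i j) \<le> n"
proof -
  let ?S = "carrier R \<times> carrier R"
  define c where "c = hurwitz_map R"
  define d where "d = inv_into ?S c"
  define V where "V = (\<lambda>t. (c ^^ t) (i, j)) ` {..<n}"
  have bc: "bij_betw c ?S ?S" unfolding c_def by (rule bij_betw_hurwitz_map[OF R])
  have cS: "(c ^^ t) (i, j) \<in> ?S" for t
  proof (induction t)
    case (Suc t)
    then show ?case using bij_betw_apply[OF bc] by simp
  qed (use ij in simp)
  have cO: "c p \<in> V" if pV: "p \<in> V" for p
  proof -
    obtain t where t: "t < n" "p = (c ^^ t) (i, j)" using pV by (auto simp: V_def)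
    show ?thesis
    proof (cases "Suc t = n")
      case True
      then have "c p = (c ^^ 0) (i, j)" using t n(2) by (metis c_def comp_apply funpow.simps funpow_0)
      then show ?thesis using n(1) unfolding V_def by blast
    next
      case False
      then have "c p = (c ^^ Suc t) (i, j)" "Suc t < n" using t by auto
      then show ?thesis unfolding V_def by blast
    qed
  qed
  have dO: "d p \<in> V" if pV: "p \<in> V" for p
  proof -
    obtain t where t: "t < n" "p = (c ^^ t) (i, j)" using pV by (auto simp: V_def)
    obtain s where s: "s < n" "p = c ((c ^^ s) (i, j))"
    proof (cases t)
      case 0
      then have "p = (c ^^ Suc (n - 1)) (i, j)" using t n by (simp add: c_def)
      then have "p = c ((c ^^ (n - 1)) (i, j))" by (simp only: funpow.simps comp_apply)
      moreover have "n - 1 < n" using n(1) by simp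
      ultimately show ?thesis using that by blast
    next
      case (Suc s)
      then show ?thesis using that[of s] t by simp
    qed
    then have "d p = (c ^^ s) (i, j)" using bij_betw_inv_into_left[OF bc cS[of s]] by (simp add: d_def)
    then show ?thesis using s(1) unfolding V_def by blast
  qed
  have p0: "(i, j) \<in> V" using n(1) by (auto simp: V_def intro!: image_eqI[of _ _ 0])
  have pow: "(h ^^ m) (i, j) \<in> V" if "\<And>p. p \<in> V \<Longrightarrow> h p \<in> V" for h m
    using that p0 by (induction m) auto
  have "hurwitz_orbit R i j \<subseteq> V"
  proof
    fix p assume "p \<in> hurwitz_orbit R i j"
    then obtain m where "p = hurwitz_power R m (i, j)" by (auto simp: hurwitz_orbit_def)
    then show "p \<in> V" using pow[of c "nat m"] pow[of d "nat (- m)"] cO dO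
      by (simp add: hurwitz_power_def flip: c_def d_def)
  qed
  then have "card (hurwitz_orbit R i j) \<le> card V" by (intro card_mono) (auto simp: V_def)
  also have "\<dots> \<le> n" unfolding V_def using card_image_le[of "{..<n}"] by (metis card_lessThan finite_lessThan)
  finally show ?thesis .
qed

text \<open>
  The second components of the successive pairs in the orbit are \<open>j\<close>, \<open>i\<close>, \<open>k = i \<triangleright> j\<close>, \<open>l = k \<triangleright> i\<close>, \<open>l \<triangleright> k\<close>.
  The first three of them are distinct as soon as \<open>i\<close> moves \<open>j\<close>, and the first four are distinct without the braid relation.
  If these already exhaust the orbit, then the sequence returns to \<open>j\<close>.
\<close>

lemma hurwitz_orbit_lower:
  fixes R :: "('a, 'b) rack_scheme" (structure)
  assumes R: "is_rack R" and fin: "finite (carrier R)" and ij: "i \<in> carrier R" "j \<in> carrier R"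
    and idem: "\<And>x. x \<in> carrier R \<Longrightarrow> x \<rhd> x = x" and ne: "i \<rhd> j \<noteq> j"
  shows "card (hurwitz_orbit R i j) \<ge> 3"
    and "(i \<rhd> j) \<rhd> i \<noteq> j \<Longrightarrow> (i \<rhd> j) \<rhd> i \<noteq> i \<Longrightarrow> card (hurwitz_orbit R i j) \<ge> 4"
    and "(i \<rhd> j) \<rhd> i \<noteq> j \<Longrightarrow> (i \<rhd> j) \<rhd> i \<noteq> i \<Longrightarrow> card (hurwitz_orbit R i j) = 4 \<Longrightarrow>
      ((i \<rhd> j) \<rhd> i) \<rhd> (i \<rhd> j) = j"
proof -
  let ?V = "hurwitz_orbit R i j"
  define c where "c = hurwitz_map R"
  have inj: "x \<rhd> y = x \<rhd> z \<longleftrightarrow> y = z" if "x \<in> carrier R" "y \<in> carrier R" "z \<in> carrier R" for x y z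
    using R that unfolding is_rack_def bij_betw_def inj_on_def by blast
  have closed: "x \<rhd> y \<in> carrier R" if "x \<in> carrier R" "y \<in> carrier R" for x y
    using R that bij_betw_apply unfolding is_rack_def by fast
  have fV: "finite ?V" using hurwitz_orbit_sub[OF R ij] fin finite_subset by blast
  define k where "k = i \<rhd> j"
  define l where "l = k \<rhd> i"
  have kl: "k \<in> carrier R" "l \<in> carrier R" using closed ij by (simp_all add: k_def l_def)
  have k: "k \<noteq> i" "k \<noteq> j" "i \<noteq> j"
    using ne inj[of i j i] idem[of i] ij by (auto simp: k_def)
  have pw: "(c ^^ 0) (i, j) = (i, j)" "(c ^^ 1) (i, j) = (k, i)" "(c ^^ 2) (i, j) = (l, k)"
    "(c ^^ 3) (i, j) = (l \<rhd> k, l)" "(c ^^ 4) (i, j) = ((l \<rhd> k) \<rhd> l, l \<rhd> k)"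
    by (simp_all add: eval_nat_numeral c_def hurwitz_map_def k_def l_def)
  have mem: "(c ^^ n) (i, j) \<in> ?V" for n unfolding c_def by (rule hurwitz_pow_in_orbit)
  have m3: "{(i, j), (k, i), (l, k)} \<subseteq> ?V"
    using mem[of 0] mem[of 1] mem[of 2] unfolding pw by simp
  have "card {(i, j), (k, i), (l, k)} = 3" using k by auto
  then show "card ?V \<ge> 3" using card_mono[OF fV m3] by simp
  assume nb: "(i \<rhd> j) \<rhd> i \<noteq> j" "(i \<rhd> j) \<rhd> i \<noteq> i"
  have m4: "{(i, j), (k, i), (l, k), (l \<rhd> k, l)} \<subseteq> ?V"
    using m3 mem[of 3] unfolding pw by simp
  have "l \<noteq> k" using inj[of k i k] idem[of k] kl ij k(1) by (auto simp: l_def)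
  then have c4: "card {(i, j), (k, i), (l, k), (l \<rhd> k, l)} = 4"
    using k nb by (auto simp flip: k_def l_def)
  then show "card ?V \<ge> 4" using card_mono[OF fV m4] by simp
  assume "card ?V = 4"
  then have "?V = {(i, j), (k, i), (l, k), (l \<rhd> k, l)}"
    using card_subset_eq[OF fV m4] c4 by simp
  then have "((l \<rhd> k) \<rhd> l, l \<rhd> k) \<in> {(i, j), (k, i), (l, k), (l \<rhd> k, l)}"
    using mem[of 4] unfolding pw by simp
  moreover have lk: "l \<rhd> k \<in> carrier R" using closed kl by simp
  have "l \<rhd> k \<noteq> l" using inj[of l k l] idem[of l] kl \<open>l \<noteq> k\<close> by auto
  moreover have "(l \<rhd> k) \<rhd> l \<noteq> l \<rhd> k"
    using inj[of "l \<rhd> k" l "l \<rhd> k"] idem[OF lk] kl lk calculation(2) by auto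
  moreover have "False" if "((l \<rhd> k) \<rhd> l, l \<rhd> k) = (k, i)"
  proof -
    have lk: "l \<rhd> k = i" "i \<rhd> l = k" using that by auto
    then have "l = j" using inj[of i l j] kl ij by (simp add: k_def)
    then show False using nb by (simp add: l_def k_def)
  qed
  moreover have "False" if "((l \<rhd> k) \<rhd> l, l \<rhd> k) = (l, k)"
  proof -
    have "l \<rhd> k = k" "k \<rhd> l = l" using that by auto
    then have "l = i" using inj[of k l i] kl ij by (simp add: l_def)
    then show False using nb by (simp add: l_def k_def)
  qed
  ultimately show "((i \<rhd> j) \<rhd> i) \<rhd> (i \<rhd> j) = j"
    by (auto simp: k_def l_def)
qed

definition crossing :: "nat list list \<Rightarrow> nat \<times> nat \<Rightarrow> nat \<times> nat" where
  "crossing T = (\<lambda>(a, b). (T ! a ! b, a))"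

text \<open>
  Twelve times an upper bound for the weight of \<open>(a, b)\<close>: the weights \<open>0\<close>, \<open>1/6\<close>, \<open>1/4\<close> belong to the orbit sizes
  \<open>2\<close>, \<open>3\<close>, \<open>4\<close>, and every weight is below \<open>1/2\<close>.
\<close>

definition twelfths :: "nat list list \<Rightarrow> nat \<Rightarrow> nat \<Rightarrow> nat" where
  "twelfths T a b =
    (let p = crossing T (crossing T (a, b)); q = crossing T p; r = crossing T q in
      if p = (a, b) then 0 else if q = (a, b) then 2 else if r = (a, b) then 3 else 6)"

definition light_table :: "nat list list \<Rightarrow> bool" where
  "light_table T \<longleftrightarrow> (\<forall>row \<in> set T. length row = length T \<and> (\<forall>k \<in> set row. k < length T)) \<and>
     (\<forall>a \<in> set [0..<length T]. sum_list (map (twelfths T a) [0..<length T]) \<le> 12)"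

lemma weight_le_twelfths:
  assumes R: "is_rack R" and T: "light_table T"
    and xs: "distinct xs" "set xs = carrier R" "length xs = length T"
      "\<And>a b. a < length T \<Longrightarrow> b < length T \<Longrightarrow> rack_op R (xs ! a) (xs ! b) = xs ! (T ! a ! b)"
    and ab: "a < length T" "b < length T"
  shows "orbit_weight (card (hurwitz_orbit R (xs ! a) (xs ! b))) \<le> twelfths T a b / 12"
proof -
  define \<phi> where "\<phi> = map_prod ((!) xs) ((!) xs)"
  define S where "S = {..<length T} \<times> {..<length T}"
  have idx: "T ! a ! b < length T" if "a < length T" "b < length T" for a b
    using T that unfolding light_table_def by (metis nth_mem)
  have step: "crossing T p \<in> S" "hurwitz_map R (\<phi> p) = \<phi> (crossing T p)" if "p \<in> S" for p
    using that xs(4) idx by (auto simp: S_def \<phi>_def crossing_def hurwitz_map_def)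
  have pow: "(crossing T ^^ n) p \<in> S \<and> (hurwitz_map R ^^ n) (\<phi> p) = \<phi> ((crossing T ^^ n) p)" if "p \<in> S" for n p
    by (induction n) (use that step in auto)
  have le: "card (hurwitz_orbit R (xs ! a) (xs ! b)) \<le> n" if "n > 0" "(crossing T ^^ n) (a, b) = (a, b)" for n
  proof (rule card_hurwitz_orbit_le[OF R _ _ that(1)])
    show "xs ! a \<in> carrier R" "xs ! b \<in> carrier R" using ab xs(2,3) by (metis nth_mem)+
    show "(hurwitz_map R ^^ n) (xs ! a, xs ! b) = (xs ! a, xs ! b)"
      using pow[of "(a, b)" n] that(2) ab by (simp add: S_def \<phi>_def)
  qed
  let ?w = "orbit_weight (card (hurwitz_orbit R (xs ! a) (xs ! b)))"
  have "?w \<le> orbit_weight 2" if "crossing T (crossing T (a, b)) = (a, b)"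
    using le[of 2] that by (intro orbit_weight_mono) (simp add: eval_nat_numeral)
  moreover have "?w \<le> orbit_weight 3" if "crossing T (crossing T (crossing T (a, b))) = (a, b)"
    using le[of 3] that by (intro orbit_weight_mono) (simp add: eval_nat_numeral)
  moreover have "?w \<le> orbit_weight 4" if "crossing T (crossing T (crossing T (crossing T (a, b)))) = (a, b)"
    using le[of 4] that by (intro orbit_weight_mono) (simp add: eval_nat_numeral)
  ultimately show ?thesis
    using orbit_weight_values(5)[of "card (hurwitz_orbit R (xs ! a) (xs ! b))"]
    by (auto simp: twelfths_def Let_def orbit_weight_values)
qed

lemma light_table_sum:
  assumes R: "is_rack R" and T: "light_table T" and t: "op_table (carrier R) (rack_op R) T"
    and i: "i \<in> carrier R"
  shows "(\<Sum>\<^sub>\<infinity>n\<in>{3..}. (real n - 2) / (2 * real n) * real (hurwitz_orbit_count R i n)) \<le> 1"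
proof -
  obtain xs where xs: "distinct xs" "set xs = carrier R" "length xs = length T"
    "\<And>a b. a < length T \<Longrightarrow> b < length T \<Longrightarrow> rack_op R (xs ! a) (xs ! b) = xs ! (T ! a ! b)"
    using op_tableE[OF t] by metis
  obtain a where a: "i = xs ! a" "a < length T" using i xs(2,3) by (metis in_set_conv_nth)
  have fin: "finite (carrier R)" using xs(2) by (metis List.finite_set)
  have bij: "bij_betw ((!) xs) {..<length T} (carrier R)" using xs by (intro bij_betw_nth) auto
  have "(\<Sum>j\<in>carrier R. orbit_weight (card (hurwitz_orbit R i j)))
    = (\<Sum>b<length T. orbit_weight (card (hurwitz_orbit R (xs ! a) (xs ! b))))"
    using sum.reindex_bij_betw[OF bij, of "\<lambda>j. orbit_weight (card (hurwitz_orbit R i j))"] a by simp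
  also have "\<dots> \<le> (\<Sum>b<length T. real (twelfths T a b) / 12)"
    by (intro sum_mono weight_le_twelfths[OF R T xs a(2)]) auto
  also have "\<dots> = real (\<Sum>b<length T. twelfths T a b) / 12"
    by (simp add: sum_divide_distrib)
  also have "(\<Sum>b<length T. twelfths T a b) = sum_list (map (twelfths T a) [0..<length T])"
    by (simp add: interv_sum_list_conv_sum_set_nat atLeast0LessThan)
  also have "real \<dots> / 12 \<le> 1" using T a(2) unfolding light_table_def by fastforce
  finally show ?thesis unfolding hurwitz_sum[OF fin] .
qed

lemma light_tables: "light_table D3_table" "light_table T_table" "light_table A_table" "light_table B_table"
  "light_table C_table" "light_table Aff52_table" "light_table Aff53_table" "light_table Aff73_table" "light_table Aff75_table"
  by code_simp+

text \<open>
  The lower bounds \<open>3\<close> and \<open>4\<close> for the orbit sizes of braided and other neighbours give weights of at least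
  \<open>1/6\<close> and \<open>1/4\<close>. If four neighbours are not braided, one orbit of size five or more would push
  the sum to at least \<open>3/10 + 3/4 > 1\<close>.
\<close>

lemma (in conj_quandle) classification_by_weights:
  assumes i: "i \<in> X"
    and three: "\<And>j. j \<in> X \<Longrightarrow> i \<triangleright> j \<noteq> j \<Longrightarrow> s j \<ge> 3"
    and four: "\<And>j. j \<in> X \<Longrightarrow> i \<triangleright> j \<noteq> j \<Longrightarrow> i \<triangleright> j \<triangleright> i \<noteq> j \<Longrightarrow> s j \<ge> 4"
    and square: "\<And>j. j \<in> X \<Longrightarrow> i \<triangleright> j \<noteq> j \<Longrightarrow> i \<triangleright> j \<triangleright> i \<noteq> j \<Longrightarrow> s j = 4 \<Longrightarrow> i \<triangleright> j \<triangleright> i \<triangleright> j = j"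
    and total: "(\<Sum>j\<in>X. orbit_weight (s j)) \<le> 1"
  shows "\<exists>T \<in> {D3_table, T_table, Aff52_table, Aff53_table, A_table, B_table, Aff73_table, Aff75_table, C_table}.
    op_table X (\<triangleright>) T"
proof -
  have nb: "j \<in> X" "i \<triangleright> j \<noteq> j" if "j \<in> N i" for j
    using that N_sub by (auto simp: N_def)
  have not_br: "i \<triangleright> j \<triangleright> i \<noteq> j" if "j \<in> N i" "j \<notin> L i" for j
    using that by (simp add: L_def br_def N_def)
  have s3: "s j \<ge> 3" if "j \<in> N i" for j using three nb[OF that] by blast
  have s4: "s j \<ge> 4" if "j \<in> N i" "j \<notin> L i" for j
    using four nb[OF that(1)] not_br[OF that] by blast
  have sq: "i \<triangleright> j \<triangleright> i \<triangleright> j = j" if "j \<in> N i" "j \<notin> L i" "s j = 4" for j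
    using square nb[OF that(1)] not_br[OF that(1,2)] that(3) by blast
  define w where "w = (\<lambda>j. orbit_weight (s j))"
  have w0: "w j \<ge> 0" for j by (simp add: w_def orbit_weight_nonneg)
  have wL: "w j \<ge> 1 / 6" if "j \<in> L i" for j
    using orbit_weight_mono[OF s3] that L_sub orbit_weight_values(2) unfolding w_def by fastforce
  have wN: "w j \<ge> 1 / 4" if "j \<in> N i - L i" for j
    using orbit_weight_mono[OF s4] that orbit_weight_values(3) unfolding w_def by fastforce
  have "(\<Sum>j\<in>L i \<union> (N i - L i). w j) \<le> (\<Sum>j\<in>X. w j)"
    using L_sub N_sub w0 by (intro sum_mono2[OF finite_X]) auto
  also have "(\<Sum>j\<in>L i \<union> (N i - L i). w j) = (\<Sum>j\<in>L i. w j) + (\<Sum>j\<in>N i - L i. w j)"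
    by (intro sum.union_disjoint) auto
  finally have two: "(\<Sum>j\<in>L i. w j) + (\<Sum>j\<in>N i - L i. w j) \<le> 1" using total by (simp add: w_def)
  have sL: "real (card (L i)) * (1 / 6) \<le> (\<Sum>j\<in>L i. w j)"
    using wL by (intro sum_bounded_below) auto
  have sN: "real (card (N i - L i)) * (1 / 4) \<le> (\<Sum>j\<in>N i - L i. w j)"
    using wN by (intro sum_bounded_below) auto
  have cards: "2 * card (L i) + 3 * card (N i - L i) \<le> 12"
    using two sL sN by linarith
  have lab: "\<forall>j \<in> N i. i \<triangleright> j \<triangleright> i \<triangleright> j = j"
    if four: "card (N i - L i) = 4"
  proof
    fix j assume j: "j \<in> N i"
    have "card (L i) = 0" using cards four by linarith
    then have L: "L i = {}" by simp
    then have jL: "j \<in> N i - L i" using j by simp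
    have "s j = 4"
    proof (rule ccontr)
      assume "s j \<noteq> 4"
      then have "s j \<ge> 5" using s4[OF j] L by fastforce
      then have "w j \<ge> 3 / 10" using orbit_weight_mono[of 5 "s j"] orbit_weight_values(4) by (simp add: w_def)
      moreover have "real (card (N i - L i - {j})) * (1 / 4) \<le> (\<Sum>j\<in>N i - L i - {j}. w j)"
        using wN by (intro sum_bounded_below) auto
      moreover have "card (N i - L i - {j}) = 3" using four jL by (simp add: card_Diff_singleton)
      moreover have "(\<Sum>j\<in>N i - L i. w j) = w j + (\<Sum>j\<in>N i - L i - {j}. w j)"
        using jL by (intro sum.remove) auto
      ultimately show False using two L by simp
    qed
    then show "i \<triangleright> j \<triangleright> i \<triangleright> j = j" using sq[OF j] L by blast
  qed
  show ?thesis using classification[OF i cards lab] by blast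
qed

section \<open>Conjugacy classes\<close>

definition conj_in :: "('a, 'b) monoid_scheme \<Rightarrow> 'a set \<Rightarrow> 'a \<Rightarrow> 'a \<Rightarrow> 'a" where
  "conj_in G X x y = (if x \<in> X \<and> y \<in> X then x \<otimes>\<^bsub>G\<^esub> y \<otimes>\<^bsub>G\<^esub> inv\<^bsub>G\<^esub> x else y)"

text \<open>
  A subset that is closed under conjugation by \<open>X\<close> is closed under conjugation by everything that \<open>X\<close> generates,
  and the group acts transitively on its conjugacy class. For inverses of generators
  this uses that an injective self-map of a finite set is onto.
\<close>

lemma (in group) conjugacy_class_indecomposable:
  assumes X: "is_conjugacy_class G X" and fin: "finite X" and gen: "generate G X = carrier G"
    and A: "A \<subseteq> X" "A \<noteq> {}" "\<And>z a. z \<in> X \<Longrightarrow> a \<in> A \<Longrightarrow> z \<otimes> a \<otimes> inv z \<in> A"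
  shows "A = X"
proof -
  obtain x0 where x0: "x0 \<in> carrier G" "X = conjugacy_class G x0"
    using X by (auto simp: is_conjugacy_class_def)
  have XG: "X \<subseteq> carrier G" using x0 conjugacy_class_subset by simp
  have fA: "finite A" using A(1) fin finite_subset by blast
  have closed: "g \<otimes> a \<otimes> inv g \<in> A" if "g \<in> generate G X" "a \<in> A" for g a
    using that
  proof (induction arbitrary: a rule: generate.induct)
    case one
    then show ?case using A(1) XG by (auto simp: subset_iff)
  next
    case (incl h)
    then show ?case using A(3) by blast
  next
    case (inv h)
    have h: "h \<in> carrier G" using inv XG by blast
    have inj: "inj_on (\<lambda>a. h \<otimes> a \<otimes> inv h) A"
      using conj_automorphism(1)[OF X h] A(1) inj_on_subset by (auto simp: bij_betw_def)
    have "(\<lambda>a. h \<otimes> a \<otimes> inv h) ` A = A"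
      using A(3)[OF inv(1)] by (intro endo_inj_surj[OF fA _ inj]) auto
    then obtain b where b: "b \<in> A" "a = h \<otimes> b \<otimes> inv h" using inv(2) by blast
    have "b \<in> carrier G" using b(1) A(1) XG by blast
    then have "inv h \<otimes> a \<otimes> inv (inv h) = b"
      using conj_conj[of "inv h" h b] h b(2) by simp
    then show ?case using b(1) by simp
  next
    case (eng g h)
    then have "g \<otimes> (h \<otimes> a \<otimes> inv h) \<otimes> inv g \<in> A" by blast
    moreover have "g \<in> carrier G" "h \<in> carrier G" "a \<in> carrier G"
      using eng(1,2,5) gen A(1) XG by auto
    ultimately show ?case by (simp add: conj_conj)
  qed
  have "x \<in> A" if xX: "x \<in> X" for x
  proof -
    obtain a where a: "a \<in> A" using A(2) by blast
    then obtain k where k: "k \<in> carrier G" "a = k \<otimes> x0 \<otimes> inv k"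
      using A(1) x0(2) by (auto simp: conjugacy_class_def)
    obtain g where g: "g \<in> carrier G" "x = g \<otimes> x0 \<otimes> inv g"
      using xX x0(2) by (auto simp: conjugacy_class_def)
    have "(g \<otimes> inv k) \<otimes> a \<otimes> inv (g \<otimes> inv k) = (g \<otimes> inv k \<otimes> k) \<otimes> x0 \<otimes> inv (g \<otimes> inv k \<otimes> k)"
      unfolding k(2) using g(1) k(1) x0(1) by (intro conj_conj) auto
    also have "g \<otimes> inv k \<otimes> k = g" using g(1) k(1) by (simp add: m_assoc)
    finally have "x = (g \<otimes> inv k) \<otimes> a \<otimes> inv (g \<otimes> inv k)" using g(2) by simp
    then show ?thesis using closed[of "g \<otimes> inv k" a] a gen g(1) k(1) by simp
  qed
  then show ?thesis using A(1) by blast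
qed

lemma (in group) conj_eq_iff:
  assumes "g \<in> carrier G" "x \<in> carrier G" "y \<in> carrier G"
  shows "g \<otimes> x \<otimes> inv g = y \<longleftrightarrow> g \<otimes> x = y \<otimes> g"
  using assms inv_solve_right[of y "g \<otimes> x" g] by auto

lemma (in group) conj_quandle_conj_in:
  assumes X: "is_conjugacy_class G X" and fin: "finite X" and card: "card X > 1"
    and gen: "generate G X = carrier G"
  shows "conj_quandle X (conj_in G X)"
proof -
  have XG: "X \<subseteq> carrier G" using X conjugacy_class_subset by (auto simp: is_conjugacy_class_def)
  have cl: "x \<otimes> y \<otimes> inv x \<in> X" if "x \<in> X" "y \<in> X" for x y
    using bij_betw_apply[OF conj_automorphism(1)[OF X]] that XG by blast
  have cinj: "x \<otimes> y \<otimes> inv x = x \<otimes> z \<otimes> inv x \<longleftrightarrow> y = z" if "x \<in> X" "y \<in> X" "z \<in> X" for x y z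
    using conj_automorphism(1)[OF X, of x] that XG by (auto simp: bij_betw_def inj_on_def)
  have idem: "conj_in G X x x = x" for x
    using XG conj_eq_iff[of x x x] by (auto simp: conj_in_def)
  show ?thesis
  proof
    show "finite X" by (rule fin)
    show "X \<noteq> {x}" for x using card by auto
    show "x \<in> X" if "conj_in G X x y \<noteq> y" for x y
      using that by (simp add: conj_in_def split: if_splits)
    show "conj_in G X x y = conj_in G X x z \<longleftrightarrow> y = z" for x y z
      using cl[of x y] cl[of x z] cinj[of x y z] by (auto simp: conj_in_def)
    show "conj_in G X x (conj_in G X y z) = conj_in G X (conj_in G X x y) (conj_in G X x z)" for x y z
      using cl[of x y] cl[of x z] cl[of y z] conj_automorphism(2)[OF X, of x y z] XG
      by (auto simp: conj_in_def)
    show "conj_in G X x x = x" for x by (rule idem)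
    show "conj_in G X y x = x" if "conj_in G X x y = y" for x y
    proof (cases "x \<in> X \<and> y \<in> X")
      case True
      then have "x \<in> carrier G" "y \<in> carrier G" using XG by auto
      then show ?thesis using that True conj_eq_iff[of x y y] conj_eq_iff[of y x x]
        by (simp add: conj_in_def)
    qed (auto simp: conj_in_def)
    show "conj_in G X y (conj_in G X x y) = x" if a: "conj_in G X x (conj_in G X y x) = y" for x y
    proof (cases "x \<in> X \<and> y \<in> X")
      case True
      then have c: "x \<in> carrier G" "y \<in> carrier G" using XG by auto
      have "(x \<otimes> y) \<otimes> x \<otimes> inv (x \<otimes> y) = y"
        using a True cl[of y x] conj_conj[OF c c(1)] by (simp add: conj_in_def)
      then have "(x \<otimes> y) \<otimes> x = y \<otimes> (x \<otimes> y)" using conj_eq_iff[of "x \<otimes> y" x y] c by simp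
      then have "(y \<otimes> x) \<otimes> y = x \<otimes> (y \<otimes> x)" using c by (simp add: m_assoc)
      then have "(y \<otimes> x) \<otimes> y \<otimes> inv (y \<otimes> x) = x" using conj_eq_iff[of "y \<otimes> x" y x] c by simp
      then show ?thesis
        using True cl[of x y] conj_conj[OF c(2) c(1) c(2)] by (simp add: conj_in_def)
    next
      case False
      then have "conj_in G X y x = x" by (auto simp: conj_in_def)
      then have "y = x" using a idem by simp
      then show ?thesis using idem by simp
    qed
    show "A = X" if "A \<subseteq> X" "A \<noteq> {}" "\<And>z a. a \<in> A \<Longrightarrow> conj_in G X z a \<in> A" for A
    proof (rule conjugacy_class_indecomposable[OF X fin gen that(1,2)])
      fix z a assume "z \<in> X" "a \<in> A"
      then show "z \<otimes> a \<otimes> inv z \<in> A" using that(3)[of a z] that(1) by (auto simp: conj_in_def)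
    qed
  qed
qed

lemma (in group) light_conjugacy_class_table:
  assumes X: "is_conjugacy_class G X" and fin: "finite X" and card: "card X > 1"
    and gen: "generate G X = carrier G" and i: "i \<in> X"
    and le: "(\<Sum>\<^sub>\<infinity>n\<in>{3..}. (real n - 2) / (2 * real n) * real (hurwitz_orbit_count (conjugation_rack G X) i n)) \<le> 1"
  shows "\<exists>T \<in> {D3_table, T_table, Aff52_table, Aff53_table, A_table, B_table, Aff73_table, Aff75_table, C_table}.
    op_table (carrier (conjugation_rack G X)) (rack_op (conjugation_rack G X)) T"
proof -
  have Q: "conj_quandle X (conj_in G X)" by (rule conj_quandle_conj_in[OF assms(1-4)])
  note dist = conj_quandle.dist[OF Q] and inj = conj_quandle.inj[OF Q] and comm = conj_quandle.comm[OF Q]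
    and idem = conj_quandle.idem[OF Q] and act_in = conj_quandle.act_in[OF Q]
  let ?R = "conjugation_rack G X"
  have R: "is_rack ?R" by (rule is_rack_conjugation_rack[OF X])
  have car: "carrier ?R = X" by (simp add: conjugation_rack_def)
  have op: "rack_op ?R x y = conj_in G X x y" if "x \<in> X" "y \<in> X" for x y
    using that by (simp add: conjugation_rack_def conj_in_def)
  define s where "s = (\<lambda>j. card (hurwitz_orbit ?R i j))"
  have facts: "s j \<ge> 3" "conj_in G X i (conj_in G X j i) \<noteq> j \<Longrightarrow> s j \<ge> 4"
    "conj_in G X i (conj_in G X j i) \<noteq> j \<Longrightarrow> s j = 4 \<Longrightarrow>
      conj_in G X i (conj_in G X j (conj_in G X i j)) = j"
    if jX: "j \<in> X" and ne: "conj_in G X i j \<noteq> j" for j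
  proof -
    note lower = hurwitz_orbit_lower[OF R, unfolded car, OF fin i jX]
    have c: "conj_in G X i j \<in> X" "conj_in G X j i \<in> X" using act_in i jX by auto
    have cc: "conj_in G X (conj_in G X i j) i = conj_in G X i (conj_in G X j i)"
      using dist[of i j i] idem by simp
    have ri: "rack_op ?R x x = x" if "x \<in> X" for x using op that idem by simp
    have ne': "rack_op ?R i j \<noteq> j" using ne op i jX by simp
    show "s j \<ge> 3" unfolding s_def using lower(1) ri ne' by blast
    assume b: "conj_in G X i (conj_in G X j i) \<noteq> j"
    have b': "conj_in G X i (conj_in G X j i) \<noteq> i"
      using inj[of i "conj_in G X j i" i] comm[of j i] ne idem by auto
    have e: "rack_op ?R (rack_op ?R i j) i = conj_in G X i (conj_in G X j i)"
      using op i jX c cc by simp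
    show "s j \<ge> 4" unfolding s_def using lower(2) ri ne' e b b' by metis
    assume "s j = 4"
    then have "rack_op ?R (rack_op ?R (rack_op ?R i j) i) (rack_op ?R i j) = j"
      unfolding s_def using lower(3) ri ne' e b b' by metis
    then have "conj_in G X (conj_in G X i (conj_in G X j i)) (conj_in G X i j) = j"
      unfolding e using op i jX c act_in by simp
    then show "conj_in G X i (conj_in G X j (conj_in G X i j)) = j"
      using dist[of i "conj_in G X j i" j] dist[of j i j] idem by simp
  qed
  have total: "(\<Sum>j\<in>X. orbit_weight (s j)) \<le> 1"
    using le unfolding hurwitz_sum[of ?R i, unfolded car, OF fin] by (simp add: s_def)
  obtain T where T: "T \<in> {D3_table, T_table, Aff52_table, Aff53_table, A_table, B_table, Aff73_table, Aff75_table, C_table}"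
    "op_table X (conj_in G X) T"
    using conj_quandle.classification_by_weights[OF Q i facts total] by blast
  have "op_table (carrier ?R) (rack_op ?R) T"
    unfolding car by (rule op_table_cong[OF T(2)]) (simp add: op)
  then show ?thesis using T(1) by blast
qed

section \<open>Operation tables of the nine racks\<close>

lemma affine_residue_op:
  assumes "m > 1" "x \<in> {0..<m}" "y \<in> {0..<m}" "\<alpha> \<in> {0..<m}"
  shows "rack_op (affine_rack (residue_ring m) \<alpha>) x y = ((1 - \<alpha>) * x + \<alpha> * y) mod m"
proof -
  have "residues m" using assms(1) by (simp add: residues_def)
  then show ?thesis
    by (simp add: affine_rack_def a_minus_def residues.res_neg_eq residues.res_one_eq
        residues.res_mult_eq residues.res_add_eq mod_simps)
qed

lemma carrier_affine_residue: "carrier (affine_rack (residue_ring m) \<alpha>) = {0..m - 1}"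
  by (simp add: affine_rack_def residue_ring_def)

lemma Aff52_op_table: "op_table (carrier (affine_rack (residue_ring 5) 2)) (rack_op (affine_rack (residue_ring 5) 2)) Aff52_table"
\<comment> \<open>After \<open>0\<close> the powers of the parameter are listed; multiplication by it is then the rotation in the first row.\<close>
proof (rule op_tableI[of "[0, 1, 2, 4, 3]"])
  have "{0..4} = {0, 1, 2, 3, 4 :: int}" by auto
  then show "set [0, 1, 2, 4, 3] = carrier (affine_rack (residue_ring 5) 2)"
    by (auto simp: carrier_affine_residue)
qed (simp_all add: affine_residue_op Aff52_table_def)

lemma Aff53_op_table: "op_table (carrier (affine_rack (residue_ring 5) 3)) (rack_op (affine_rack (residue_ring 5) 3)) Aff53_table"
proof (rule op_tableI[of "[0, 1, 3, 4, 2]"])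
  have "{0..4} = {0, 1, 2, 3, 4 :: int}" by auto
  then show "set [0, 1, 3, 4, 2] = carrier (affine_rack (residue_ring 5) 3)"
    by (auto simp: carrier_affine_residue)
qed (simp_all add: affine_residue_op Aff53_table_def)

lemma Aff73_op_table: "op_table (carrier (affine_rack (residue_ring 7) 3)) (rack_op (affine_rack (residue_ring 7) 3)) Aff73_table"
proof (rule op_tableI[of "[0, 1, 3, 2, 6, 4, 5]"])
  have "{0..6} = {0, 1, 2, 3, 4, 5, 6 :: int}" by auto
  then show "set [0, 1, 3, 2, 6, 4, 5] = carrier (affine_rack (residue_ring 7) 3)"
    by (auto simp: carrier_affine_residue)
qed (simp_all add: affine_residue_op Aff73_table_def)

lemma Aff75_op_table: "op_table (carrier (affine_rack (residue_ring 7) 5)) (rack_op (affine_rack (residue_ring 7) 5)) Aff75_table"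
proof (rule op_tableI[of "[0, 1, 5, 4, 6, 2, 3]"])
  have "{0..6} = {0, 1, 2, 3, 4, 5, 6 :: int}" by auto
  then show "set [0, 1, 5, 4, 6, 2, 3] = carrier (affine_rack (residue_ring 7) 5)"
    by (auto simp: carrier_affine_residue)
qed (simp_all add: affine_residue_op Aff75_table_def)

lemma B_op_table: "op_table (carrier B_rack) (rack_op B_rack) B_table"
\<comment> \<open>\<open>1\<close> and \<open>6\<close> are opposite in the octahedron, and \<open>2, 3, 4, 5\<close> is the cycle of \<open>1\<close>.\<close>
proof (rule op_tableI[of "[1, 6, 2, 3, 4, 5]"])
  have "{1..6} = {1, 2, 3, 4, 5, 6 :: nat}" by auto
  then show "set [1, 6, 2, 3, 4, 5] = carrier B_rack" by (auto simp: B_rack_def)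
qed (simp_all add: B_rack_def B_perm_def B_table_def transpose_def)

lemma D3_op_table: "op_table (carrier D3_rack) (rack_op D3_rack) D3_table"
proof (rule op_tableI[of "[(0, True), (1, True), (2, True)]"])
  have inv: "inv\<^bsub>dihedral_group 3\<^esub> (a, True) = (a, True)" if "a \<in> {0, 1, 2}" for a
    by (rule group.inv_equality[OF group_dihedral_group]) (use that in \<open>auto simp: dihedral_group_def\<close>)
  have op: "rack_op D3_rack x y = x \<otimes>\<^bsub>dihedral_group 3\<^esub> y \<otimes>\<^bsub>dihedral_group 3\<^esub> inv\<^bsub>dihedral_group 3\<^esub> x" for x y
    by (simp add: D3_rack_def Let_def conjugation_rack_def)
  show "map (\<lambda>x. map (rack_op D3_rack x) [(0, True), (1, True), (2, True)]) [(0, True), (1, True), (2, True)] =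
      map (map ((!) [(0, True), (1, True), (2, True)])) D3_table"
    by (simp add: op inv D3_table_def) (simp add: dihedral_group_def)
qed (auto simp: D3_carrier)

lemma conj_transpose:
  assumes "bij p"
  shows "p \<circ> transpose a b \<circ> inv' p = transpose (p a) (p b)"
proof (cases "a = b")
  case False
  then show ?thesis using conjugation_of_cycle[of "[a, b]" p] assms by simp
next
  case True
  then show ?thesis using surj_iff[of p] bij_is_surj[OF assms] by simp
qed

lemma sym_group_transposition_class:
  assumes "n \<ge> 2"
  shows "conjugacy_class (sym_group n) (cycle_of_list [1, 2]) = {transpose a b |a b. a \<in> {1..n} \<and> b \<in> {1..n} \<and> a \<noteq> b}"
proof (intro equalityI subsetI)
  fix x assume "x \<in> conjugacy_class (sym_group n) (cycle_of_list [1, 2])"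
  then obtain p where p: "p permutes {1..n}" "x = p \<circ> transpose 1 2 \<circ> inv' p"
    unfolding conjugacy_class_def
    using sym_group_inv_equality by (auto simp: sym_group_carrier sym_group_mult)
  have "x = transpose (p 1) (p 2)" using conj_transpose[OF permutes_bij[OF p(1)], of 1 2] p(2) by simp
  moreover have "p 1 \<noteq> p 2" using permutes_inj[OF p(1)] by (simp add: inj_eq)
  moreover have "p 1 \<in> {1..n}" "p 2 \<in> {1..n}" using permutes_in_image[OF p(1)] assms by auto
  ultimately show "x \<in> {transpose a b |a b. a \<in> {1..n} \<and> b \<in> {1..n} \<and> a \<noteq> b}" by blast
next
  fix x assume "x \<in> {transpose a b |a b. a \<in> {1..n} \<and> b \<in> {1..n} \<and> a \<noteq> b}"
  then obtain a b where ab: "a \<in> {1..n}" "b \<in> {1..n}" "a \<noteq> b" "x = transpose a b" by blast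
  define c where "c = transpose 1 a b"
  define p where "p = transpose 1 a \<circ> transpose 2 c"
  have c: "c \<in> {1..n}" "c \<noteq> 1" using ab assms by (auto simp: c_def transpose_def split: if_splits)
  have p: "p permutes {1..n}" unfolding p_def
    using ab(1) c assms by (intro permutes_compose permutes_swap_id) auto
  have "transpose 2 c 1 = 1" "transpose 1 a c = b" using c(2) by (simp_all add: transpose_apply_other c_def)
  then have "p 1 = a" "p 2 = b" by (simp_all add: p_def)
  then have "x = p \<circ> transpose 1 2 \<circ> inv' p" using conj_transpose[OF permutes_bij[OF p], of 1 2] ab(4) by simp
  then show "x \<in> conjugacy_class (sym_group n) (cycle_of_list [1, 2])"
    unfolding conjugacy_class_def using p sym_group_inv_equality[of p n]
    by (auto simp: sym_group_carrier sym_group_mult intro!: exI[of _ p])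
qed

lemma sym_conjugation_op:
  assumes "p permutes {1..n}"
  shows "rack_op (conjugation_rack (sym_group n) X) p q = p \<circ> q \<circ> inv' p"
  using sym_group_inv_equality[of p n] assms
  by (simp add: conjugation_rack_def sym_group_carrier sym_group_mult)

lemma transposition_op:
  assumes "a \<in> {1..n}" "b \<in> {1..n}"
  shows "rack_op (conjugation_rack (sym_group n) X) (transpose a b) (transpose c d)
    = transpose (transpose a b c) (transpose a b d)"
  using sym_conjugation_op[OF permutes_swap_id[OF assms]] conj_transpose[of "transpose a b" c d] by simp

lemma transpose_eq_iff:
  assumes "a < b" "c < d"
  shows "transpose a b = transpose c d \<longleftrightarrow> a = c \<and> b = (d :: nat)"
proof
  assume e: "transpose a b = transpose c d"
  have "transpose c d a = b" "transpose c d b = a" using fun_cong[OF e, of a] fun_cong[OF e, of b] by simp_all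
  then show "a = c \<and> b = d" using assms by (auto simp: transpose_def split: if_splits)
qed simp

lemma A_op_table: "op_table (carrier A_rack) (rack_op A_rack) A_table"
proof (rule op_tableI)
  let ?xs = "[transpose 1 2, transpose 1 3, transpose 2 3, transpose 1 4, transpose 2 4, transpose 3 4] :: (nat \<Rightarrow> nat) list"
  show "distinct ?xs" by (simp add: transpose_eq_iff)
  have e: "{1..4} = {1, 2, 3, 4 :: nat}" by auto
  have "{transpose a b |a b. a \<in> {1..4} \<and> b \<in> {1..4} \<and> a \<noteq> b} = set ?xs"
    unfolding e
    by (auto simp: transpose_commute) (rule exI, rule exI, rule conjI, rule refl, simp)+
  then show "set ?xs = carrier A_rack"
    using sym_group_transposition_class[of 4] by (simp add: A_rack_def conjugation_rack_def)
  show "map (\<lambda>x. map (rack_op A_rack x) ?xs) ?xs = map (map ((!) ?xs)) A_table"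
    unfolding A_rack_def
    by (simp add: transposition_op A_table_def) (simp add: transpose_def transpose_commute)
qed

lemma C_op_table: "op_table (carrier C_rack) (rack_op C_rack) C_table"
proof (rule op_tableI)
  let ?xs = "[transpose 1 2, transpose 1 3, transpose 2 3, transpose 1 4, transpose 2 4,
    transpose 1 5, transpose 2 5, transpose 3 4, transpose 3 5, transpose 4 5] :: (nat \<Rightarrow> nat) list"
  show "distinct ?xs" by (simp add: transpose_eq_iff)
  have e: "{1..5} = {1, 2, 3, 4, 5 :: nat}" by auto
  have "{transpose a b |a b. a \<in> {1..5} \<and> b \<in> {1..5} \<and> a \<noteq> b} = set ?xs"
    unfolding e
    by (auto simp: transpose_commute) (rule exI, rule exI, rule conjI, rule refl, simp)+
  then show "set ?xs = carrier C_rack"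
    using sym_group_transposition_class[of 5] by (simp add: C_rack_def conjugation_rack_def)
  show "map (\<lambda>x. map (rack_op C_rack x) ?xs) ?xs = map (map ((!) ?xs)) C_table"
    unfolding C_rack_def
    by (simp add: transposition_op C_table_def) (simp add: transpose_def transpose_commute)
qed

text \<open>
  The class of \<open>(2 3 4)\<close> consists of the cycles \<open>(p 2, p 3, p 4)\<close> for even permutations \<open>p\<close>. Writing \<open>p\<close> as a product of
  transpositions \<open>(4 a) (3 b) (2 c)\<close> reduces their enumeration to finitely many cases.
\<close>

lemma T_op_table: "op_table (carrier T_rack) (rack_op T_rack) T_table"
proof (rule op_tableI)
  let ?t = "cycle_of_list [2, 3, 4 :: nat]"
  let ?xs = "[?t, cycle_of_list [1, 4, 3], cycle_of_list [1, 2, 4], cycle_of_list [1, 3, 2]] :: (nat \<Rightarrow> nat) list"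
  have e: "{1..4} = {1, 2, 3, 4 :: nat}" by auto
  have conj: "p \<circ> cycle_of_list [a, b, c] \<circ> inv' p = cycle_of_list [p a, p b, p c]"
    if "p permutes {1..4}" "distinct [a, b, c]" for p and a b c :: nat
    using conjugation_of_cycle[OF that(2) permutes_bij[OF that(1)]] by simp
  have perm: "cycle_of_list [a, b, c] permutes {1..4}" if "set [a, b, c] \<subseteq> {1..4}" for a b c :: nat
    using that by (auto intro!: permutes_compose permutes_swap_id)
  have ev: "evenperm (cycle_of_list [a, b, c])" if "distinct [a, b, c]" for a b c :: nat
    using that by (simp add: evenperm_comp evenperm_swap permutation_swap_id)
  have inv: "inv\<^bsub>alt_group 4\<^esub> p = inv' p" if "p permutes {1..4}" "evenperm p" for p
    using alt_group_inv_equality that by (simp add: alt_group_carrier)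
  have op: "rack_op T_rack (cycle_of_list [a, b, c]) (cycle_of_list [d, e, f])
      = cycle_of_list [cycle_of_list [a, b, c] d, cycle_of_list [a, b, c] e, cycle_of_list [a, b, c] f]"
    if "distinct [a, b, c]" "set [a, b, c] \<subseteq> {1..4}" "distinct [d, e, f]" for a b c d e f :: nat
    using inv[OF perm[OF that(2)] ev[OF that(1)]] conj[OF perm[OF that(2)] that(3)]
    by (simp only: T_rack_def conjugation_rack_def rack.simps alt_group_mult)
  show "distinct ?xs"
    by (auto simp: fun_eq_iff transpose_def split: if_splits dest: spec[of _ 1] spec[of _ 2])
  show "map (\<lambda>x. map (rack_op T_rack x) ?xs) ?xs = map (map ((!) ?xs)) T_table"
    by (simp add: op T_table_def del: cycle_of_list.simps) (simp add: fun_eq_iff transpose_def)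
  have rots: "cycle_of_list [3, 4, 2] = ?t" "cycle_of_list [4, 2, 3] = ?t"
    "cycle_of_list [4, 3, 1] = cycle_of_list [1, 4, 3 :: nat]" "cycle_of_list [3, 1, 4] = cycle_of_list [1, 4, 3 :: nat]"
    "cycle_of_list [2, 4, 1] = cycle_of_list [1, 2, 4 :: nat]" "cycle_of_list [4, 1, 2] = cycle_of_list [1, 2, 4 :: nat]"
    "cycle_of_list [3, 2, 1] = cycle_of_list [1, 3, 2 :: nat]" "cycle_of_list [2, 1, 3] = cycle_of_list [1, 3, 2 :: nat]"
    by (auto simp: fun_eq_iff transpose_def)
  have image: "p \<otimes>\<^bsub>alt_group 4\<^esub> ?t \<otimes>\<^bsub>alt_group 4\<^esub> inv\<^bsub>alt_group 4\<^esub> p = cycle_of_list [p 2, p 3, p 4]"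
    if "p permutes {1..4}" "evenperm p" for p
    using conj[OF that(1), of 2 3 4] inv[OF that] by (simp add: alt_group_mult del: cycle_of_list.simps)
  have "carrier T_rack = {p \<otimes>\<^bsub>alt_group 4\<^esub> ?t \<otimes>\<^bsub>alt_group 4\<^esub> inv\<^bsub>alt_group 4\<^esub> p |p. p permutes {1..4} \<and> evenperm p}"
    by (simp only: T_rack_def conjugation_rack_def conjugacy_class_def partial_object.simps alt_group_carrier)
  also have "\<dots> = {cycle_of_list [p 2, p 3, p 4] |p. p permutes {1..4} \<and> evenperm p}"
    by (intro Collect_cong ex_cong1) (metis image)
  finally have cls: "carrier T_rack = {cycle_of_list [p 2, p 3, p 4] |p. p permutes {1..4} \<and> evenperm p}" .
  have mem: "cycle_of_list [u, v, w] \<in> carrier T_rack"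
    if "(u, v, w) \<in> {(2, 3, 4), (1, 4, 3), (1, 2, 4), (1, 3, 2)}" for u v w :: nat
  proof -
    \<comment> \<open>An even permutation that moves \<open>1\<close> to the fixed point of the cycle.\<close>
    define p :: "nat \<Rightarrow> nat" where
      "p = (if u = 2 then id else if v = 4 then transpose 1 2 \<circ> transpose 3 4
        else if v = 2 then transpose 1 3 \<circ> transpose 2 4 else transpose 1 4 \<circ> transpose 2 3)"
    have "p permutes {1..4}" unfolding p_def
      by (auto intro!: permutes_compose permutes_swap_id permutes_id)
    moreover have "evenperm p" unfolding p_def
      by (simp add: evenperm_comp evenperm_swap permutation_swap_id)
    moreover have "cycle_of_list [p 2, p 3, p 4] = cycle_of_list [u, v, w]"
      using that by (auto simp: p_def rots transpose_def simp del: cycle_of_list.simps One_nat_def)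
    ultimately show ?thesis unfolding cls by (intro CollectI exI[of _ p]) simp
  qed
  show "set ?xs = carrier T_rack"
  proof
    show "set ?xs \<subseteq> carrier T_rack"
      using mem[of 2 3 4] mem[of 1 4 3] mem[of 1 2 4] mem[of 1 3 2]
      by (simp del: cycle_of_list.simps One_nat_def)
  next
    show "carrier T_rack \<subseteq> set ?xs"
    proof
    fix x assume "x \<in> carrier T_rack"
    then obtain p where p: "x = cycle_of_list [p 2, p 3, p 4]" "p permutes {1..4}" "evenperm p"
      unfolding cls by blast
    have split: "\<exists>b q. b \<in> insert a S \<and> q permutes S \<and> p = transpose a b \<circ> q" if "p permutes insert a S" for a S and p :: "nat \<Rightarrow> nat"
    proof -
      have "p \<in> {p. p permutes insert a S}" using that by simp
      then show ?thesis unfolding permutes_insert by auto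
    qed
    have "{1..4} = insert 4 (insert 3 (insert 2 {1 :: nat}))" by auto
    then obtain a p3 where a: "a \<in> {4, 3, 2, 1}" "p3 permutes insert 3 (insert 2 {1})" "p = transpose 4 a \<circ> p3"
      using split p(2) by metis
    obtain b p2 where b: "b \<in> {3, 2, 1}" "p2 permutes insert 2 {1}" "p3 = transpose 3 b \<circ> p2"
      using split[OF a(2)] by metis
    obtain c p1 where c: "c \<in> {2, 1}" "p1 permutes {1}" "p2 = transpose 2 c \<circ> p1"
      using split[OF b(2)] by metis
    have "p1 = id" using c(2) by simp
    then have p': "p = transpose 4 a \<circ> (transpose 3 b \<circ> transpose 2 c)" using a b c by simp
    have "evenperm p \<longleftrightarrow> (4 = a \<longleftrightarrow> (3 = b \<longleftrightarrow> 2 = c))"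
      unfolding p' by (simp add: evenperm_comp evenperm_swap permutation_swap_id permutation_compose)
    then show "x \<in> set ?xs"
      using p(1,3) a(1) b(1) c(1) unfolding p'
      by (elim insertE emptyE) (simp_all add: rots transpose_def del: cycle_of_list.simps One_nat_def)
    qed
  qed
qed

section \<open>The equivalence\<close>

lemma isomorphic_op_table:
  assumes R: "is_rack R" and iso: "R \<cong>\<^sub>R S"
    and T: "op_table (carrier S) (rack_op S) T" "light_table T"
  shows "op_table (carrier R) (rack_op R) T"
proof -
  obtain h where h: "h \<in> rack_hom R S" "bij_betw h (carrier R) (carrier S)"
    using iso by (auto simp: rack_isomorphic_def)
  have "rack_op R x y \<in> carrier R \<and> h (rack_op R x y) = rack_op S (h x) (h y)"
    if "x \<in> carrier R" "y \<in> carrier R" for x y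
    using that R h(1) bij_betw_apply[of "rack_op R x" "carrier R" "carrier R" y]
    by (simp add: is_rack_def rack_hom_def)
  then show ?thesis
    using op_table_transfer[OF T(1) h(2)] T(2) by (simp add: light_table_def)
qed

lemma (in group) light_sum_iff_isomorphic:
  assumes X: "is_conjugacy_class G X" "finite X" "card X > 1" "generate G X = carrier G" and i: "i \<in> X"
  shows "(\<Sum>\<^sub>\<infinity>n\<in>{3..}. (real n - 2) / (2 * real n) * real (hurwitz_orbit_count (conjugation_rack G X) i n)) \<le> 1
    \<longleftrightarrow>
      (conjugation_rack G X \<cong>\<^sub>R D3_rack \<or>
       conjugation_rack G X \<cong>\<^sub>R T_rack \<or>
       conjugation_rack G X \<cong>\<^sub>R affine_rack (residue_ring 5) 2 \<or>
       conjugation_rack G X \<cong>\<^sub>R affine_rack (residue_ring 5) 3 \<or>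
       conjugation_rack G X \<cong>\<^sub>R A_rack \<or>
       conjugation_rack G X \<cong>\<^sub>R B_rack \<or>
       conjugation_rack G X \<cong>\<^sub>R affine_rack (residue_ring 7) 3 \<or>
       conjugation_rack G X \<cong>\<^sub>R affine_rack (residue_ring 7) 5 \<or>
       conjugation_rack G X \<cong>\<^sub>R C_rack)"
proof -
  let ?R = "conjugation_rack G X"
  have R: "is_rack ?R" by (rule is_rack_conjugation_rack[OF X(1)])
  have iR: "i \<in> carrier ?R" using i by (simp add: conjugation_rack_def)
  have iff: "op_table (carrier ?R) (rack_op ?R) T \<longleftrightarrow> ?R \<cong>\<^sub>R S"
    if "op_table (carrier S) (rack_op S) T" "light_table T" for S :: "'c rack" and T
  proof
    assume "op_table (carrier ?R) (rack_op ?R) T"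
    from op_table_isomorphic[OF this that(1)] show "?R \<cong>\<^sub>R S"
      using that(2) by (simp add: light_table_def)
  qed (rule isomorphic_op_table[OF R _ that])
  let ?table = "op_table (carrier ?R) (rack_op ?R)"
  have "?thesis \<longleftrightarrow>
    ((\<Sum>\<^sub>\<infinity>n\<in>{3..}. (real n - 2) / (2 * real n) * real (hurwitz_orbit_count ?R i n)) \<le> 1 \<longleftrightarrow>
      (?table D3_table \<or> ?table T_table \<or> ?table Aff52_table \<or> ?table Aff53_table \<or> ?table A_table \<or>
       ?table B_table \<or> ?table Aff73_table \<or> ?table Aff75_table \<or> ?table C_table))"
    unfolding iff[OF D3_op_table light_tables(1)] iff[OF T_op_table light_tables(2)]
      iff[OF A_op_table light_tables(3)] iff[OF B_op_table light_tables(4)] iff[OF C_op_table light_tables(5)]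
      iff[OF Aff52_op_table light_tables(6)] iff[OF Aff53_op_table light_tables(7)]
      iff[OF Aff73_op_table light_tables(8)] iff[OF Aff75_op_table light_tables(9)] ..
  then show ?thesis
    using light_conjugacy_class_table[OF X i] light_table_sum[OF R _ _ iR] light_tables by blast
qed

theorem theorem2p37:
  fixes G (structure) and X and i
  assumes "group G"
    and "is_conjugacy_class G X"
    and "finite X" and "card X > 1"
    and "generate G X = carrier G"
    and "i \<in> X"
  shows "(\<Sum>\<^sub>\<infinity>n\<in>{3..}. (real n - 2) / (2 * real n) * real (hurwitz_orbit_count (conjugation_rack G X) i n)) \<le> 1
    \<longleftrightarrow>
      (conjugation_rack G X \<cong>\<^sub>R D3_rack \<or>
       conjugation_rack G X \<cong>\<^sub>R T_rack \<or>
       conjugation_rack G X \<cong>\<^sub>R affine_rack (residue_ring 5) 2 \<or>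
       conjugation_rack G X \<cong>\<^sub>R affine_rack (residue_ring 5) 3 \<or>
       conjugation_rack G X \<cong>\<^sub>R A_rack \<or>
       conjugation_rack G X \<cong>\<^sub>R B_rack \<or>
       conjugation_rack G X \<cong>\<^sub>R affine_rack (residue_ring 7) 3 \<or>
       conjugation_rack G X \<cong>\<^sub>R affine_rack (residue_ring 7) 5 \<or>
       conjugation_rack G X \<cong>\<^sub>R C_rack)"
  using group.light_sum_iff_isomorphic[OF assms] .

end
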